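(* Let $\mathcal{D}=(\mathcal{P},\mathcal{B})$ be a nontrivial Steiner $3$-design and let $G\leq \mathrm{Aut}(\mathcal{D})$ act transitively on the set of blocks $\mathcal{B}$ and primitively on the set of points $\mathcal{P}$. Then, in the O'Nan–Scott classification of finite primitive permutation groups, $G$ is of affine type or of almost simple type.
   Context: A $t$-$(v,k,\lambda)$ design $\mathcal{D}=(\mathcal{P},\mathcal{B})$ consists of a finite set $\mathcal{P}$ of $v$ points and a set $\mathcal{B}$ of $k$-element subsets of $\mathcal{P}$ (blocks) such that any $t$ distinct points lie in exactly $\lambda$ blocks. It is nontrivial if $t<k<v-t$. A Steiner $3$-design is a $3$-$(v,k,1)$ design. An automorphism is a permutation of $\mathcal{P}$ mapping blocks to blocks; $\mathrm{Aut}(\mathcal{D})$ is the group of all automorphisms. The O'Nan–Scott theorem states that a finite primitive permutation group is permutation isomorphic to a group of exactly one of the types: affine, almost simple, simple diagonal, product, twisted wreath. *)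

theory Defs
  imports "HOL-Algebra.Group_Action" "HOL-Algebra.SimpleGroups"
begin

definition is_design :: "nat \<Rightarrow> nat \<Rightarrow> nat \<Rightarrow> nat \<Rightarrow> 'a set \<Rightarrow> 'a set set \<Rightarrow> bool" where
  "is_design t v k l P \<B> \<longleftrightarrow>
     finite P \<and> card P = v \<and>
     (\<forall>b\<in>\<B>. b \<subseteq> P \<and> card b = k) \<and>
     (\<forall>S. S \<subseteq> P \<and> card S = t \<longrightarrow> card {b \<in> \<B>. S \<subseteq> b} = l)"

definition nontrivial_design :: "nat \<Rightarrow> nat \<Rightarrow> nat \<Rightarrow> nat \<Rightarrow> 'a set \<Rightarrow> 'a set set \<Rightarrow> bool" where
  "nontrivial_design t v k l P \<B> \<longleftrightarrow> is_design t v k l P \<B> \<and> t < k \<and> k < v - t"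

definition nontrivial_steiner_3_design :: "nat \<Rightarrow> nat \<Rightarrow> 'a set \<Rightarrow> 'a set set \<Rightarrow> bool" where
  "nontrivial_steiner_3_design v k P \<B> \<longleftrightarrow> nontrivial_design 3 v k 1 P \<B>"

definition design_Aut :: "'a set \<Rightarrow> 'a set set \<Rightarrow> ('a \<Rightarrow> 'a) monoid" where
  "design_Aut P \<B> = BijGroup P \<lparr>carrier := {g \<in> Bij P. \<forall>b\<in>\<B>. g ` b \<in> \<B>}\<rparr>"

text \<open>The action of a group of permutations of the points on the set \<open>\<B>\<close> of blocks
  (extensional on \<open>\<B>\<close>, as required by \<^const>\<open>BijGroup\<close>).\<close>

definition block_action :: "'a set set \<Rightarrow> ('a \<Rightarrow> 'a) \<Rightarrow> 'a set \<Rightarrow> 'a set" where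
  "block_action \<B> g = (\<lambda>b\<in>\<B>. g ` b)"

definition primitive_action ::
    "('g, 'm) monoid_scheme \<Rightarrow> 'a set \<Rightarrow> ('g \<Rightarrow> 'a \<Rightarrow> 'a) \<Rightarrow> bool" where
  "primitive_action G E \<phi> \<longleftrightarrow>
     transitive_action G E \<phi> \<and>
     (\<forall>\<Delta>. \<Delta> \<subseteq> E \<and> \<Delta> \<noteq> {} \<and>
           (\<forall>g\<in>carrier G. \<phi> g ` \<Delta> = \<Delta> \<or> \<phi> g ` \<Delta> \<inter> \<Delta> = {})
        \<longrightarrow> card \<Delta> = 1 \<or> \<Delta> = E)"

definition perm_isomorphic ::
    "('a \<Rightarrow> 'a, 'm) monoid_scheme \<Rightarrow> 'a set \<Rightarrow> ('b \<Rightarrow> 'b, 'n) monoid_scheme \<Rightarrow> 'b set \<Rightarrow> bool" where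
  "perm_isomorphic G E H F \<longleftrightarrow>
     (\<exists>\<psi>\<in>iso G H. \<exists>f. bij_betw f E F \<and>
        (\<forall>g\<in>carrier G. \<forall>x\<in>E. f (g x) = \<psi> g (f x)))"

text \<open>The vector space of \<open>d\<close>-tuples over the field with \<open>p\<close> elements, the latter being
  represented by the residues \<open>0, \<dots>, p - 1\<close>.\<close>

definition fp_space :: "nat \<Rightarrow> nat \<Rightarrow> (nat \<Rightarrow> nat) set" where
  "fp_space p d = {..<d} \<rightarrow>\<^sub>E {..<p}"

definition fp_affine_map ::
    "nat \<Rightarrow> nat \<Rightarrow> (nat \<Rightarrow> nat \<Rightarrow> nat) \<Rightarrow> (nat \<Rightarrow> nat) \<Rightarrow> (nat \<Rightarrow> nat) \<Rightarrow> (nat \<Rightarrow> nat)" where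
  "fp_affine_map p d A b =
     (\<lambda>x\<in>fp_space p d. \<lambda>i\<in>{..<d}. ((\<Sum>j<d. A i j * x j) + b i) mod p)"

definition AGL :: "nat \<Rightarrow> nat \<Rightarrow> ((nat \<Rightarrow> nat) \<Rightarrow> (nat \<Rightarrow> nat)) set" where
  "AGL d p = {h \<in> Bij (fp_space p d). \<exists>A b. h = fp_affine_map p d A b}"

definition fp_translations :: "nat \<Rightarrow> nat \<Rightarrow> ((nat \<Rightarrow> nat) \<Rightarrow> (nat \<Rightarrow> nat)) set" where
  "fp_translations d p = {fp_affine_map p d (\<lambda>i j. if i = j then 1 else 0) b | b. True}"

definition affine_type :: "('a \<Rightarrow> 'a, 'm) monoid_scheme \<Rightarrow> 'a set \<Rightarrow> bool" where
  "affine_type G P \<longleftrightarrow>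
     (\<exists>p d H. prime p \<and> d \<ge> 1 \<and>
        subgroup H (BijGroup (fp_space p d)) \<and>
        fp_translations d p \<subseteq> H \<and> H \<subseteq> AGL d p \<and>
        perm_isomorphic G P (BijGroup (fp_space p d) \<lparr>carrier := H\<rparr>) (fp_space p d))"

definition inner_auto :: "('g, 'm) monoid_scheme \<Rightarrow> ('g \<Rightarrow> 'g) set" where
  "inner_auto T = {\<lambda>x\<in>carrier T. t \<otimes>\<^bsub>T\<^esub> x \<otimes>\<^bsub>T\<^esub> inv\<^bsub>T\<^esub> t | t. t \<in> carrier T}"

text \<open>\<open>Inn T \<le> G \<le> Aut T\<close> up to isomorphism, for a finite nonabelian simple group \<open>T\<close>
  (\<^const>\<open>simple_group\<close> entails finiteness). Since \<open>T \<cong> Inn T\<close> embeds into \<open>G\<close>, it is no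
  restriction that \<open>T\<close> lives on the element type of \<open>G\<close>.\<close>

definition almost_simple_type :: "('g, 'm) monoid_scheme \<Rightarrow> bool" where
  "almost_simple_type G \<longleftrightarrow>
     (\<exists>(T :: 'g monoid) H. simple_group T \<and> \<not> comm_group T \<and>
        subgroup H (AutoGroup T) \<and> inner_auto T \<subseteq> H \<and>
        G \<cong> AutoGroup T \<lparr>carrier := H\<rparr>)"

lemma design_block_bij:
  assumes "finite P" and "\<And>b. b \<in> \<B> \<Longrightarrow> b \<subseteq> P" and "g \<in> carrier (design_Aut P \<B>)"
  shows "block_action \<B> g \<in> Bij \<B>"
proof -
  have g: "bij_betw g P P" "\<And>b. b \<in> \<B> \<Longrightarrow> g ` b \<in> \<B>"
    using assms(3) by (auto simp: design_Aut_def Bij_def)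
  have fin: "finite \<B>"
    using assms(1,2) by (meson Pow_iff finite_Pow_iff finite_subset subsetI)
  have inj: "inj_on ((`) g) \<B>"
    using g(1) assms(2) by (meson bij_betw_def inj_onI inj_on_image_eq_iff)
  have "(`) g ` \<B> = \<B>"
    using fin inj g(2) by (intro endo_inj_surj) auto
  with inj show ?thesis
    by (auto simp: block_action_def Bij_def bij_betw_def inj_on_def)
qed

lemma subgroup_design_Aut:
  assumes "finite P" and "\<And>b. b \<in> \<B> \<Longrightarrow> b \<subseteq> P"
  shows "subgroup (carrier (design_Aut P \<B>)) (BijGroup P)"
proof (rule group.subgroupI[OF group_BijGroup])
  show "carrier (design_Aut P \<B>) \<subseteq> carrier (BijGroup P)"
    by (auto simp: design_Aut_def BijGroup_def)
  have "(\<lambda>x\<in>P. x) ` b = b" if "b \<in> \<B>" for b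
    using assms(2)[OF that] by (force simp: image_iff)
  then have "(\<lambda>x\<in>P. x) \<in> carrier (design_Aut P \<B>)"
    by (simp add: design_Aut_def id_Bij)
  then show "carrier (design_Aut P \<B>) \<noteq> {}" by blast
next
  fix g assume g: "g \<in> carrier (design_Aut P \<B>)"
  then have gB: "g \<in> Bij P" and inj: "inj_on g P"
    by (auto simp: design_Aut_def Bij_def bij_betw_def)
  have "(\<lambda>x\<in>P. inv_into P g x) ` b \<in> \<B>" if b: "b \<in> \<B>" for b
  proof -
    have "block_action \<B> g ` \<B> = \<B>"
      using design_block_bij[OF assms g] by (simp add: Bij_def bij_betw_def)
    then obtain c where c: "c \<in> \<B>" "b = g ` c"
      using b by (metis (no_types, lifting) block_action_def imageE restrict_apply')
    have "(\<lambda>x\<in>P. inv_into P g x) ` b = inv_into P g ` b"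
      using assms(2)[OF b] by (intro image_cong) auto
    also have "\<dots> = c"
      using inj assms(2)[OF c(1)] c(2) by (simp add: inv_into_image_cancel)
    finally show ?thesis using c(1) by simp
  qed
  then show "inv\<^bsub>BijGroup P\<^esub> g \<in> carrier (design_Aut P \<B>)"
    using gB by (simp add: inv_BijGroup design_Aut_def restrict_inv_into_Bij del: restrict_apply)
next
  fix g h assume gh: "g \<in> carrier (design_Aut P \<B>)" "h \<in> carrier (design_Aut P \<B>)"
  have "compose P g h ` b \<in> \<B>" if b: "b \<in> \<B>" for b
  proof -
    have "compose P g h ` b = g ` h ` b"
      using assms(2)[OF b] by (force simp: compose_def image_iff)
    then show ?thesis using gh b by (simp add: design_Aut_def)
  qed
  then show "g \<otimes>\<^bsub>BijGroup P\<^esub> h \<in> carrier (design_Aut P \<B>)"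
    using gh by (simp add: design_Aut_def BijGroup_def compose_Bij)
qed

lemma group_design_Aut:
  assumes "finite P" and "\<And>b. b \<in> \<B> \<Longrightarrow> b \<subseteq> P"
  shows "group (design_Aut P \<B>)"
proof -
  have "design_Aut P \<B> = BijGroup P \<lparr>carrier := carrier (design_Aut P \<B>)\<rparr>"
    by (simp add: design_Aut_def)
  moreover have "subgroup (carrier (design_Aut P \<B>)) (BijGroup P)"
    by (rule subgroup_design_Aut) (use assms in auto)
  ultimately show ?thesis
    using subgroup.subgroup_is_group group_BijGroup by metis
qed

lemma design_actions:
  assumes "finite P" and "\<And>b. b \<in> \<B> \<Longrightarrow> b \<subseteq> P" and "subgroup G (design_Aut P \<B>)"
  shows "group_action (design_Aut P \<B> \<lparr>carrier := G\<rparr>) P (\<lambda>g. g)"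
    and "group_action (design_Aut P \<B> \<lparr>carrier := G\<rparr>) \<B> (block_action \<B>)"
proof -
  have grp: "group (design_Aut P \<B> \<lparr>carrier := G\<rparr>)"
    by (rule subgroup.subgroup_is_group[OF assms(3)], rule group_design_Aut) (use assms in auto)
  have G: "g \<in> carrier (design_Aut P \<B>)" if "g \<in> G" for g
    using subgroup.mem_carrier[OF assms(3) that] .
  then have GB: "g \<in> Bij P" if "g \<in> G" for g
    using that by (auto simp: design_Aut_def)
  have "(\<lambda>g. g) \<in> hom (design_Aut P \<B> \<lparr>carrier := G\<rparr>) (BijGroup P)"
    using GB by (auto simp: hom_def design_Aut_def BijGroup_def)
  then show "group_action (design_Aut P \<B> \<lparr>carrier := G\<rparr>) P (\<lambda>g. g)"
    using grp group_BijGroup by (simp add: group_action_def group_hom_def group_hom_axioms_def)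
  have bl: "block_action \<B> g \<in> Bij \<B>" if "g \<in> G" for g
    using design_block_bij[OF assms(1,2) G[OF that]] .
  have "block_action \<B> (compose P g h) = compose \<B> (block_action \<B> g) (block_action \<B> h)"
    if gh: "g \<in> G" "h \<in> G" for g h
  proof
    fix b
    show "block_action \<B> (compose P g h) b = compose \<B> (block_action \<B> g) (block_action \<B> h) b"
    proof (cases "b \<in> \<B>")
      case True
      have "compose P g h ` b = g ` h ` b"
        using assms(2)[OF True] by (force simp: compose_def image_iff)
      moreover have "h ` b \<in> \<B>" using G[OF gh(2)] True by (simp add: design_Aut_def)
      ultimately show ?thesis using True by (simp add: block_action_def compose_def)
    qed (simp add: block_action_def compose_def)
  qed
  then have "block_action \<B> \<in> hom (design_Aut P \<B> \<lparr>carrier := G\<rparr>) (BijGroup \<B>)"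
    using GB bl by (auto simp: hom_def design_Aut_def BijGroup_def)
  then show "group_action (design_Aut P \<B> \<lparr>carrier := G\<rparr>) \<B> (block_action \<B>)"
    using grp group_BijGroup by (simp add: group_action_def group_hom_def group_hom_axioms_def)
qed

end

theory Submission
  imports Defs "HOL-Algebra.Generated_Groups" "HOL-Algebra.Multiplicative_Group" "HOL-Algebra.Sylow"
    "HOL-Combinatorics.Permutations"
begin

text \<open>
  Counting against blocks: a \<open>3\<close>-set lies in exactly one block and \<open>G\<close> is block-transitive, so the
  number \<open>b\<close> of blocks divides the size of every \<open>G\<close>-invariant family of triples.

  Let \<open>N\<close> be a minimal normal subgroup of the primitive group \<open>G\<close>. If \<open>N\<close> is abelian, \<open>G\<close> is affine.
  Otherwise \<open>N\<close> is a direct product of the conjugates of a nonabelian simple group \<open>T\<close>, and \<open>G\<close> is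
  almost simple unless \<open>C\<^sub>G(N) \<noteq> 1\<close> or there are \<open>m \<ge> 2\<close> factors. In these remaining cases
  primitivity leaves two possibilities.

  Either the stabilizer \<open>N\<^sub>\<alpha>\<close> is the product of its projections to the factors. Then \<open>G\<close>
  preserves a cartesian structure \<open>v = n\<^sup>m\<close> on the points, and \<open>b\<close> divides both the number of triples
  on a coordinate line and the number of L-shaped triples, which contradicts \<open>v - 2 \<ge> (k - 1)(k - 2)\<close>.

  Or \<open>T\<close> is semiregular and \<open>G\<^sub>\<alpha>\<close> induces all inner automorphisms of \<open>T\<close>. Take \<open>x \<in> T\<close> with
  \<open>x\<^sup>2 \<noteq> 1\<close>. The stabilizer of \<open>\<alpha>\<close> and \<open>x\<alpha>\<close> also fixes \<open>x\<^sup>-\<^sup>1\<alpha>\<close>, so \<open>b\<close> divides \<open>v d\<close>, where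
  \<open>d\<close> is the length of the \<open>G\<^sub>\<alpha>\<close>-orbit of \<open>x\<alpha>\<close>. The class size \<open>h = |x\<^sup>T|\<close> divides \<open>d\<close> and \<open>v\<close>, hence is
  essentially coprime to \<open>(v - 1)(v - 2)\<close>; this gives \<open>h r \<le> k d\<close> with \<open>r\<close> the number of blocks on a
  point. This is impossible for \<open>v > |T|\<close>. For \<open>v = |T|\<close> it is impossible because an automorphism that
  is not an involution has at most \<open>(v - 2)/(k - 2) + 1\<close> fixed points, so that \<open>|C\<^sub>T(x)|\<close> is small.
  No part of the classification of finite simple groups enters.
\<close>

section \<open>Arithmetic of the parameters\<close>

text \<open>Since k is at most about the square root of \<open>2 * v\<close>, the number b of blocks
  is at least of order \<open>v^(3/2)\<close>. The proof therefore looks for invariant families of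
  triples that are small, or whose size \<open>v * d\<close> wastes a large factor of d: a factor h
  of d that also divides v contributes almost nothing to the required multiple of
  \<open>(v - 1) * (v - 2)\<close>, so the bound on d improves by the factor h. The obstacle is the
  prime 2, the only one that v and v - 2 can share. A power \<open>|T|^\<mu>\<close> with \<mu>
  \<ge> 2 is odd or divisible by 4; for v = |T| the residue 2 modulo 4 is excluded by signs of
  permutations. The types of the O'Nan-Scott theorem are not treated one by one. A stabilizer
  \<open>N\<^sub>\<alpha>\<close> projecting onto the factors is never described as a product of
  diagonals: it matters only that its order is a power of |T| and at most the square root of |N|.
  The same estimate serves the case \<open>C\<^sub>G(N) \<noteq> 1\<close>, where the elements of
  \<open>G\<^sub>\<alpha>\<close> inducing inner automorphisms are built from the transitive
  centralizer.\<close>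

lemma geometric_lower_bound:
  fixes n :: nat
  assumes "n \<ge> 1" "j \<ge> 1"
  shows "(n - 1) * (n ^ j + 1) \<le> n ^ Suc j - 1"
proof -
  obtain q where q: "n = Suc q" using assms(1) by (cases n) auto
  have "n \<le> n ^ j" using assms by (simp add: self_le_power)
  then show ?thesis unfolding q by (simp add: algebra_simps)
qed

text \<open>From k = 6 on, \<open>k^2 \<le> 2 * (k - 1) * (k - 2)\<close>; this fails at k = 5,
  where \<open>v \<ge> 25\<close> takes over.\<close>

lemma square_le_double:
  fixes k v :: nat
  assumes "(k - 1) * (k - 2) \<le> v - 2" "v \<ge> 25"
  shows "k\<^sup>2 \<le> 2 * v"
proof (cases "k \<le> 5")
  case True
  then have "k\<^sup>2 \<le> 5\<^sup>2" by (intro power_mono) auto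
  then show ?thesis using assms by simp
next
  case False
  then have "k = (k - 6) + 6" by simp
  then obtain j where j: "k = j + 6" by blast
  have "k\<^sup>2 \<le> 2 * ((k - 1) * (k - 2))" unfolding j by (simp add: power2_eq_square algebra_simps)
  then show ?thesis using assms by linarith
qed

text \<open>The numbers \<open>c1\<close> and \<open>c2\<close> count the triples on a coordinate
  line and the L-shaped triples in a grid \<open>n^m\<close>. For m = 2 and m = 3 both are combined:
  after cancelling v and n - 1 they carry, up to constants, the neighbouring multipliers n - 2 and n
  - 1 of \<open>Y\<close>, so a subtraction shows that \<open>(v - 1) * (v - 2) / (n - 1)\<close>
  divides \<open>Y\<close> or \<open>3 * Y\<close>. For m \<ge> 4 the family counted by
  \<open>c1\<close> is already too small.\<close>

lemma no_cartesian_parameters: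
  fixes v k n m b lam c1 c2 :: nat
  assumes "n \<ge> 3" "m \<ge> 2" and v: "v = n ^ m" and k: "k \<ge> 4"
    and lam: "(k - 2) * lam = v - 2" "k - 1 \<le> lam"
    and b: "b * (k * (k - 1) * (k - 2)) = v * (v - 1) * (v - 2)"
    and c1: "b dvd c1" "6 * c1 = m * v * (n - 1) * (n - 2)"
    and c2: "b dvd c2" "2 * c2 = v * (m * (m - 1)) * (n - 1)\<^sup>2"
  shows False
proof -
  define X where "X = (v - 1) * (v - 2)"
  define Y where "Y = k * (k - 1) * (k - 2)"
  have Y0: "Y > 0" using k by (simp add: Y_def)
  have vge: "v \<ge> 9"
  proof -
    have "(3::nat) ^ 2 \<le> 3 ^ m" using assms by (intro power_increasing) auto
    also have "\<dots> \<le> n ^ m" using assms by (intro power_mono) auto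
    finally show ?thesis using v by simp
  qed
  have bY: "b * Y = v * X" using b by (simp add: X_def Y_def mult.assoc)
  obtain w1 where w1: "c1 = b * w1" using c1 by blast
  obtain w2 where w2: "c2 = b * w2" using c2 by blast
  have e1: "6 * X * w1 = m * (n - 1) * (n - 2) * Y"
  proof -
    have "v * (6 * X * w1) = 6 * (b * Y) * w1" using bY by simp
    also have "\<dots> = (6 * c1) * Y" using w1 by simp
    also have "\<dots> = v * (m * (n - 1) * (n - 2) * Y)" using c1 by simp
    finally show ?thesis using vge by simp
  qed
  have e2: "2 * X * w2 = m * (m - 1) * (n - 1)\<^sup>2 * Y"
  proof -
    have "v * (2 * X * w2) = 2 * (b * Y) * w2" using bY by simp
    also have "\<dots> = (2 * c2) * Y" using w2 by simp
    also have "\<dots> = v * (m * (m - 1) * (n - 1)\<^sup>2 * Y)" using c2 by simp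
    finally show ?thesis using vge by simp
  qed
  have kk: "(k - 1) * (k - 2) \<le> v - 2"
    using lam mult_le_mono2[OF lam(2), of "k - 2"] by (simp add: mult.commute)
  have Yle: "Y \<le> k * (v - 2)" using kk by (simp add: Y_def mult.assoc)
  consider "m = 2" | "m = 3" | "m \<ge> 4" using assms(2) by linarith
  then show False
  proof cases
    case 1
    obtain q where q: "n = q + 3" using assms(1) by (metis add.commute le_Suc_ex)
    define Z where "Z = (n + 1) * (n\<^sup>2 - 2)"
    have X: "X = (n - 1) * Z"
      unfolding X_def Z_def v 1 q by (simp add: power2_eq_square algebra_simps)
    have "(n - 1) * (3 * Z * w1) = (n - 1) * ((n - 2) * Y)"
      using e1 unfolding X 1 by (simp add: mult_ac)
    then have "Z * (3 * w1) = (n - 2) * Y" using assms(1) by simp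
    then have a1: "Z dvd (n - 2) * Y" by (metis dvd_triv_left)
    have "(n - 1) * (Z * w2) = (n - 1) * ((n - 1) * Y)"
      using e2 unfolding X 1 by (simp add: mult_ac power2_eq_square)
    then have "Z * w2 = (n - 1) * Y" using assms(1) by simp
    then have a2: "Z dvd (n - 1) * Y" by (metis dvd_triv_left)
    have "(n - 1) * Y - (n - 2) * Y = Y" unfolding q by simp
    then have "Z dvd Y" using a1 a2 by (metis dvd_diff_nat)
    then have ZY: "Z \<le> Y" using Y0 by (simp add: dvd_imp_le)
    show False
    proof (cases "k \<le> n")
      case True
      then have "Y \<le> n * (n - 1) * (n - 2)" unfolding Y_def by (intro mult_le_mono) auto
      also have "\<dots> < Z" unfolding Z_def q by (simp add: power2_eq_square algebra_simps)
      finally show False using ZY by simp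
    next
      case False
      show False
      proof (cases "k = n + 1")
        case True
        \<comment> \<open>Modulo k - 2 = n - 1 the number \<open>n^2 - 2\<close> is -1, so k - 2
          cannot divide v - 2.\<close>
        have "(n - 1) * lam = n\<^sup>2 - 2" using lam v 1 True by simp
        then have "(q + 2) * lam = (q + 2) * (q + 4) - 1" unfolding q by (simp add: power2_eq_square algebra_simps)
        then have "(q + 2) * lam + 1 = (q + 2) * (q + 4)" by simp
        then have "q + 2 dvd 1" by (metis dvd_add_right_iff dvd_triv_left)
        then show False by simp
      next
        case F: False
        then have "k \<ge> n + 2" using False by simp
        then have "(n + 1) * n \<le> (k - 1) * (k - 2)" by (intro mult_le_mono) auto
        also have "\<dots> \<le> n\<^sup>2 - 2" using kk v 1 by simp
        finally show False using assms(1) by (simp add: power2_eq_square)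
      qed
    qed
  next
    case 2
    obtain q where q: "n = q + 3" using assms(1) by (metis add.commute le_Suc_ex)
    define Z where "Z = (n\<^sup>2 + n + 1) * (n ^ 3 - 2)"
    have X: "X = (n - 1) * Z"
      unfolding X_def Z_def v 2 q by (simp add: power2_eq_square power3_eq_cube algebra_simps)
    have n1: "n - 1 > 0" using assms(1) by simp
    have "(n - 1) * (2 * Z * w1) = (n - 1) * ((n - 2) * Y)"
      using e1 unfolding X 2 by (simp add: mult_ac)
    then have "Z * (2 * w1) = (n - 2) * Y" using n1 by simp
    then have a1: "Z dvd 3 * ((n - 2) * Y)" by (metis dvd_triv_left dvd_mult)
    have "(n - 1) * (Z * w2) = (n - 1) * (3 * ((n - 1) * Y))"
      using e2 unfolding X 2 by (simp add: mult_ac power2_eq_square)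
    then have "Z * w2 = 3 * ((n - 1) * Y)" using n1 by simp
    then have a2: "Z dvd 3 * ((n - 1) * Y)" by (metis dvd_triv_left)
    have "3 * ((n - 1) * Y) - 3 * ((n - 2) * Y) = 3 * Y" unfolding q by simp
    then have "Z dvd 3 * Y" using a1 a2 by (metis dvd_diff_nat)
    then have ZY: "Z \<le> 3 * Y" using Y0 by (simp add: dvd_imp_le)
    then have "(n\<^sup>2 + n + 1) * (n ^ 3 - 2) \<le> 3 * k * (n ^ 3 - 2)"
      using Yle v 2 unfolding Z_def by simp
    moreover have "n ^ 3 - 2 > 0" using vge v 2 by simp
    ultimately have k3: "n\<^sup>2 + n + 1 \<le> 3 * k" by (metis mult_le_cancel2)
    have kk3: "(k - 1) * (k - 2) \<le> n ^ 3 - 2" using kk v 2 by simp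
    have div: "(k - 2) dvd n ^ 3 - 2" using lam v 2 by (metis dvd_triv_left)
    have kb: "k < c" if "n ^ 3 - 2 < (c - 1) * (c - 2)" for c
    proof (rule ccontr)
      assume "\<not> k < c"
      then have "(c - 1) * (c - 2) \<le> (k - 1) * (k - 2)" by (intro mult_le_mono) auto
      then show False using that kk3 by linarith
    qed
    \<comment> \<open>The lower bound on k is quadratic in n, while \<open>k^2\<close> grows only
      like \<open>n^3\<close>. This leaves finitely many n, for which k - 2 must divide 25, 62, 123,
      214 or 341.\<close>
    have "n \<le> 7"
    proof (rule ccontr)
      assume "\<not> n \<le> 7"
      then have "n = (n - 8) + 8" by simp
      then obtain p where p: "n = p + 8" by blast
      have "(n\<^sup>2 + n - 2) * (n\<^sup>2 + n - 5) \<le> (3 * (k - 1)) * (3 * (k - 2))"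
        using k3 by (intro mult_le_mono) auto
      also have "\<dots> \<le> 9 * (n ^ 3 - 2)" using kk3 by simp
      finally show False unfolding p by (simp add: power2_eq_square power3_eq_cube algebra_simps)
    qed
    then consider "n = 3" | "n = 4" | "n = 5" | "n = 6" | "n = 7" using assms(1) by linarith
    then show False
    proof cases
      case 1
      have "k < 7" by (rule kb) (simp add: 1)
      then have "k = 5 \<or> k = 6" using k3 unfolding 1 by (simp; linarith)
      then show False using div unfolding 1 by auto
    next
      case 2
      have "k < 10" by (rule kb) (simp add: 2)
      then have "k = 7 \<or> k = 8 \<or> k = 9" using k3 unfolding 2 by (simp; linarith)
      then show False using div unfolding 2 by auto
    next
      case 3
      have "k < 13" by (rule kb) (simp add: 3)
      then have "k = 11 \<or> k = 12" using k3 unfolding 3 by (simp; linarith)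
      then show False using div unfolding 3 by auto
    next
      case 4
      have "k < 17" by (rule kb) (simp add: 4)
      then have "k = 15 \<or> k = 16" using k3 unfolding 4 by (simp; linarith)
      then show False using div unfolding 4 by auto
    next
      case 5
      have "k < 20" by (rule kb) (simp add: 5)
      then have "k = 19" using k3 unfolding 5 by (simp; linarith)
      then show False using div unfolding 5 by auto
    qed
  next
    case 3
    have w1pos: "w1 > 0" using e1 Y0 assms by (cases w1) auto
    have "6 * (v - 1) * (v - 2) \<le> 6 * X * w1" using w1pos by (simp add: X_def)
    also have "\<dots> \<le> m * (n - 1) * (n - 2) * (k * (v - 2))" unfolding e1 using Yle by simp
    finally have "6 * (v - 1) * (v - 2) \<le> (m * (n - 1) * (n - 2) * k) * (v - 2)" by (simp add: mult_ac)
    then have i1: "6 * (v - 1) \<le> m * (n - 1) * (n - 2) * k" using vge by simp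
    obtain j where j: "m = j + 4" using 3 by (metis add.commute le_Suc_ex)
    \<comment> \<open>Of \<open>(v - 1) / (n - 1) = 1 + n + ... + n^(m - 1)\<close> only the two
      extreme terms are kept.\<close>
    have "(n - 1) * (n ^ (j + 3) + 1) \<le> v - 1"
      using geometric_lower_bound[of n "j + 3"] assms(1) unfolding v j by (simp add: numeral_eq_Suc)
    then have "6 * ((n - 1) * (n ^ (j + 3) + 1)) \<le> m * (n - 1) * (n - 2) * k"
      using i1 by linarith
    then have "(n - 1) * (6 * (n ^ (j + 3) + 1)) \<le> (n - 1) * (m * (n - 2) * k)"
      by (simp only: mult_ac)
    then have "6 * (n ^ (j + 3) + 1) \<le> m * (n - 2) * k" using assms(1) by simp
    also have "\<dots> \<le> m * n * k" by simp
    also have "n ^ (j + 3) = n * n ^ (j + 2)" by (simp add: numeral_eq_Suc)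
    finally have "6 * (n * n ^ (j + 2) + 1) \<le> n * (m * k)" by (simp only: mult_ac)
    then have "n * (6 * n ^ (j + 2)) < n * (m * k)"
      by (rule less_le_trans[rotated]) simp
    then have "6 * n ^ (j + 2) < m * k" using nat_mult_less_cancel_disj by blast
    then have "(6 * n ^ (j + 2))\<^sup>2 < (m * k)\<^sup>2" by (intro power_strict_mono) auto
    moreover have "k\<^sup>2 \<le> 2 * v"
    proof (rule square_le_double[OF kk])
      have "(3::nat) ^ 4 \<le> 3 ^ m" using 3 by (intro power_increasing) auto
      also have "\<dots> \<le> n ^ m" using assms by (intro power_mono) auto
      finally show "25 \<le> v" using v by simp
    qed
    then have "(m * k)\<^sup>2 \<le> m\<^sup>2 * (2 * v)" by (simp add: power_mult_distrib)
    ultimately have "(6 * n ^ (j + 2))\<^sup>2 < m\<^sup>2 * (2 * v)" by linarith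
    moreover have "(6 * n ^ (j + 2))\<^sup>2 = n ^ (j + 4) * (36 * n ^ j)"
      by (simp add: power2_eq_square power4_eq_xxxx power_add mult_ac)
    ultimately have "n ^ (j + 4) * (36 * n ^ j) < n ^ (j + 4) * (2 * m\<^sup>2)" unfolding v j by (simp add: mult_ac)
    then have "18 * n ^ j < m\<^sup>2" by simp
    moreover have "(3::nat) ^ j \<le> n ^ j" using assms by (intro power_mono) auto
    \<comment> \<open>Nearly tight: m = 4 gives 16 against 18.\<close>
    moreover have "(j + 4)\<^sup>2 \<le> 18 * 3 ^ j" by (induction j) (auto simp: power2_eq_square algebra_simps)
    ultimately show False unfolding j by linarith
  qed
qed

text \<open>Here a = |T|, h is the size of a conjugacy class of T and m the number of factors;
  \<open>le\<close> combines \<open>h * r \<le> k * d\<close> with \<open>r \<ge> v - 1\<close> and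
  \<open>d \<le> m * (a - 1)\<close>. It forces k above \<open>2 * a^(\<mu> - 1) / \<mu>\<close>,
  against \<open>k^2 \<le> 2 * v\<close> if \<mu> \<ge> 3. For \<mu> = 2 it leaves k \<ge> a + 1,
  and k = a + 1 fails because k - 2 would divide \<open>a^2 - 2\<close>.\<close>

lemma no_semiregular_parameters:
  fixes v k lam h m a \<mu> :: nat
  assumes "h \<ge> 4" "a \<ge> 12" "\<mu> \<ge> 2" "m \<le> 2 * \<mu>" and v: "v = a ^ \<mu>" and k: "k \<ge> 4"
    and lam: "(k - 2) * lam = v - 2" "k - 1 \<le> lam"
    and le: "h * (v - 1) \<le> k * (m * (a - 1))"
  shows False
proof -
  have kk: "(k - 1) * (k - 2) \<le> v - 2"
    using lam mult_le_mono2[OF lam(2), of "k - 2"] by (simp add: mult.commute)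
  have "4 * (v - 1) \<le> h * (v - 1)" using assms(1) by simp
  also have "\<dots> \<le> k * (m * (a - 1))" by (rule le)
  also have "\<dots> \<le> k * (2 * \<mu> * (a - 1))" using assms(4) by simp
  finally have l4: "4 * (v - 1) \<le> (a - 1) * (2 * \<mu> * k)" by (simp add: mult_ac)
  obtain j where j: "\<mu> = j + 2" using assms(3) by (metis add.commute le_Suc_ex)
  have "(a - 1) * (a ^ (j + 1) + 1) \<le> v - 1"
    using geometric_lower_bound[of a "j + 1"] assms(2) unfolding v j by (simp add: numeral_eq_Suc)
  then have "4 * ((a - 1) * (a ^ (j + 1) + 1)) \<le> (a - 1) * (2 * \<mu> * k)"
    using l4 by linarith
  then have "(a - 1) * (4 * (a ^ (j + 1) + 1)) \<le> (a - 1) * (2 * \<mu> * k)"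
    by (simp only: mult.left_commute)
  then have l5: "2 * (a ^ (j + 1) + 1) \<le> \<mu> * k" using assms(2) by simp
  show False
  proof (cases "j = 0")
    case True
    have va: "v = a\<^sup>2" using v j True by (simp add: power2_eq_square)
    have "a + 1 \<le> k" using l5 unfolding j True by simp
    show False
    proof (cases "k = a + 1")
      case T: True
      have "a = (a - 2) + 2" using assms(2) by simp
      then obtain q where q: "a = q + 2" by blast
      have "(q + 1) * lam = (q + 1) * (q + 3) - 1" using lam(1) unfolding T va q by (simp add: power2_eq_square algebra_simps)
      then have "(q + 1) * lam + 1 = (q + 1) * (q + 3)" by simp
      then have "q + 1 dvd 1" by (metis dvd_add_right_iff dvd_triv_left)
      then show False using assms(2) q by simp
    next
      case False
      then have "(a + 1) * a \<le> (k - 1) * (k - 2)" using \<open>a + 1 \<le> k\<close> by (intro mult_le_mono) auto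
      then show False using kk assms(2) unfolding va by (simp add: power2_eq_square)
    qed
  next
    case False
    then obtain i where i: "j = i + 1" by (metis Suc_eq_plus1 not0_implies_Suc)
    have "2 * a ^ (j + 1) < \<mu> * k" using l5 by simp
    then have "(2 * a ^ (j + 1))\<^sup>2 < (\<mu> * k)\<^sup>2" by (intro power_strict_mono) auto
    moreover have "k\<^sup>2 \<le> 2 * v"
    proof (rule square_le_double[OF kk])
      have "(12::nat) ^ 2 \<le> 12 ^ \<mu>" using assms by (intro power_increasing) auto
      also have "\<dots> \<le> a ^ \<mu>" using assms by (intro power_mono) auto
      finally show "25 \<le> v" using v by simp
    qed
    then have "(\<mu> * k)\<^sup>2 \<le> \<mu>\<^sup>2 * (2 * v)" by (simp add: power_mult_distrib)
    ultimately have "(2 * a ^ (j + 1))\<^sup>2 < \<mu>\<^sup>2 * (2 * v)" by linarith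
    moreover have "(2 * a ^ (j + 1))\<^sup>2 = a ^ (j + 2) * (4 * a ^ j)"
      by (simp add: power2_eq_square power_add mult_ac)
    ultimately have "a ^ (j + 2) * (4 * a ^ j) < a ^ (j + 2) * (2 * \<mu>\<^sup>2)" unfolding v j by (simp add: mult_ac)
    then have "2 * a ^ j < \<mu>\<^sup>2" by simp
    moreover have "(12::nat) ^ j \<le> a ^ j" using assms by (intro power_mono) auto
    moreover have "(i + 3)\<^sup>2 \<le> 2 * 12 ^ (i + 1)" by (induction i) (auto simp: power2_eq_square algebra_simps)
    moreover have "\<mu> = i + 3" using i j by simp
    then have "\<mu>\<^sup>2 = (i + 3)\<^sup>2" by simp
    ultimately show False unfolding i by linarith
  qed
qed

text \<open>Here v = |T|, h is a class size and f the order of the corresponding centralizer. The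
  bounds \<open>h * lam \<le> k * (k - 1)\<close> and \<open>f \<le> lam + 1\<close> give
  \<open>v = h * f \<le> k^2\<close>, so \<open>v = (k - 2) * lam + 2\<close> leaves only lam
  between k - 1 and k + 2, or k = 4 with lam = 7. Integrality of r and b and the factorization of v
  dispose of these.\<close>

lemma no_regular_parameters:
  fixes v k lam r b h f :: nat
  assumes "h \<ge> 4" "f \<ge> 3" and hf: "h * f = v" and k: "k \<ge> 4" and f: "f \<le> lam + 1"
    and lam: "(k - 2) * lam = v - 2" "k - 1 \<le> lam"
    and r: "(k - 1) * r = (v - 1) * lam" and b: "b * k = v * r"
    and le: "h * r \<le> k * (v - 1)"
  shows False
proof -
  have v12: "v \<ge> 12" using mult_le_mono[OF assms(1,2)] hf by simp
  have veq: "v = (k - 2) * lam + 2" using lam v12 by simp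
  have "(v - 1) * (h * lam) = (k - 1) * (h * r)" using r by (metis mult.left_commute)
  also have "\<dots> \<le> (k - 1) * (k * (v - 1))" using le by simp
  finally have "(v - 1) * (h * lam) \<le> (v - 1) * (k * (k - 1))" by (simp add: mult_ac)
  then have hl: "h * lam \<le> k * (k - 1)" using v12 by simp
  have hk: "h \<le> k"
  proof -
    have "h * (k - 1) \<le> k * (k - 1)" using hl lam(2) by (meson le_trans mult_le_mono2)
    then show ?thesis using k by simp
  qed
  obtain q where q: "k = q + 4" using k by (metis add.commute le_Suc_ex)
  have v_le: "v \<le> k * k"
  proof -
    have "v \<le> h * (lam + 1)" using mult_le_mono2[OF f, of h] hf by simp
    also have "\<dots> \<le> k * (k - 1) + k" using hl hk by simp
    finally show ?thesis unfolding q by (simp add: algebra_simps)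
  qed
  have fh: "h = v div f" "f dvd v" using hf assms(2) by (auto simp flip: hf)
  have "lam \<le> k + 2 \<or> k = 4 \<and> lam = 7"
  proof (rule ccontr)
    assume *: "\<not> ?thesis"
    then have l: "lam \<ge> q + 7" unfolding q by simp
    show False
    proof (cases "q = 0")
      case True
      then have "lam \<ge> 8" using * l q by auto
      then show False using v_le veq unfolding q True by simp
    next
      case False
      have "(q + 2) * (q + 7) \<le> (q + 2) * lam" using l by (intro mult_le_mono2)
      then show False using v_le veq False unfolding q by (simp add: algebra_simps)
    qed
  qed
  then consider "lam = k - 1" | "lam = k" | "lam = k + 1" | "lam = k + 2" | "k = 4" "lam = 7"
    using lam(2) by linarith
  then show False
  proof cases
    case 1
    \<comment> \<open>The derived design at a point has the parameters of a projective plane of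
      order k - 2. Integrality of b leaves the classical orders 2, 4 and 10, that is v = 8, 22 and
      112; the last two have no divisor h in the required range.\<close>
    have "r = v - 1" using r unfolding 1 using k by (simp add: mult.commute)
    then have "k dvd v * (v - 1)" using b by (metis dvd_triv_right)
    moreover have vq: "v = (q + 2) * (q + 3) + 2" using veq unfolding 1 q by simp
    have "v = (q + 4) * (q + 1) + 4" unfolding vq by (simp add: algebra_simps)
    moreover have "v - 1 = (q + 4) * (q + 1) + 3" using calculation by simp
    ultimately have "k dvd ((q + 4) * (q + 1) + 4) * ((q + 4) * (q + 1) + 3)" by metis
    also have "((q + 4) * (q + 1) + 4) * ((q + 4) * (q + 1) + 3) = k * ((q + 1) * ((q + 4) * (q + 1) + 7)) + 12"
      unfolding q by (simp add: algebra_simps)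
    finally have "k dvd 12" by (metis dvd_add_right_iff dvd_triv_left)
    moreover have "k \<le> 12" using calculation by (auto dest: dvd_imp_le)
    ultimately have "k \<in> {4..12} \<and> k dvd 12" using k by simp
    moreover have "{4..12::nat} = {4,5,6,7,8,9,10,11,12}" by auto
    ultimately have "k = 4 \<or> k = 6 \<or> k = 12" by auto
    then have "q = 0 \<or> q = 2 \<or> q = 8" using q by auto
    then show False
    proof (elim disjE)
      assume "q = 0"
      then show False using v12 vq by simp
    next
      assume q2: "q = 2"
      then have "v = 22" "k = 6" "lam = 5" using vq q 1 by auto
      then have "h * f = 22" "h * 5 \<le> 30" using hf hl by auto
      then have "h = 4 \<or> h = 5 \<or> h = 6" using assms(1) by linarith
      then show False using \<open>h * f = 22\<close> by (elim disjE) (simp_all, presburger+)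
    next
      assume q2: "q = 8"
      then have "v = 112" "k = 12" "lam = 11" using vq q 1 by auto
      then have "h * f = 112" "h * 11 \<le> 132" "f \<le> 12" using hf hl f by auto
      then have "h \<le> 12" by linarith
      have "9 < h" using \<open>h * f = 112\<close> \<open>f \<le> 12\<close> mult_le_mono[of h 9 f 12] by linarith
      then have "h = 10 \<or> h = 11 \<or> h = 12" using \<open>h \<le> 12\<close> by linarith
      then show False using \<open>h * f = 112\<close> by (elim disjE) (simp_all, presburger+)
    qed
  next
    case 2
    \<comment> \<open>Parameters of an inversive plane of order k - 1. They are integral for every
      k, so h and f must decide: h \<le> k - 1 forces f = k or f = k + 1, and f divides v.\<close>
    have vq: "v = (q + 3) * (q + 3) + 1" using veq unfolding 2 q by (simp add: algebra_simps)
    have "k * h \<le> k * (k - 1)" using hl unfolding 2 by (simp add: mult.commute)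
    then have "h \<le> q + 3" using k unfolding q by simp
    then have "v \<le> (q + 3) * f" using hf by auto
    then have "(q + 3) * (q + 3) < (q + 3) * f" using vq by linarith
    then have "f > q + 3" by simp
    moreover have "f \<le> q + 5" using f unfolding 2 q by simp
    ultimately have "f = q + 4 \<or> f = q + 5" by linarith
    then show False
    proof
      assume "f = q + 4"
      then have "q + 4 dvd (q + 4) * (q + 2) + 2" using fh(2) unfolding vq by (simp add: algebra_simps)
      then have "q + 4 dvd 2" by (metis dvd_add_right_iff dvd_triv_left)
      then show False by (auto dest: dvd_imp_le)
    next
      assume "f = q + 5"
      then have "q + 5 dvd (q + 5) * (q + 1) + 5" using fh(2) unfolding vq by (simp add: algebra_simps)
      then have "q + 5 dvd 5" by (metis dvd_add_right_iff dvd_triv_left)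
      then have "q = 0" by (auto dest: dvd_imp_le)
      then show False using v12 vq by simp
    qed
  next
    case 3
    have vq: "v - 1 = (q + 3) * (q + 4) - 1" using veq unfolding 3 q by (simp add: algebra_simps)
    have "(q + 3) * r + (q + 5) = (q + 3) * (q + 4) * (q + 5)"
      using r unfolding vq 3 q by (simp add: algebra_simps)
    then have "(q + 3) * r + ((q + 3) + 2) = (q + 3) * ((q + 4) * (q + 5))" by (simp add: algebra_simps)
    then have "q + 3 dvd 2" by (metis dvd_add_right_iff dvd_triv_left dvd_refl)
    then show False by (auto dest: dvd_imp_le)
  next
    case 4
    have vq: "v = (q + 2) * (q + 6) + 2" using veq unfolding 4 q by simp
    moreover have "k - 1 = q + 3" "v - 1 = (q + 2) * (q + 6) + 1" "lam = q + 6" using vq 4 q by auto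
    ultimately have "(q + 3) * r = ((q + 2) * (q + 6) + 1) * (q + 6)" using r by simp
    then have "(q + 3) * r + 6 = (q + 3) * (q * q + 11 * q + 28)" by (simp add: algebra_simps)
    then have "q + 3 dvd 6" by (metis dvd_add_right_iff dvd_triv_left)
    then have "q \<le> 3" by (auto dest: dvd_imp_le)
    then have "q = 0 \<or> q = 1 \<or> q = 2 \<or> q = 3" by linarith
    then show False
    proof (elim disjE)
      assume "q = 0"
      then have "h * f = 14" "h * 6 \<le> 12" using hf hl unfolding vq q 4 by auto
      then show False using assms(1) by linarith
    next
      assume "q = 1" then show False using \<open>q + 3 dvd 6\<close> by simp
    next
      assume "q = 2" then show False using \<open>q + 3 dvd 6\<close> by simp
    next
      assume "q = 3"
      then have "h * f = 47" "h * 9 \<le> 42" using hf hl unfolding vq q 4 by auto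
      then have "h = 4" using assms(1) by linarith
      then show False using \<open>h * f = 47\<close> by presburger
    qed
  next
    case 5
    then have "h * 7 \<le> 12" using hl by simp
    then show False using assms(1) by linarith
  qed
qed

lemma cancel_coprime_factor:
  fixes v h e Y :: nat
  assumes dvd: "(v - 1) * (v - 2) dvd Y * (e * h)" and "h dvd v" "even Y" "Y > 0" "e > 0" "v \<ge> 3"
    and par: "odd v \<or> 4 dvd v"
  shows "(v - 1) * (v - 2) \<le> Y * e"
proof -
  have co1: "coprime (v - 1) h"
    by (metis assms(2,6) coprime_diff_one_left_nat coprime_divisors dvd_refl less_le_trans zero_less_numeral)
  have "(v - 1) * (v - 2) dvd Y * e"
  proof (cases "odd v")
    case True
    have "coprime (v - 2) v"
    proof (rule coprimeI)
      fix c assume c: "c dvd v - 2" "c dvd v"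
      have "(v - 2) + 2 = v" using assms(6) by simp
      then have "c dvd (v - 2) + 2" using c(2) by metis
      then have "c dvd 2" using c(1) by (metis dvd_add_right_iff)
      then have "c = 1 \<or> c = 2" by (metis prime_nat_iff two_is_prime_nat)
      then show "is_unit c" using c True by auto
    qed
    then have "coprime (v - 2) h" using assms(2) by (meson coprime_divisors dvd_refl)
    then have "coprime ((v - 1) * (v - 2)) h" using co1 by simp
    then show ?thesis using dvd by (metis coprime_dvd_mult_left_iff mult.assoc)
  next
    case False
    then have "4 dvd v" using par by simp
    then obtain u where u: "v = 4 * u" by blast
    have u0: "u > 0" using assms(6) u by simp
    define w where "w = 2 * u - 1"
    have vw: "v - 2 = 2 * w" using u w_def by simp
    have oddw: "odd w" using u0 by (simp add: w_def)
    have "coprime w v"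
    proof (rule coprimeI)
      fix c assume c: "c dvd w" "c dvd v"
      have "2 * (w + 1) = v" using u0 u w_def by simp
      then have "c dvd 2 * w + 2" using c(2) by simp
      then have "c dvd 2" using c(1) by (metis dvd_add_right_iff dvd_mult)
      then have "c = 1 \<or> c = 2" by (metis prime_nat_iff two_is_prime_nat)
      then show "is_unit c" using c oddw by auto
    qed
    then have "coprime w h" using assms(2) by (meson coprime_divisors dvd_refl)
    then have "coprime ((v - 1) * w) h" using co1 by simp
    moreover have "(v - 1) * w dvd Y * e * h" 
      by (rule dvd_trans[of _ "(v - 1) * (v - 2)"]) (use dvd vw in \<open>simp_all add: mult.assoc\<close>)
    ultimately have 1: "(v - 1) * w dvd Y * e" by (metis coprime_dvd_mult_left_iff)
    have "odd ((v - 1) * w)" using oddw u u0 by simp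
    then have "coprime 2 ((v - 1) * w)" by simp
    moreover have "2 dvd Y * e" using assms(3) by simp
    ultimately have "2 * ((v - 1) * w) dvd Y * e" using 1 by (simp add: divides_mult)
    then show ?thesis by (simp add: vw mult_ac)
  qed
  then show ?thesis using assms by (simp add: dvd_imp_le)
qed

section \<open>Steiner 3-designs\<close>

lemma card_eq_fibre_mult:
  assumes "finite A" "\<And>y. y \<in> f ` A \<Longrightarrow> card {x \<in> A. f x = y} = c"
  shows "card A = card (f ` A) * c"
proof -
  have "card A = (\<Sum>y\<in>f ` A. card {x \<in> A. f x = y})"
    using assms(1) sum.image_gen[of A "\<lambda>_. 1::nat" f] by simp
  also have "\<dots> = card (f ` A) * c" using assms(2) by simp
  finally show ?thesis .
qed

lemma double_count:
  assumes "finite A" "finite C"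
    and "\<And>x. x \<in> A \<Longrightarrow> card {y \<in> C. R x y} = c" "\<And>y. y \<in> C \<Longrightarrow> card {x \<in> A. R x y} = d"
  shows "card A * c = card C * d"
  using sum_multicount[of A C R d] assms by (simp add: mult.commute)

locale steiner3 =
  fixes v k :: nat and P :: "'a set" and \<B> :: "'a set set"
  assumes steiner: "nontrivial_steiner_3_design v k P \<B>"
begin

lemma finP: "finite P" and cardP: "card P = v" and blockP: "B \<in> \<B> \<Longrightarrow> B \<subseteq> P"
  and cardB: "B \<in> \<B> \<Longrightarrow> card B = k" and k4: "k \<ge> 4" and kv: "k + 3 < v"
  using steiner
  by (auto simp: nontrivial_steiner_3_design_def nontrivial_design_def is_design_def)

lemma finB: "finite \<B>"
  using finP blockP by (meson Pow_iff finite_Pow_iff finite_subset subsetI)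

lemma finb: "B \<in> \<B> \<Longrightarrow> finite B"
  using blockP finP finite_subset by blast

lemma card_blocks_through_three: "S \<subseteq> P \<Longrightarrow> card S = 3 \<Longrightarrow> card {B \<in> \<B>. S \<subseteq> B} = 1"
  using steiner
  by (simp add: nontrivial_steiner_3_design_def nontrivial_design_def is_design_def)

lemma ex1_block:
  assumes "S \<subseteq> P" "card S = 3"
  shows "\<exists>!B. B \<in> \<B> \<and> S \<subseteq> B"
proof -
  obtain B where B: "{B \<in> \<B>. S \<subseteq> B} = {B}"
    using card_blocks_through_three[OF assms] by (auto simp: card_1_singleton_iff)
  have "C = B \<longleftrightarrow> C \<in> \<B> \<and> S \<subseteq> C" for C
    using B[THEN eqset_imp_iff, of C] by simp
  then show ?thesis by metis
qed

lemma block_exists: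
  assumes "x \<in> P" "y \<in> P" "z \<in> P" "x \<noteq> y" "x \<noteq> z" "y \<noteq> z"
  obtains B where "B \<in> \<B>" "x \<in> B" "y \<in> B" "z \<in> B"
  using ex1_block[of "{x, y, z}"] assms by auto

lemma block_unique:
  assumes "B \<in> \<B>" "C \<in> \<B>" "{x, y, z} \<subseteq> B" "{x, y, z} \<subseteq> C" "x \<noteq> y" "x \<noteq> z" "y \<noteq> z"
  shows "B = C"
  using ex1_block[of "{x, y, z}"] assms blockP by (metis card_3_iff subset_trans)

text \<open>\<open>lam\<close> and \<open>rep\<close> are the numbers of blocks through two points
  and through one point; the divisions are exact by \<open>lam_mult\<close> and
  \<open>rep_mult\<close>.\<close>

definition "lam = (v - 2) div (k - 2)"
definition "rep = ((v - 1) * lam) div (k - 1)"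

lemma blocks_through_two:
  assumes "x \<in> P" "y \<in> P" "x \<noteq> y"
  shows "(k - 2) * card {B \<in> \<B>. x \<in> B \<and> y \<in> B} = v - 2"
proof -
  let ?C = "{B \<in> \<B>. x \<in> B \<and> y \<in> B}"
  have "card (P - {x, y}) * 1 = card ?C * (k - 2)"
  proof (rule double_count[where R = "\<lambda>z B. z \<in> B"])
    show "finite (P - {x, y})" "finite ?C" using finP finB by auto
  next
    fix z assume z: "z \<in> P - {x, y}"
    then obtain B where B: "B \<in> \<B>" "x \<in> B" "y \<in> B" "z \<in> B" using block_exists[of x y z] assms by auto
    then have "{B \<in> ?C. z \<in> B} = {B}" using block_unique[of B _ x y z] z assms by blast
    then show "card {B \<in> ?C. z \<in> B} = 1" by simp
  next
    fix B assume B: "B \<in> ?C"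
    then have "{z \<in> P - {x, y}. z \<in> B} = B - {x, y}" using blockP by auto
    then show "card {z \<in> P - {x, y}. z \<in> B} = k - 2"
      using B assms cardB finb by (simp add: card_Diff_subset)
  qed
  then show ?thesis using assms finP cardP by (simp add: card_Diff_subset mult.commute)
qed

lemma lam_mult: "(k - 2) * lam = v - 2"
proof -
  have "card P > 2" using cardP kv by simp
  then obtain S where "S \<subseteq> P" "card S = 2" by (meson less_imp_le obtain_subset_with_card_n)
  then obtain x y where "x \<in> P" "y \<in> P" "x \<noteq> y" by (auto simp: card_2_iff)
  then have "(k - 2) dvd (v - 2)" using blocks_through_two by (metis dvd_triv_left)
  then show ?thesis by (simp add: lam_def)
qed

lemma card_blocks_through_two:
  assumes "x \<in> P" "y \<in> P" "x \<noteq> y"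
  shows "card {B \<in> \<B>. x \<in> B \<and> y \<in> B} = lam"
proof -
  have "(k - 2) * card {B \<in> \<B>. x \<in> B \<and> y \<in> B} = (k - 2) * lam"
    by (simp only: blocks_through_two[OF assms] lam_mult)
  then show ?thesis using k4 by simp
qed

lemma blocks_through_one:
  assumes "x \<in> P"
  shows "(k - 1) * card {B \<in> \<B>. x \<in> B} = (v - 1) * lam"
proof -
  let ?C = "{B \<in> \<B>. x \<in> B}"
  have "card (P - {x}) * lam = card ?C * (k - 1)"
  proof (rule double_count[where R = "\<lambda>z B. z \<in> B"])
    show "finite (P - {x})" "finite ?C" using finP finB by auto
  next
    fix z assume z: "z \<in> P - {x}"
    have "{B \<in> ?C. z \<in> B} = {B \<in> \<B>. x \<in> B \<and> z \<in> B}" by auto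
    then show "card {B \<in> ?C. z \<in> B} = lam" using card_blocks_through_two[of x z] z assms by auto
  next
    fix B assume B: "B \<in> ?C"
    then have "{z \<in> P - {x}. z \<in> B} = B - {x}" using blockP by auto
    then show "card {z \<in> P - {x}. z \<in> B} = k - 1"
      using B assms cardB finb by (simp add: card_Diff_subset)
  qed
  then show ?thesis using assms finP cardP by (simp add: card_Diff_subset mult.commute)
qed

lemma nonempty: "P \<noteq> {}" using cardP kv by auto

lemma rep_mult: "(k - 1) * rep = (v - 1) * lam"
proof -
  obtain x where "x \<in> P" using nonempty by blast
  then have "(k - 1) dvd (v - 1) * lam" using blocks_through_one by (metis dvd_triv_left)
  then show ?thesis by (simp add: rep_def)
qed

lemma card_blocks_through_one:
  assumes "x \<in> P"
  shows "card {B \<in> \<B>. x \<in> B} = rep"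
proof -
  have "(k - 1) * card {B \<in> \<B>. x \<in> B} = (k - 1) * rep"
    by (simp only: blocks_through_one[OF assms] rep_mult)
  then show ?thesis using k4 by simp
qed

lemma flag_count: "card \<B> * k = v * rep"
proof -
  have "card P * rep = card \<B> * k"
  proof (rule double_count[where R = "\<lambda>z B. z \<in> B"])
    show "finite P" "finite \<B>" using finP finB by auto
    show "card {B \<in> \<B>. x \<in> B} = rep" if "x \<in> P" for x using card_blocks_through_one[OF that] .
    fix B assume B: "B \<in> \<B>"
    then have "{z \<in> P. z \<in> B} = B" using blockP by auto
    then show "card {z \<in> P. z \<in> B} = k" using B cardB by simp
  qed
  then show ?thesis using cardP by simp
qed

lemma card_blocks: "card \<B> * (k * (k - 1) * (k - 2)) = v * (v - 1) * (v - 2)"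
proof -
  have "card \<B> * (k * (k - 1) * (k - 2)) = (v * rep) * (k - 1) * (k - 2)"
    by (simp only: flag_count[symmetric] mult_ac)
  also have "\<dots> = v * ((k - 1) * rep) * (k - 2)" by (simp only: mult_ac)
  also have "\<dots> = v * (v - 1) * ((k - 2) * lam)" unfolding rep_mult by (simp only: mult_ac)
  finally show ?thesis by (simp only: lam_mult)
qed

lemma cardB_pos: "card \<B> > 0"
proof -
  have "v * (v - 1) * (v - 2) > 0" using kv by simp
  then show ?thesis unfolding card_blocks[symmetric] by simp
qed

text \<open>Take x on a block B and y off B. The blocks joining x and y to the other k - 1 points of
  B are distinct, since a block with x and two further points of B is B itself.\<close>

lemma lam_ge: "k - 1 \<le> lam"
proof -
  obtain B where B: "B \<in> \<B>" using cardB_pos by (metis card.empty ex_in_conv less_irrefl)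
  have "B \<noteq> {}" using cardB[OF B] k4 by auto
  then obtain x where x: "x \<in> B" by blast
  have "B \<noteq> P" using cardB[OF B] cardP kv by auto
  then obtain y where y: "y \<in> P" "y \<notin> B" using blockP[OF B] by blast
  have xP: "x \<in> P" using x blockP[OF B] by blast
  have "\<exists>C. C \<in> \<B> \<and> x \<in> C \<and> y \<in> C \<and> z \<in> C" if "z \<in> B - {x}" for z
  proof -
    have "z \<in> P" "x \<noteq> z" "y \<noteq> z" "x \<noteq> y" using that y x blockP[OF B] by auto
    then show ?thesis using block_exists[of x y z] xP y(1) by metis
  qed
  then obtain F where F: "\<And>z. z \<in> B - {x} \<Longrightarrow> F z \<in> \<B> \<and> x \<in> F z \<and> y \<in> F z \<and> z \<in> F z" by metis
  have "inj_on F (B - {x})"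
  proof (rule inj_onI)
    fix z w assume zw: "z \<in> B - {x}" "w \<in> B - {x}" "F z = F w"
    show "z = w"
    proof (rule ccontr)
      assume "z \<noteq> w"
      moreover have "w \<in> F z" using F[OF zw(2)] zw(3) by simp
      ultimately have "F z = B"
        using block_unique[of "F z" B x z w] F[OF zw(1)] B zw(1,2) x by blast
      then show False using F[OF zw(1)] y by auto
    qed
  qed
  then have "card (B - {x}) \<le> card {C \<in> \<B>. x \<in> C \<and> y \<in> C}"
    using F finB by (intro card_inj_on_le[of F]) auto
  moreover have "x \<noteq> y" using x y by blast
  moreover have "card (B - {x}) = k - 1" using x cardB[OF B] by simp
  ultimately show ?thesis using card_blocks_through_two[OF xP y(1)] by simp
qed

lemma rep_ge: "v - 1 \<le> rep"
proof -
  have "(k - 1) * (v - 1) \<le> (k - 1) * rep"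
    unfolding rep_mult using mult_le_mono2[OF lam_ge, of "v - 1"] by (simp only: mult.commute)
  then show ?thesis using k4 by simp
qed

text \<open>Fixed points of an automorphism that is not an involution: a block through three of them is
  invariant, so through a moved point \<open>y\<close> all but at most one block through a fixed point
  contains at most one further fixed point.\<close>

lemma card_fixed_points_le:
  assumes g: "bij_betw g P P" "\<And>B. B \<in> \<B> \<Longrightarrow> g ` B \<in> \<B>"
    and y: "y \<in> P" "g (g y) \<noteq> y"
  shows "card {x \<in> P. g x = x} \<le> lam + 1"
proof -
  let ?F = "{x \<in> P. g x = x}"
  have gP: "g x \<in> P" if "x \<in> P" for x using g(1) that by (auto simp: bij_betw_def)
  have inj: "x = z" if "g x = g z" "x \<in> P" "z \<in> P" for x z
    using g(1) that by (auto simp: bij_betw_def inj_on_def)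
  have gy: "g y \<noteq> y" using y by metis
  have ggy: "g (g y) \<noteq> g y" using gy inj y gP by metis
  have finF: "finite ?F" using finP by simp
  have inv: "g ` B = B" if B: "B \<in> \<B>" "{p, q, r} \<subseteq> B" "p \<noteq> q" "p \<noteq> r" "q \<noteq> r" "{p, q, r} \<subseteq> ?F" for B p q r
  proof -
    have "{p, q, r} \<subseteq> g ` B" using that by force
    then show ?thesis using block_unique[of "g ` B" B p q r] that g(2) by blast
  qed
  have "\<exists>C. C \<in> \<B> \<and> x \<in> C \<and> y \<in> C \<and> g y \<in> C" if "x \<in> ?F" for x
  proof -
    have "x \<in> P" "x \<noteq> y" "x \<noteq> g y" using that gy inj[of x y] y(1) by auto
    then show ?thesis using block_exists[of x y "g y"] gP[OF y(1)] y(1) gy by metis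
  qed
  then obtain C where C: "\<And>x. x \<in> ?F \<Longrightarrow> C x \<in> \<B> \<and> x \<in> C x \<and> y \<in> C x \<and> g y \<in> C x" by metis
  have k_le: "k \<le> lam + 1" using lam_ge by simp
  consider (none) "?F = {}" | (few) x where "x \<in> ?F" "card (C x \<inter> ?F) \<le> 2"
    | (many) x where "x \<in> ?F" "\<And>x. x \<in> ?F \<Longrightarrow> card (C x \<inter> ?F) \<ge> 3"
  proof -
    have "(\<exists>x\<in>?F. card (C x \<inter> ?F) \<le> 2) \<or> (\<forall>x\<in>?F. card (C x \<inter> ?F) \<ge> 3)"
      using not_less_eq_eq by (auto simp: numeral_3_eq_3 numeral_2_eq_2)
    then show thesis using none few many by blast
  qed
  then show ?thesis
  proof cases
    case none
    then show ?thesis by (simp only: card.empty)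
  next
    case few
    have xP: "x \<in> P" and xy: "x \<noteq> y" using few gy by auto
    have "\<exists>D. D \<in> \<B> \<and> x \<in> D \<and> y \<in> D \<and> z \<in> D" if "z \<in> ?F - {x}" for z
    proof -
      have "z \<in> P" "x \<noteq> z" "y \<noteq> z" using that gy by auto
      then show ?thesis using block_exists[of x y z] xP xy y(1) by metis
    qed
    then obtain D where D: "\<And>z. z \<in> ?F - {x} \<Longrightarrow> D z \<in> \<B> \<and> x \<in> D z \<and> y \<in> D z \<and> z \<in> D z" by metis
    \<comment> \<open>These points inject into the blocks through x and y other than
      \<open>C x\<close>; with the at most two fixed points on \<open>C x\<close> this makes (lam -
      1) + 2.\<close>
    let ?A = "{z \<in> ?F - {x}. D z \<noteq> C x}"
    have "inj_on D ?A"
    proof (rule inj_onI)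
      fix z w assume zw: "z \<in> ?A" "w \<in> ?A" "D z = D w"
      show "z = w"
      proof (rule ccontr)
        assume "z \<noteq> w"
        have z: "z \<in> ?F" "z \<noteq> x" and w: "w \<in> ?F" "w \<noteq> x" using zw(1,2) by blast+
        have Dz: "D z \<in> \<B>" "x \<in> D z" "y \<in> D z" "z \<in> D z" using D[of z] z by blast+
        have "w \<in> D z" using D[of w] w zw(3) by simp
        then have "g ` D z = D z" using inv[of "D z" x z w] Dz z w few(1) \<open>z \<noteq> w\<close> by blast
        then have gyD: "g y \<in> D z" using Dz(3) by blast
        have "x \<noteq> g y" using few(1) inj[of x y] xP y(1) xy by auto
        then have "D z = C x"
          using block_unique[of "D z" "C x" x y "g y"] Dz gyD C[OF few(1)] xy gy by auto
        then show False using zw(1) by blast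
      qed
    qed
    moreover have "D ` ?A \<subseteq> {B \<in> \<B>. x \<in> B \<and> y \<in> B} - {C x}" using D by auto
    moreover have "finite ({B \<in> \<B>. x \<in> B \<and> y \<in> B} - {C x})" using finB by simp
    ultimately have "card ?A \<le> card ({B \<in> \<B>. x \<in> B \<and> y \<in> B} - {C x})" using card_inj_on_le by blast
    also have "\<dots> = lam - 1"
      using card_blocks_through_two[OF xP y(1) xy] C[OF few(1)] finB by simp
    finally have A: "card ?A \<le> lam - 1" .
    have "?F \<subseteq> ?A \<union> (C x \<inter> ?F)" using D C few(1) by fastforce
    then have "card ?F \<le> card (?A \<union> (C x \<inter> ?F))" using finP by (intro card_mono) auto
    also have "\<dots> \<le> card ?A + card (C x \<inter> ?F)" by (rule card_Un_le)
    also have "\<dots> \<le> lam + 1" using A few(2) lam_ge k4 by linarith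
    finally show ?thesis .
  next
    case many
    \<comment> \<open>Every \<open>C z\<close> contains three fixed points, so it is invariant and
      contains y, g y and g (g y), which are distinct because g (g y) differs from y. Hence all
      \<open>C z\<close> coincide and the fixed points lie on one block.\<close>
    have "\<exists>E. C z = E \<and> {y, g y, g (g y)} \<subseteq> E" if z: "z \<in> ?F" for z
    proof -
      obtain T where T: "T \<subseteq> C z \<inter> ?F" "card T = 3"
        using many(2)[OF z] by (meson obtain_subset_with_card_n)
      then obtain p q r where "T = {p, q, r}" "p \<noteq> q" "p \<noteq> r" "q \<noteq> r" by (auto simp: card_3_iff)
      then have "g ` C z = C z" using inv[of "C z" p q r] T C[OF z] by auto
      then have "g (g y) \<in> C z" using C[OF z] by blast
      then show ?thesis using C[OF z] by auto
    qed
    then have "C z = C x" if "z \<in> ?F" for z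
      using block_unique[of "C z" "C x" y "g y" "g (g y)"] that C many(1) y gy ggy by metis
    then have "?F \<subseteq> C x" using C by blast
    then have "card ?F \<le> card (C x)" using finb C many(1) by (intro card_mono) auto
    then show ?thesis using cardB C many(1) k_le by auto
  qed
qed

text \<open>Every \<open>3\<close>-set lies in exactly one block, so by block-transitivity the members of an invariant
  family of triples are evenly distributed over the blocks.\<close>

lemma card_blocks_dvd:
  fixes \<Omega> :: "'c set" and s :: "'c \<Rightarrow> 'a set"
  assumes fin: "finite \<Omega>" and s: "\<And>w. w \<in> \<Omega> \<Longrightarrow> s w \<subseteq> P \<and> card (s w) = 3"
    and H: "\<And>B C. B \<in> \<B> \<Longrightarrow> C \<in> \<B> \<Longrightarrow> \<exists>g\<in>H. g ` B = C"
    and inv: "\<And>g. g \<in> H \<Longrightarrow> \<exists>F. inj_on F \<Omega> \<and> (\<forall>w\<in>\<Omega>. F w \<in> \<Omega> \<and> s (F w) = g ` s w)"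
  shows "card \<B> dvd card \<Omega>"
proof -
  \<comment> \<open>Used for (B, C) and for (C, B), so that equality follows without an inverse of
    F.\<close>
  have le: "card {w \<in> \<Omega>. s w \<subseteq> B} \<le> card {w \<in> \<Omega>. s w \<subseteq> C}" if BC: "B \<in> \<B>" "C \<in> \<B>" for B C
  proof -
    obtain g where g: "g \<in> H" "g ` B = C" using H[OF BC] by blast
    obtain F where F: "inj_on F \<Omega>" "\<forall>w\<in>\<Omega>. F w \<in> \<Omega> \<and> s (F w) = g ` s w" using inv[OF g(1)] by blast
    show ?thesis
    proof (rule card_inj_on_le[of F])
      show "inj_on F {w \<in> \<Omega>. s w \<subseteq> B}" using F(1) by (rule inj_on_subset) auto
      show "F ` {w \<in> \<Omega>. s w \<subseteq> B} \<subseteq> {w \<in> \<Omega>. s w \<subseteq> C}" using F(2) g(2) by blast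
    qed (use fin in auto)
  qed
  obtain B where B: "B \<in> \<B>" using cardB_pos by (metis card.empty ex_in_conv less_irrefl)
  have "card \<Omega> * 1 = card \<B> * card {w \<in> \<Omega>. s w \<subseteq> B}"
  proof (rule double_count[where R = "\<lambda>w B. s w \<subseteq> B"])
    show "card {C \<in> \<B>. s w \<subseteq> C} = 1" if "w \<in> \<Omega>" for w
      using card_blocks_through_three s[OF that] by blast
    show "card {w \<in> \<Omega>. s w \<subseteq> C} = card {w \<in> \<Omega>. s w \<subseteq> B}" if "C \<in> \<B>" for C
      using le[OF that B] le[OF B that] by simp
  qed (use fin finB in auto)
  then show ?thesis by simp
qed


text \<open>The cartesian structure is given by its coordinate lines: \<open>cls i x\<close> is the
  line through x in direction i, and an element of \<open>H\<close> may permute the directions by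
  \<sigma>.\<close>

lemma no_invariant_cartesian_decomposition:
  fixes cls :: "'i \<Rightarrow> 'a \<Rightarrow> 'a set" and I :: "'i set"
  assumes H: "\<And>B C. B \<in> \<B> \<Longrightarrow> C \<in> \<B> \<Longrightarrow> \<exists>g\<in>H. g ` B = C"
    and Hbij: "\<And>g. g \<in> H \<Longrightarrow> bij_betw g P P"
    and I: "finite I" "card I = m" "m \<ge> 2" and n: "n \<ge> 3" "v = n ^ m"
    and cls: "\<And>i x. i \<in> I \<Longrightarrow> x \<in> P \<Longrightarrow> cls i x \<subseteq> P \<and> x \<in> cls i x \<and> card (cls i x) = n"
    and cls_eq: "\<And>i x y. i \<in> I \<Longrightarrow> x \<in> P \<Longrightarrow> y \<in> cls i x \<Longrightarrow> cls i y = cls i x"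
    and cls_int: "\<And>i j x y. i \<in> I \<Longrightarrow> j \<in> I \<Longrightarrow> x \<in> P \<Longrightarrow> i \<noteq> j \<Longrightarrow> y \<in> cls i x \<Longrightarrow> y \<in> cls j x \<Longrightarrow> y = x"
    and inv: "\<And>g. g \<in> H \<Longrightarrow> \<exists>\<sigma>. inj_on \<sigma> I \<and> (\<forall>i\<in>I. \<sigma> i \<in> I \<and> (\<forall>x\<in>P. g ` cls i x = cls (\<sigma> i) (g x)))"
  shows False
proof -
  have fcls: "finite (cls i x)" if "i \<in> I" "x \<in> P" for i x
    using cls[OF that] finP finite_subset by blast
  \<comment> \<open>Triples are tagged with direction and line, so that the size
    \<open>m * (v / n) * (n choose 3)\<close> comes out of plain summation.\<close>
  define \<Omega>1 where "\<Omega>1 = (SIGMA i:I. SIGMA K:cls i ` P. {S. S \<subseteq> K \<and> card S = 3})"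
  have cardK: "card (cls i ` P) * n = v" if i: "i \<in> I" for i
  proof -
    have "card P = card (cls i ` P) * n"
    proof (rule card_eq_fibre_mult[OF finP])
      fix K assume "K \<in> cls i ` P"
      then obtain x where x: "x \<in> P" "K = cls i x" by blast
      have "{y \<in> P. cls i y = K} = K"
        using cls[OF i] cls_eq[OF i] x by blast
      then show "card {y \<in> P. cls i y = K} = n" using cls[OF i x(1)] x(2) by simp
    qed
    then show ?thesis using cardP by simp
  qed
  have finK: "finite K" "card K = n" "K \<subseteq> P" if "i \<in> I" "K \<in> cls i ` P" for i K
    using that fcls cls by blast+
  have fin3: "finite {S. S \<subseteq> K \<and> card S = 3}" if "i \<in> I" "K \<in> cls i ` P" for i K
    using finK(1)[OF that] by simp
  have inner: "card (SIGMA K:cls i ` P. {S. S \<subseteq> K \<and> card S = 3}) = card (cls i ` P) * (n choose 3)"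
    if i: "i \<in> I" for i
  proof -
    have "card (SIGMA K:cls i ` P. {S. S \<subseteq> K \<and> card S = 3}) = (\<Sum>K\<in>cls i ` P. card {S. S \<subseteq> K \<and> card S = 3})"
      using finP fin3[OF i] by (intro card_SigmaI) auto
    also have "\<dots> = (\<Sum>K\<in>cls i ` P. n choose 3)"
      using finK[OF i] by (intro sum.cong refl) (simp add: n_subsets)
    finally show ?thesis by simp
  qed
  have fin1: "finite \<Omega>1" unfolding \<Omega>1_def
    using I(1) finP fin3 by (intro finite_SigmaI) auto
  have "n * card \<Omega>1 = (\<Sum>i\<in>I. n * (card (cls i ` P) * (n choose 3)))"
    unfolding \<Omega>1_def using I(1) finP fin3 inner
    by (subst card_SigmaI) (auto simp: sum_distrib_left intro!: finite_SigmaI)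
  also have "\<dots> = (\<Sum>i\<in>I. v * (n choose 3))"
  proof (intro sum.cong refl)
    fix i assume "i \<in> I"
    then show "n * (card (cls i ` P) * (n choose 3)) = v * (n choose 3)"
      using cardK[of i] by (metis mult.assoc mult.commute)
  qed
  finally have c1': "n * card \<Omega>1 = m * v * (n choose 3)" using I(2) by simp
  have c6: "6 * (n choose 3) = n * ((n - 1) * (n - 2))"
  proof -
    have "3 * (n choose 3) = n * ((n - 1) choose 2)" using times_binomial_minus1_eq[of 3 n] by simp
    moreover have "2 * ((n - 1) choose 2) = (n - 1) * (n - 2)"
      using times_binomial_minus1_eq[of 2 "n - 1"] by (simp add: numeral_eq_Suc)
    moreover have "6 * (n choose 3) = 2 * (3 * (n choose 3))" by simp
    ultimately show ?thesis by (simp only: mult.left_commute[of 2])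
  qed
  have "n * (6 * card \<Omega>1) = m * v * (6 * (n choose 3))" using c1' by (simp add: mult.left_commute)
  also have "\<dots> = n * (m * v * (n - 1) * (n - 2))" unfolding c6 by (simp only: mult_ac)
  finally have c1: "6 * card \<Omega>1 = m * v * (n - 1) * (n - 2)" using n(1) by simp
  have d1: "card \<B> dvd card \<Omega>1"
  proof (rule card_blocks_dvd[OF fin1, where s = "\<lambda>w. snd (snd w)" and H = H])
    show "snd (snd w) \<subseteq> P \<and> card (snd (snd w)) = 3" if "w \<in> \<Omega>1" for w
      using that finK(3) unfolding \<Omega>1_def by fastforce
    show "\<exists>g\<in>H. g ` B = C" if "B \<in> \<B>" "C \<in> \<B>" for B C using H[OF that] .
    fix g assume g: "g \<in> H"
    have gi: "inj_on g P" using Hbij[OF g] by (simp add: bij_betw_def)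
    have gP: "g x \<in> P" if "x \<in> P" for x using Hbij[OF g] that by (auto simp: bij_betw_def)
    obtain \<sigma> where \<sigma>: "inj_on \<sigma> I" "\<And>i. i \<in> I \<Longrightarrow> \<sigma> i \<in> I" "\<And>i x. i \<in> I \<Longrightarrow> x \<in> P \<Longrightarrow> g ` cls i x = cls (\<sigma> i) (g x)"
      using inv[OF g] by blast
    have el: "i \<in> I \<and> K \<subseteq> P \<and> K \<in> cls i ` P \<and> S \<subseteq> K \<and> card S = 3" if "(i, K, S) \<in> \<Omega>1" for i K S
      using that finK(3) unfolding \<Omega>1_def by auto
    let ?F = "\<lambda>(i, K, S). (\<sigma> i, g ` K, g ` S)"
    have "inj_on ?F \<Omega>1"
    proof (rule inj_onI)
      fix w w' assume ww: "w \<in> \<Omega>1" "w' \<in> \<Omega>1" "?F w = ?F w'"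
      obtain i K S i' K' S' where w: "w = (i, K, S)" "w' = (i', K', S')" by (cases w, cases w')
      have a: "(i, K, S) \<in> \<Omega>1" "(i', K', S') \<in> \<Omega>1"
        and e: "\<sigma> i = \<sigma> i'" "g ` K = g ` K'" "g ` S = g ` S'" using ww unfolding w by auto
      note l = el[OF a(1)] el[OF a(2)]
      have "i = i'" using l e(1) \<sigma>(1) by (meson inj_onD)
      moreover have "K = K'" using l e(2) inj_on_image_eq_iff[OF gi, of K K'] by blast
      moreover have "S = S'" using l e(3) inj_on_image_eq_iff[OF gi, of S S'] by blast
      ultimately show "w = w'" unfolding w by blast
    qed
    moreover have "?F w \<in> \<Omega>1 \<and> snd (snd (?F w)) = g ` snd (snd w)" if w: "w \<in> \<Omega>1" for w
    proof -
      obtain i K S where wi: "w = (i, K, S)" by (cases w)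
      note l = el[OF w[unfolded wi]]
      have "K \<in> cls i ` P" using l by blast
      then obtain x where x: "x \<in> P" "K = cls i x" by (rule imageE) blast
      have "g ` K = cls (\<sigma> i) (g x)" using \<sigma>(3)[of i x] l x by simp
      then have "g ` K \<in> cls (\<sigma> i) ` P" using gP[OF x(1)] by (simp only: imageI)
      moreover have "inj_on g S" using l gi inj_on_subset by blast
      then have "card (g ` S) = 3" using l card_image[of g S] by simp
      ultimately show ?thesis using l \<sigma>(2) unfolding wi \<Omega>1_def by auto
    qed
    ultimately show "\<exists>F. inj_on F \<Omega>1 \<and> (\<forall>w\<in>\<Omega>1. F w \<in> \<Omega>1 \<and> snd (snd (F w)) = g ` snd (snd w))" by blast
  qed
  \<comment> \<open>Ordered L-shapes: a corner x, a direction i with a point y, another direction j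
    with a point z. The map \<open>f\<close> keeps the corner and forgets the order of the
    arms.\<close>
  define \<Theta> where "\<Theta> = (SIGMA x:P. SIGMA i:I. SIGMA y:cls i x - {x}. SIGMA j:I - {i}. cls j x - {x})"
  define f :: "'a \<times> 'i \<times> 'a \<times> 'i \<times> 'a \<Rightarrow> 'a \<times> 'a set"
    where "f = (\<lambda>(x, i, y, j, z). (x, {y, z}))"
  have cn: "card (cls i x - {x}) = n - 1" if "i \<in> I" "x \<in> P" for i x
    using cls[OF that] fcls[OF that] by simp
  have el2: "(x, i, y, j, z) \<in> \<Theta> \<longleftrightarrow> x \<in> P \<and> i \<in> I \<and> j \<in> I \<and> i \<noteq> j \<and> y \<in> cls i x \<and> y \<noteq> x \<and> z \<in> cls j x \<and> z \<noteq> x" for x i y j z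
    unfolding \<Theta>_def by auto
  have fin\<Theta>: "finite \<Theta>" unfolding \<Theta>_def
    using finP I(1) fcls by (intro finite_SigmaI finite_Diff) auto
  have card\<Theta>: "card \<Theta> = v * (m * ((n - 1) * ((m - 1) * (n - 1))))"
  proof -
    have 1: "card (SIGMA j:I - {i}. cls j x - {x}) = (m - 1) * (n - 1)" if "i \<in> I" "x \<in> P" for i x
      using that I fcls cn by (subst card_SigmaI) auto
    have 2: "card (SIGMA y:cls i x - {x}. SIGMA j:I - {i}. cls j x - {x}) = (n - 1) * ((m - 1) * (n - 1))" if "i \<in> I" "x \<in> P" for i x
      using that I fcls cn 1 by (subst card_SigmaI) (auto intro!: finite_SigmaI)
    have 3: "card (SIGMA i:I. SIGMA y:cls i x - {x}. SIGMA j:I - {i}. cls j x - {x}) = m * ((n - 1) * ((m - 1) * (n - 1)))" if "x \<in> P" for x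
      using that I fcls 2 by (subst card_SigmaI) (auto intro!: finite_SigmaI)
    show ?thesis unfolding \<Theta>_def
      using finP cardP I fcls 3 by (subst card_SigmaI) (auto intro!: finite_SigmaI)
  qed
  have yz: "y \<noteq> z" if "(x, i, y, j, z) \<in> \<Theta>" for x i y j z
    using that cls_int[of i j x y] unfolding el2 by blast
  have "card \<Theta> = card (f ` \<Theta>) * 2"
  proof (rule card_eq_fibre_mult[OF fin\<Theta>])
    fix w assume "w \<in> f ` \<Theta>"
    then obtain x i y j z where t: "(x, i, y, j, z) \<in> \<Theta>" "w = (x, {y, z})" unfolding f_def by auto
    \<comment> \<open>The directions are recovered from y and z, because lines through x in
      different directions meet only in x.\<close>
    have "{u \<in> \<Theta>. f u = w} = {(x, i, y, j, z), (x, j, z, i, y)}" (is "?L = ?R")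
    proof
      show "?R \<subseteq> ?L" using t unfolding el2 f_def by (auto simp: el2)
      show "?L \<subseteq> ?R"
      proof
        fix u assume u: "u \<in> ?L"
        obtain x' i' y' j' z' where u': "u = (x', i', y', j', z')" by (cases u)
        have a: "(x', i', y', j', z') \<in> \<Theta>" "x' = x" "{y', z'} = {y, z}" using u t(2) unfolding u' f_def by auto
        have b: "x \<in> P" "i \<in> I" "j \<in> I" "y \<in> cls i x" "y \<noteq> x" "z \<in> cls j x" "z \<noteq> x"
          using t(1) unfolding el2 by blast+
        have c: "i' \<in> I" "j' \<in> I" "y' \<in> cls i' x" "z' \<in> cls j' x"
          using a(1) unfolding el2 a(2) by blast+
        have uniq: "h = h'" if "h \<in> I" "h' \<in> I" "q \<in> cls h x" "q \<in> cls h' x" "q \<noteq> x" for h h' q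
          using cls_int[of h h' x q] that b(1) by blast
        have "i' = i \<and> j' = j" if "y' = y" "z' = z"
          using uniq[of i' i y] uniq[of j' j z] b c unfolding that by blast
        moreover have "i' = j \<and> j' = i" if "y' = z" "z' = y"
          using uniq[of i' j z] uniq[of j' i y] b c unfolding that by blast
        ultimately show "u \<in> ?R" using a(2,3) unfolding u' by (auto simp: doubleton_eq_iff)
      qed
    qed
    moreover have "i \<noteq> j" using t(1) unfolding el2 by blast
    ultimately show "card {u \<in> \<Theta>. f u = w} = 2" by simp
  qed
  then have c2: "2 * card (f ` \<Theta>) = v * (m * (m - 1)) * (n - 1)\<^sup>2"
    unfolding card\<Theta> power2_eq_square by (simp only: mult_ac)
  have d2: "card \<B> dvd card (f ` \<Theta>)"
  proof (rule card_blocks_dvd[where \<Omega> = "f ` \<Theta>" and s = "\<lambda>(x, Q). insert x Q" and H = H])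
    show "finite (f ` \<Theta>)" using fin\<Theta> by simp
    have el3: "\<exists>x i y j z. (x, i, y, j, z) \<in> \<Theta> \<and> w = (x, {y, z}) \<and> x \<in> P \<and> y \<in> P \<and> z \<in> P" if w: "w \<in> f ` \<Theta>" for w
    proof -
      obtain x i y j z where t: "(x, i, y, j, z) \<in> \<Theta>" "w = (x, {y, z})" using w unfolding f_def by auto
      then have "y \<in> P" "z \<in> P" "x \<in> P" using cls unfolding el2 by blast+
      then show ?thesis using t by blast
    qed
    show "(case w of (x, Q) \<Rightarrow> insert x Q) \<subseteq> P \<and> card (case w of (x, Q) \<Rightarrow> insert x Q) = 3" if w: "w \<in> f ` \<Theta>" for w
    proof -
      obtain x i y j z where t: "(x, i, y, j, z) \<in> \<Theta>" "w = (x, {y, z})" "x \<in> P" "y \<in> P" "z \<in> P" using el3[OF w] by blast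
      moreover have "x \<noteq> y" "x \<noteq> z" using t(1) unfolding el2 by blast+
      ultimately show ?thesis using yz[OF t(1)] by simp
    qed
    show "\<exists>g\<in>H. g ` B = C" if "B \<in> \<B>" "C \<in> \<B>" for B C using H[OF that] .
    fix g assume g: "g \<in> H"
    have gi: "inj_on g P" using Hbij[OF g] by (simp add: bij_betw_def)
    have gP: "g x \<in> P" if "x \<in> P" for x using Hbij[OF g] that by (auto simp: bij_betw_def)
    obtain \<sigma> where \<sigma>: "inj_on \<sigma> I" "\<And>i. i \<in> I \<Longrightarrow> \<sigma> i \<in> I" "\<And>i x. i \<in> I \<Longrightarrow> x \<in> P \<Longrightarrow> g ` cls i x = cls (\<sigma> i) (g x)"
      using inv[OF g] by blast
    let ?F = "\<lambda>(x, Q). (g x, g ` Q)"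
    have injF: "inj_on ?F (f ` \<Theta>)"
    proof (rule inj_onI)
      fix w w' assume a: "w \<in> f ` \<Theta>" "w' \<in> f ` \<Theta>" "?F w = ?F w'"
      obtain x Q x' Q' where ww: "w = (x, Q)" "w' = (x', Q')" by (cases w, cases w')
      have "x \<in> P" "Q \<subseteq> P" "x' \<in> P" "Q' \<subseteq> P" using el3[OF a(1)] el3[OF a(2)] unfolding ww by auto
      moreover have "g x = g x'" "g ` Q = g ` Q'" using a(3) unfolding ww by auto
      ultimately show "w = w'" unfolding ww using gi by (metis inj_onD inj_on_image_eq_iff)
    qed
    have mapF: "?F w \<in> f ` \<Theta> \<and> (case ?F w of (x, Q) \<Rightarrow> insert x Q) = g ` (case w of (x, Q) \<Rightarrow> insert x Q)" if w: "w \<in> f ` \<Theta>" for w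
    proof -
      obtain x i y j z where t: "(x, i, y, j, z) \<in> \<Theta>" "w = (x, {y, z})" "x \<in> P" "y \<in> P" "z \<in> P" using el3[OF w] by blast
      have t': "i \<in> I" "j \<in> I" "i \<noteq> j" "y \<in> cls i x" "y \<noteq> x" "z \<in> cls j x" "z \<noteq> x" using t(1) unfolding el2 by blast+
      have "(g x, \<sigma> i, g y, \<sigma> j, g z) \<in> \<Theta>"
        unfolding el2
      proof (intro conjI)
        show "g x \<in> P" "\<sigma> i \<in> I" "\<sigma> j \<in> I" using gP t(3) \<sigma>(2) t' by auto
        show "\<sigma> i \<noteq> \<sigma> j" using \<sigma>(1) t' by (meson inj_onD)
        show "g y \<in> cls (\<sigma> i) (g x)" "g z \<in> cls (\<sigma> j) (g x)"
          using \<sigma>(3)[of i x] \<sigma>(3)[of j x] t' t(3) by blast+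
        show "g y \<noteq> g x" "g z \<noteq> g x" using gi t t' by (meson inj_onD)+
      qed
      then have "f (g x, \<sigma> i, g y, \<sigma> j, g z) \<in> f ` \<Theta>" by (rule imageI)
      then show ?thesis unfolding t(2) f_def by simp
    qed
    show "\<exists>F. inj_on F (f ` \<Theta>) \<and> (\<forall>w\<in>f ` \<Theta>. F w \<in> f ` \<Theta> \<and> (case F w of (x, Q) \<Rightarrow> insert x Q) = g ` (case w of (x, Q) \<Rightarrow> insert x Q))"
      using injF by (rule exI[of _ ?F, OF conjI]) (rule ballI, erule mapF)
  qed
  show False
    by (rule no_cartesian_parameters[OF n(1) I(3) n(2) k4 lam_mult lam_ge card_blocks d1 c1 d2 c2])
qed


end

section \<open>Minimal normal subgroups\<close>

context group
begin

definition cj :: "'a \<Rightarrow> 'a \<Rightarrow> 'a" where "cj g x = g \<otimes> x \<otimes> inv g"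

lemma cj_closed [simp]: "g \<in> carrier G \<Longrightarrow> x \<in> carrier G \<Longrightarrow> cj g x \<in> carrier G"
  by (simp add: cj_def)

lemma cj_mult: "g \<in> carrier G \<Longrightarrow> x \<in> carrier G \<Longrightarrow> y \<in> carrier G \<Longrightarrow> cj g (x \<otimes> y) = cj g x \<otimes> cj g y"
  by (simp add: cj_def m_assoc inv_solve_left)

lemma cj_cj: "g \<in> carrier G \<Longrightarrow> h \<in> carrier G \<Longrightarrow> x \<in> carrier G \<Longrightarrow> cj g (cj h x) = cj (g \<otimes> h) x"
  by (simp add: cj_def m_assoc inv_mult_group)

lemma cj_one [simp]: "x \<in> carrier G \<Longrightarrow> cj \<one> x = x"
  by (simp add: cj_def)

lemma cj_one_right [simp]: "g \<in> carrier G \<Longrightarrow> cj g \<one> = \<one>"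
  by (simp add: cj_def)

lemma cj_inv: "g \<in> carrier G \<Longrightarrow> x \<in> carrier G \<Longrightarrow> cj g (inv x) = inv (cj g x)"
  by (simp add: cj_def m_assoc inv_mult_group)

lemma cj_inv_cancel [simp]: "g \<in> carrier G \<Longrightarrow> x \<in> carrier G \<Longrightarrow> cj (inv g) (cj g x) = x"
  by (simp add: cj_cj)

lemma cj_inv_cancel2 [simp]: "g \<in> carrier G \<Longrightarrow> x \<in> carrier G \<Longrightarrow> cj g (cj (inv g) x) = x"
  by (simp add: cj_cj)

lemma cj_eq_iff [simp]: "g \<in> carrier G \<Longrightarrow> x \<in> carrier G \<Longrightarrow> y \<in> carrier G \<Longrightarrow> cj g x = cj g y \<longleftrightarrow> x = y"
  by (metis cj_inv_cancel)

lemma cj_eq_self_iff: "g \<in> carrier G \<Longrightarrow> x \<in> carrier G \<Longrightarrow> cj g x = x \<longleftrightarrow> g \<otimes> x = x \<otimes> g"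
  by (metis cj_def inv_solve_right' m_closed)

lemma cj_mult_left: "g \<in> carrier G \<Longrightarrow> x \<in> carrier G \<Longrightarrow> cj g x \<otimes> g = g \<otimes> x"
  by (simp add: cj_def m_assoc)

lemma commute_inv:
  assumes "x \<in> carrier G" "y \<in> carrier G" "x \<otimes> y = y \<otimes> x"
  shows "inv x \<otimes> y = y \<otimes> inv x"
  using assms by (metis inv_closed inv_solve_left inv_solve_right m_assoc m_closed)

lemma commute_mult:
  assumes "x \<in> carrier G" "y \<in> carrier G" "z \<in> carrier G" "x \<otimes> z = z \<otimes> x" "y \<otimes> z = z \<otimes> y"
  shows "(x \<otimes> y) \<otimes> z = z \<otimes> (x \<otimes> y)"
  using assms by (metis m_assoc)

lemma commute_cj:
  assumes "g \<in> carrier G" "x \<in> carrier G" "y \<in> carrier G" "x \<otimes> y = y \<otimes> x"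
  shows "cj g x \<otimes> cj g y = cj g y \<otimes> cj g x"
  using assms by (metis cj_mult)

text \<open>Common source of the orbit-stabilizer count, the class-size formula and the order of a
  projection: the fibres of F are the left cosets of L in K.\<close>

lemma card_subgroup_fibres:
  assumes fin: "finite (carrier G)" and K: "subgroup K G" and L: "L \<subseteq> K"
    and F: "\<And>x y. x \<in> K \<Longrightarrow> y \<in> K \<Longrightarrow> F x = F y \<longleftrightarrow> inv x \<otimes> y \<in> L"
  shows "card K = card (F ` K) * card L"
proof (rule card_eq_fibre_mult)
  have KG: "K \<subseteq> carrier G" using K by (rule subgroup.subset)
  show "finite K" using fin KG finite_subset by blast
  fix z assume "z \<in> F ` K"
  then obtain x where x: "x \<in> K" "z = F x" by (rule imageE)
  have xG: "x \<in> carrier G" using x KG by blast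
  have "{y \<in> K. F y = z} = (\<lambda>l. x \<otimes> l) ` L"
  proof (intro equalityI subsetI)
    fix y assume "y \<in> {y \<in> K. F y = z}"
    then have y: "y \<in> K" "F x = F y" using x by auto
    then have "inv x \<otimes> y \<in> L" using F x by simp
    moreover have "y = x \<otimes> (inv x \<otimes> y)" using xG y KG by (simp add: inv_solve_left subsetD m_assoc[symmetric])
    ultimately show "y \<in> (\<lambda>l. x \<otimes> l) ` L" by (rule rev_image_eqI)
  next
    fix y assume "y \<in> (\<lambda>l. x \<otimes> l) ` L"
    then obtain l where l: "l \<in> L" "y = x \<otimes> l" by (rule imageE)
    have lK: "l \<in> K" using l L by (rule_tac subsetD)
    have yK: "y \<in> K" using K x l lK by (simp add: subgroup.m_closed)
    have "inv x \<otimes> y = l" using xG lK KG l by (simp add: subsetD m_assoc[symmetric])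
    then have "F x = F y" using F[OF x(1) yK] l by simp
    then show "y \<in> {y \<in> K. F y = z}" using yK x by simp
  qed
  moreover have "inj_on (\<lambda>l. x \<otimes> l) L"
    using xG L KG Units_l_cancel by (intro inj_onI) (simp add: Units_eq subset_iff)
  ultimately show "card {y \<in> K. F y = z} = card L" by (simp add: card_image)
qed

text \<open>K need not contain N: besides the whole group, K will be a minimal normal subgroup, a
  simple factor or a point stabilizer.\<close>

definition nrm :: "'a set \<Rightarrow> 'a set \<Rightarrow> bool" where
  "nrm K N \<longleftrightarrow> subgroup N G \<and> (\<forall>g\<in>K. \<forall>n\<in>N. cj g n \<in> N)"

definition min_nrm :: "'a set \<Rightarrow> 'a set \<Rightarrow> bool" where
  "min_nrm K N \<longleftrightarrow> nrm K N \<and> N \<noteq> {\<one>} \<and> (\<forall>M. nrm K M \<and> M \<subseteq> N \<longrightarrow> M = {\<one>} \<or> M = N)"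

lemma nrm_subgroup: "nrm K N \<Longrightarrow> subgroup N G" by (simp add: nrm_def)

lemma nrm_cj: "nrm K N \<Longrightarrow> g \<in> K \<Longrightarrow> n \<in> N \<Longrightarrow> cj g n \<in> N" by (simp add: nrm_def)

lemma nrm_mono: "nrm K N \<Longrightarrow> K' \<subseteq> K \<Longrightarrow> nrm K' N" by (auto simp: nrm_def)

lemma subgroup_cj_image:
  assumes "subgroup H G" "g \<in> carrier G"
  shows "subgroup (cj g ` H) G"
proof (rule subgroupI)
  have HG: "h \<in> carrier G" if "h \<in> H" for h using assms(1) that by (rule subgroup.mem_carrier)
  show "cj g ` H \<subseteq> carrier G" using HG assms(2) by auto
  show "cj g ` H \<noteq> {}" using assms(1) subgroup.one_closed by auto
  fix a assume "a \<in> cj g ` H"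
  then obtain x where x: "x \<in> H" "a = cj g x" by (rule imageE)
  have "inv a = cj g (inv x)" using x HG assms(2) cj_inv by simp
  then show "inv a \<in> cj g ` H" using subgroup.m_inv_closed[OF assms(1) x(1)] by (simp only: imageI)
  fix b assume "b \<in> cj g ` H"
  then obtain y where y: "y \<in> H" "b = cj g y" by (rule imageE)
  have "a \<otimes> b = cj g (x \<otimes> y)" using x y HG assms(2) cj_mult by simp
  then show "a \<otimes> b \<in> cj g ` H" using subgroup.m_closed[OF assms(1) x(1) y(1)] by (simp only: imageI)
qed

lemma cj_image_cj_image:
  assumes "H \<subseteq> carrier G" "g \<in> carrier G" "h \<in> carrier G"
  shows "cj g ` cj h ` H = cj (g \<otimes> h) ` H"
  using assms by (force simp: image_image cj_cj)

lemma ex_min_nrm: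
  assumes "finite N" "nrm K N" "N \<noteq> {\<one>}"
  obtains M where "min_nrm K M" "M \<subseteq> N"
proof -
  have "\<exists>M. min_nrm K M \<and> M \<subseteq> N"
    using assms
  proof (induction "card N" arbitrary: N rule: less_induct)
    case less
    show ?case
    proof (cases "min_nrm K N")
      case True
      then show ?thesis by blast
    next
      case False
      then obtain M where M: "nrm K M" "M \<subseteq> N" "M \<noteq> {\<one>}" "M \<noteq> N"
        using less.prems by (auto simp: min_nrm_def)
      then have "card M < card N" using less.prems(1) by (simp add: psubset_card_mono psubsetI)
      moreover have "finite M" using M less.prems(1) finite_subset by blast
      ultimately obtain L where "min_nrm K L" "L \<subseteq> M" using less.hyps[of M] M by metis
      then show ?thesis using M(2) by (meson subset_trans)
    qed
  qed
  then show thesis using that by metis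
qed

end

section \<open>A nonabelian minimal normal subgroup as a direct product of simple factors\<close>

locale min_normal = group G for G (structure) +
  fixes N T
  assumes finG: "finite (carrier G)"
    and minN: "min_nrm (carrier G) N"
    and nonab: "\<exists>x\<in>N. \<exists>y\<in>N. x \<otimes> y \<noteq> y \<otimes> x"
    and minT: "min_nrm N T" and TN: "T \<subseteq> N"
begin

text \<open>These conjugates will turn out to be the simple direct factors of N. The seed
  \<open>T\<close> is minimal among the nontrivial subgroups normalized by N and not yet known to be
  simple.\<close>

definition \<T> where "\<T> = (\<lambda>g. cj g ` T) ` carrier G"

lemma subN: "subgroup N G" using minN by (simp add: min_nrm_def nrm_def)

lemma subT: "subgroup T G" using minT by (simp add: min_nrm_def nrm_def)

lemma NG: "x \<in> N \<Longrightarrow> x \<in> carrier G" using subN by (rule subgroup.mem_carrier)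

lemma cjN: "g \<in> carrier G \<Longrightarrow> x \<in> N \<Longrightarrow> cj g x \<in> N" using minN by (simp add: min_nrm_def nrm_def)

lemma N_mult: "x \<in> N \<Longrightarrow> y \<in> N \<Longrightarrow> x \<otimes> y \<in> N" using subN by (rule subgroup.m_closed)

lemma N_inv: "x \<in> N \<Longrightarrow> inv x \<in> N" using subN by (rule subgroup.m_inv_closed)

lemma N_one: "\<one> \<in> N" using subN by (rule subgroup.one_closed)

lemma TTN: "A \<in> \<T> \<Longrightarrow> x \<in> A \<Longrightarrow> x \<in> N" using cjN TN by (auto simp: \<T>_def)

lemma TTG: "A \<in> \<T> \<Longrightarrow> x \<in> A \<Longrightarrow> x \<in> carrier G" using TTN NG by blast

lemma T_in: "T \<in> \<T>"
proof -
  have "cj \<one> ` T = T" using TN NG by (force simp: image_iff)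
  then show ?thesis unfolding \<T>_def by (metis imageI one_closed)
qed

lemma fin\<T>: "finite \<T>" by (simp add: \<T>_def finG)

lemma TT_cj: "A \<in> \<T> \<Longrightarrow> g \<in> carrier G \<Longrightarrow> cj g ` A \<in> \<T>"
  using TN NG by (force simp: \<T>_def cj_image_cj_image subset_iff)

lemma TT_transitive:
  assumes "A \<in> \<T>" "B \<in> \<T>"
  obtains g where "g \<in> carrier G" "cj g ` A = B"
proof -
  obtain h k where hk: "h \<in> carrier G" "A = cj h ` T" "k \<in> carrier G" "B = cj k ` T"
    using assms by (auto simp: \<T>_def)
  have "cj (k \<otimes> inv h) ` A = cj ((k \<otimes> inv h) \<otimes> h) ` T"
    unfolding hk(2) using hk TN NG by (intro cj_image_cj_image) auto
  also have "(k \<otimes> inv h) \<otimes> h = k" using hk by (simp add: m_assoc)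
  finally show thesis using that[of "k \<otimes> inv h"] hk by simp
qed

lemma TT_sub: "A \<in> \<T> \<Longrightarrow> subgroup A G" using subgroup_cj_image[OF subT] by (auto simp: \<T>_def)

lemma TT_mult: "A \<in> \<T> \<Longrightarrow> x \<in> A \<Longrightarrow> y \<in> A \<Longrightarrow> x \<otimes> y \<in> A"
  by (rule subgroup.m_closed[OF TT_sub])

lemma TT_inv: "A \<in> \<T> \<Longrightarrow> x \<in> A \<Longrightarrow> inv x \<in> A"
  by (rule subgroup.m_inv_closed[OF TT_sub])

lemma TT_one: "A \<in> \<T> \<Longrightarrow> \<one> \<in> A"
  by (rule subgroup.one_closed[OF TT_sub])

text \<open>Conjugation by g permutes the subgroups normalized by N, since N is normal in G.\<close>

lemma min_nrm_TT:
  assumes "A \<in> \<T>"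
  shows "min_nrm N A"
proof -
  obtain g where g: "g \<in> carrier G" "A = cj g ` T" using assms by (auto simp: \<T>_def)
  have TG: "t \<in> carrier G" if "t \<in> T" for t using that TN NG by blast
  have nrm: "cj n (cj h x) \<in> cj h ` M" if "h \<in> carrier G" "nrm N M" "n \<in> N" "x \<in> M" for h M n x
  proof -
    have xG: "x \<in> carrier G" by (rule subgroup.mem_carrier[OF nrm_subgroup[OF that(2)] that(4)])
    have n': "cj (inv h) n \<in> N" using that cjN by simp
    have "cj n (cj h x) = cj h (cj (cj (inv h) n) x)"
    proof -
      have "h \<otimes> cj (inv h) n = n \<otimes> h" using that NG by (simp add: cj_def m_assoc[symmetric])
      then show ?thesis using that NG xG n' by (simp add: cj_cj)
    qed
    then show ?thesis using nrm_cj[OF that(2) n' that(4)] by simp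
  qed
  have 1: "nrm N A" unfolding nrm_def
    using TT_sub[OF assms] nrm[OF g(1), of T] minT g(2) by (auto simp: min_nrm_def)
  have 2: "A \<noteq> {\<one>}"
  proof
    assume "A = {\<one>}"
    then have "cj g x = \<one>" if "x \<in> T" for x using that g by auto
    then have "x = \<one>" if "x \<in> T" for x using that g(1) TG by (metis cj_eq_iff cj_one_right one_closed)
    then have "T \<subseteq> {\<one>}" by (metis singletonI subsetI)
    then have "T = {\<one>}" using subgroup.one_closed[OF subT] by auto
    then show False using minT by (simp add: min_nrm_def)
  qed
  have 3: "M = {\<one>} \<or> M = A" if M: "nrm N M" "M \<subseteq> A" for M
  proof -
    let ?L = "cj (inv g) ` M"
    have MG: "M \<subseteq> carrier G" by (rule subgroup.subset[OF nrm_subgroup[OF M(1)]])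
    have "nrm N ?L" unfolding nrm_def
      using subgroup_cj_image[OF nrm_subgroup[OF M(1)]] nrm[OF _ M(1), of "inv g"] g(1) by auto
    moreover have "?L \<subseteq> T" using M(2) g TG by auto
    ultimately have "?L = {\<one>} \<or> ?L = T" using minT by (simp add: min_nrm_def)
    moreover have "M = cj g ` ?L"
      using MG g(1) by (force simp: image_image image_iff)
    ultimately show ?thesis using g by auto
  qed
  show ?thesis unfolding min_nrm_def using 1 2 3 by blast
qed

lemma cj_N_TT: "A \<in> \<T> \<Longrightarrow> n \<in> N \<Longrightarrow> x \<in> A \<Longrightarrow> cj n x \<in> A"
  using min_nrm_TT by (auto simp: min_nrm_def nrm_def)

lemma TT_int:
  assumes "A \<in> \<T>" "B \<in> \<T>" "A \<noteq> B" "x \<in> A" "x \<in> B"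
  shows "x = \<one>"
proof -
  have "nrm N (A \<inter> B)" unfolding nrm_def
    using assms cj_N_TT TT_sub subgroups_Inter_pair by auto
  then have "A \<inter> B = {\<one>} \<or> A \<inter> B = A" "A \<inter> B = {\<one>} \<or> A \<inter> B = B"
    using min_nrm_TT[OF assms(1)] min_nrm_TT[OF assms(2)] by (auto simp: min_nrm_def)
  then show ?thesis using assms by blast
qed

text \<open>The commutator \<open>x y x^-1 y^-1\<close> lies in both factors, which meet
  trivially.\<close>

lemma TT_commute:
  assumes "A \<in> \<T>" "B \<in> \<T>" "A \<noteq> B" "x \<in> A" "y \<in> B"
  shows "x \<otimes> y = y \<otimes> x"
proof -
  have G: "x \<in> carrier G" "y \<in> carrier G" using assms TTG by auto
  let ?c = "cj x y \<otimes> inv y"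
  have "?c \<in> B" using assms TTN cj_N_TT TT_mult TT_inv by auto
  moreover have "?c = x \<otimes> cj y (inv x)" using G by (simp add: cj_def m_assoc)
  then have "?c \<in> A" using assms TTN cj_N_TT TT_mult TT_inv by auto
  ultimately have "?c = \<one>" using TT_int assms by blast
  then have "cj x y = y" using G by (metis cj_closed inv_closed inv_equality inv_inv)
  then show ?thesis using cj_eq_self_iff G by blast
qed

text \<open>The conjugates of T generate a G-invariant subgroup of N, which is N by minimality. In
  this form it serves as an induction principle over N.\<close>

lemma N_subset:
  assumes "subgroup H G" "\<And>A x. A \<in> \<T> \<Longrightarrow> x \<in> A \<Longrightarrow> x \<in> H"
  shows "N \<subseteq> H"
proof -
  let ?M = "generate G (\<Union>\<T>)"
  have UG: "\<Union>\<T> \<subseteq> carrier G" using TTG by blast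
  have sM: "subgroup ?M G" using UG by (rule generate_is_subgroup)
  have cj: "cj g x \<in> ?M" if g: "g \<in> carrier G" and x: "x \<in> ?M" for g x
    using x
  proof (induction rule: generate.induct)
    case one
    then show ?case using g generate.one by simp
  next
    case (incl h)
    then show ?case using g TT_cj generate.incl by (metis (no_types, lifting) UnionE UnionI imageI)
  next
    case (inv h)
    then have "inv (cj g h) \<in> ?M" using g TT_cj generate.inv by (metis (no_types, lifting) UnionE UnionI imageI)
    then show ?case using inv g UG cj_inv by auto
  next
    case (eng h1 h2)
    have "h1 \<in> carrier G" "h2 \<in> carrier G" using eng generate_in_carrier[OF UG] by auto
    then show ?case using eng g cj_mult generate.eng by metis
  qed
  have "?M \<subseteq> N"
    using mono_generate TTN generate_subgroup_incl[OF _ subN] by blast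
  moreover have "nrm (carrier G) ?M" using sM cj by (simp add: nrm_def)
  moreover have "?M \<noteq> {\<one>}"
  proof
    assume "?M = {\<one>}"
    then have "T \<subseteq> {\<one>}" using T_in generate.incl by (metis UnionI subsetI)
    then have "T = {\<one>}" using subgroup.one_closed[OF subT] by auto
    then show False using minT by (simp add: min_nrm_def)
  qed
  ultimately have "?M = N" using minN unfolding min_nrm_def by metis
  moreover have "?M \<subseteq> H" using generate_subgroup_incl[OF _ assms(1)] assms(2) by blast
  ultimately show ?thesis by simp
qed

lemma subgroup_centralizer:
  assumes "S \<subseteq> carrier G"
  shows "subgroup {g \<in> carrier G. \<forall>x\<in>S. g \<otimes> x = x \<otimes> g} G"
proof (rule subgroupI)
  show "{g \<in> carrier G. \<forall>x\<in>S. g \<otimes> x = x \<otimes> g} \<noteq> {}" using assms by (auto intro!: exI[of _ \<one>])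
qed (use assms in \<open>auto simp: commute_inv commute_mult subset_iff\<close>)

text \<open>The elements of N commuting with all factors form a G-invariant subgroup, so it is
  trivial or N; if it were N, every factor would be central in N, and N, being generated by them,
  abelian.\<close>

lemma centralizer_TT_trivial:
  assumes n: "n \<in> N" "\<And>A x. A \<in> \<T> \<Longrightarrow> x \<in> A \<Longrightarrow> n \<otimes> x = x \<otimes> n"
  shows "n = \<one>"
proof -
  let ?Z = "{n \<in> N. \<forall>x\<in>\<Union>\<T>. n \<otimes> x = x \<otimes> n}"
  have "subgroup ({g \<in> carrier G. \<forall>x\<in>\<Union>\<T>. g \<otimes> x = x \<otimes> g} \<inter> N) G"
    using TTG by (intro subgroups_Inter_pair subgroup_centralizer subN) auto
  moreover have "{g \<in> carrier G. \<forall>x\<in>\<Union>\<T>. g \<otimes> x = x \<otimes> g} \<inter> N = ?Z" using NG by auto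
  ultimately have "subgroup ?Z G" by simp
  moreover have "cj g z \<in> ?Z" if g: "g \<in> carrier G" and z: "z \<in> ?Z" for g z
  proof -
    have "cj g z \<otimes> x = x \<otimes> cj g z" if x: "x \<in> A" "A \<in> \<T>" for x A
    proof -
      have xG: "x \<in> carrier G" using x TTG by blast
      have "cj (inv g) x \<in> cj (inv g) ` A" "cj (inv g) ` A \<in> \<T>" using x TT_cj g by auto
      then have "z \<otimes> cj (inv g) x = cj (inv g) x \<otimes> z" using z by blast
      then have "cj g z \<otimes> cj g (cj (inv g) x) = cj g (cj (inv g) x) \<otimes> cj g z"
        using commute_cj[of g z "cj (inv g) x"] g z NG xG by (simp del: cj_inv_cancel2)
      then show ?thesis using g xG by simp
    qed
    then show ?thesis using cjN g z by auto
  qed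
  ultimately have "nrm (carrier G) ?Z" by (simp add: nrm_def)
  then have "?Z = {\<one>} \<or> ?Z = N" using minN unfolding min_nrm_def by (metis (no_types, lifting) mem_Collect_eq subsetI)
  moreover have "?Z \<noteq> N"
  proof
    assume Z: "?Z = N"
    have "N \<subseteq> {g \<in> carrier G. \<forall>x\<in>N. g \<otimes> x = x \<otimes> g}"
    proof (rule N_subset)
      show "subgroup {g \<in> carrier G. \<forall>x\<in>N. g \<otimes> x = x \<otimes> g} G" using NG by (intro subgroup_centralizer) auto
      fix A y assume y: "A \<in> \<T>" "y \<in> A"
      have "y \<otimes> x = x \<otimes> y" if "x \<in> N" for x
      proof -
        have "x \<in> ?Z" using Z that by blast
        then have "\<forall>z\<in>\<Union>\<T>. x \<otimes> z = z \<otimes> x" by simp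
        moreover have "y \<in> \<Union>\<T>" using y by (rule UnionI)
        ultimately have "x \<otimes> y = y \<otimes> x" by (rule bspec)
        then show ?thesis by (rule sym)
      qed
      then show "y \<in> {g \<in> carrier G. \<forall>x\<in>N. g \<otimes> x = x \<otimes> g}" using y TTG by blast
    qed
    then have "x \<in> {g \<in> carrier G. \<forall>x\<in>N. g \<otimes> x = x \<otimes> g}" if "x \<in> N" for x
      using that by (rule subsetD)
    then have "x \<otimes> y = y \<otimes> x" if "x \<in> N" "y \<in> N" for x y using that by simp
    then show False using nonab by metis
  qed
  moreover have "n \<in> ?Z" using n by blast
  ultimately show ?thesis by blast
qed

lemma TT_center:
  assumes "A \<in> \<T>" "x \<in> A" "\<And>y. y \<in> A \<Longrightarrow> x \<otimes> y = y \<otimes> x"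
  shows "x = \<one>"
proof (rule centralizer_TT_trivial)
  show "x \<in> N" using assms TTN by blast
  show "x \<otimes> y = y \<otimes> x" if "B \<in> \<T>" "y \<in> B" for B y
    using assms TT_commute that by (cases "A = B") blast+
qed

text \<open>A group in which all squares are trivial is abelian, whereas the center of T is
  trivial.\<close>

lemma ex_nonelementary: "\<exists>x\<in>T. x \<otimes> x \<noteq> \<one>"
proof (rule ccontr)
  assume "\<not> ?thesis"
  then have i: "inv t = t" if "t \<in> T" for t using that TTG[OF T_in] by (metis inv_equality)
  have "x \<otimes> y = y \<otimes> x" if xy: "x \<in> T" "y \<in> T" for x y
  proof -
    have "inv (x \<otimes> y) = inv y \<otimes> inv x" using xy TTG[OF T_in] by (simp add: inv_mult_group)
    then show ?thesis using i xy TT_mult[OF T_in] by simp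
  qed
  then have "x = \<one>" if "x \<in> T" for x using TT_center[OF T_in that] that by blast
  then have "T \<subseteq> {\<one>}" by (metis singletonI subsetI)
  then have "T = {\<one>}" using TT_one[OF T_in] by auto
  then show False using minT by (simp add: min_nrm_def)
qed

text \<open>The products of an element of A and an element centralizing A form a subgroup containing
  every factor, hence N. Uniqueness is the triviality of the center of A.\<close>

lemma ex_component:
  assumes A: "A \<in> \<T>" and n: "n \<in> N"
  shows "\<exists>!t. t \<in> A \<and> (\<forall>x\<in>A. (inv t \<otimes> n) \<otimes> x = x \<otimes> (inv t \<otimes> n))"
proof -
  let ?C = "{g \<in> carrier G. \<forall>x\<in>A. g \<otimes> x = x \<otimes> g}"
  let ?H = "{t \<otimes> c | t c. t \<in> A \<and> c \<in> ?C}"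
  have sC: "subgroup ?C G" using TTG[OF A] by (intro subgroup_centralizer) auto
  have CG: "c \<in> carrier G" if "c \<in> ?C" for c using that by simp
  have com: "c \<otimes> t = t \<otimes> c" if "t \<in> A" "c \<in> ?C" for t c using that by simp
  have "subgroup ?H G"
  proof (rule subgroupI)
    show "?H \<subseteq> carrier G" using TTG[OF A] by auto
    show "?H \<noteq> {}" using TT_one[OF A] subgroup.one_closed[OF sC] by blast
    fix a assume "a \<in> ?H"
    then obtain t c where tc: "a = t \<otimes> c" "t \<in> A" "c \<in> ?C" by blast
    have ic: "inv c \<in> ?C" using subgroup.m_inv_closed[OF sC tc(3)] .
    have it: "inv t \<in> A" using TT_inv[OF A tc(2)] .
    have "inv a = inv c \<otimes> inv t" unfolding tc(1) using TTG[OF A tc(2)] CG[OF tc(3)] by (rule inv_mult_group)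
    also have "\<dots> = inv t \<otimes> inv c" using com[OF it ic] .
    finally show "inv a \<in> ?H" using it ic by blast
    fix b assume "b \<in> ?H"
    then obtain u d where ud: "b = u \<otimes> d" "u \<in> A" "d \<in> ?C" by blast
    have G: "t \<in> carrier G" "u \<in> carrier G" "c \<in> carrier G" "d \<in> carrier G"
      using TTG[OF A tc(2)] TTG[OF A ud(2)] CG[OF tc(3)] CG[OF ud(3)] by simp_all
    have "a \<otimes> b = t \<otimes> (c \<otimes> u) \<otimes> d" unfolding tc(1) ud(1) using G by (simp add: m_assoc)
    also have "\<dots> = (t \<otimes> u) \<otimes> (c \<otimes> d)" unfolding com[OF ud(2) tc(3)] using G by (simp add: m_assoc)
    finally show "a \<otimes> b \<in> ?H" using TT_mult[OF A tc(2) ud(2)] subgroup.m_closed[OF sC tc(3) ud(3)] by blast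
  qed
  moreover have "x \<in> ?H" if B: "B \<in> \<T>" "x \<in> B" for B x
  proof (cases "A = B")
    case True
    have "x = x \<otimes> \<one>" using TTG B by simp
    then show ?thesis using True B subgroup.one_closed[OF sC] by blast
  next
    case False
    have "x = \<one> \<otimes> x" using TTG B by simp
    moreover have "x \<in> ?C" using TT_commute[OF B(1) A _ B(2)] False B TTG by auto
    ultimately show ?thesis using TT_one[OF A] by blast
  qed
  ultimately have "N \<subseteq> ?H" by (rule N_subset)
  then have "n \<in> ?H" using n by (rule subsetD)
  then obtain t c where tc: "n = t \<otimes> c" "t \<in> A" "c \<in> ?C" by blast
  have "inv t \<otimes> n = c" using tc TTG[OF A] by (simp add: m_assoc[symmetric])
  then have ex: "t \<in> A \<and> (\<forall>x\<in>A. (inv t \<otimes> n) \<otimes> x = x \<otimes> (inv t \<otimes> n))" using tc by simp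
  show ?thesis
  proof (rule ex1I, rule ex)
    fix u assume u: "u \<in> A \<and> (\<forall>x\<in>A. (inv u \<otimes> n) \<otimes> x = x \<otimes> (inv u \<otimes> n))"
    have G: "t \<in> carrier G" "u \<in> carrier G" "n \<in> carrier G" using tc u TTG[OF A] n NG by auto
    have uC: "inv u \<otimes> n \<in> ?C" and tC: "inv t \<otimes> n \<in> ?C" using u ex G by auto
    have "(inv u \<otimes> n) \<otimes> inv (inv t \<otimes> n) \<in> ?C"
      using subgroup.m_closed[OF sC uC subgroup.m_inv_closed[OF sC tC]] .
    moreover have "(inv u \<otimes> n) \<otimes> inv (inv t \<otimes> n) = inv u \<otimes> t" using G by (simp add: inv_mult_group m_assoc) (simp add: m_assoc[symmetric])
    ultimately have "inv u \<otimes> t \<in> ?C" by simp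
    moreover have "inv u \<otimes> t \<in> A" using u tc TT_inv[OF A] TT_mult[OF A] by simp
    ultimately have "inv u \<otimes> t = \<one>" using TT_center[OF A] by simp
    then show "u = t" using G by (metis inv_closed inv_equality inv_inv)
  qed
qed

text \<open>\<open>pr A n\<close> is the component of \<open>n \<in> N\<close> in the simple factor \<open>A\<close>: the element of \<open>A\<close> inducing the
  same automorphism of \<open>A\<close> as \<open>n\<close>. It is meaningful only for \<open>A \<in> \<T>\<close> and \<open>n \<in> N\<close>.\<close>

definition pr where
  "pr A n = (THE t. t \<in> A \<and> (\<forall>x\<in>A. (inv t \<otimes> n) \<otimes> x = x \<otimes> (inv t \<otimes> n)))"

lemma pr_props:
  assumes "A \<in> \<T>" "n \<in> N"
  shows pr_in: "pr A n \<in> A"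
    and pr_commute: "\<And>x. x \<in> A \<Longrightarrow> (inv (pr A n) \<otimes> n) \<otimes> x = x \<otimes> (inv (pr A n) \<otimes> n)"
  using theI'[OF ex_component[OF assms]] unfolding pr_def by auto

lemma pr_eqI:
  assumes "A \<in> \<T>" "n \<in> N" "t \<in> A" "\<And>x. x \<in> A \<Longrightarrow> cj n x = cj t x"
  shows "pr A n = t"
proof -
  have G: "t \<in> carrier G" "n \<in> carrier G" using assms TTG NG by auto
  have "(inv t \<otimes> n) \<otimes> x = x \<otimes> (inv t \<otimes> n)" if x: "x \<in> A" for x
  proof -
    have xG: "x \<in> carrier G" using x assms TTG by blast
    have "cj (inv t \<otimes> n) x = cj (inv t) (cj n x)" using G xG by (simp add: cj_cj)
    also have "\<dots> = x" using assms(4)[OF x] G xG by simp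
    finally show ?thesis using cj_eq_self_iff G xG by simp
  qed
  then show ?thesis unfolding pr_def using ex_component[OF assms(1,2)] assms(3)
    by (intro the1_equality) auto
qed

lemma pr_cj:
  assumes "A \<in> \<T>" "n \<in> N" "x \<in> A"
  shows "cj n x = cj (pr A n) x"
proof -
  have G: "pr A n \<in> carrier G" "n \<in> carrier G" "x \<in> carrier G" using assms TTG NG pr_in by auto
  have "cj (inv (pr A n) \<otimes> n) x = x" using pr_commute[OF assms] cj_eq_self_iff G by simp
  then have "cj (inv (pr A n)) (cj n x) = x" using G by (simp add: cj_cj)
  then show ?thesis using G by (metis cj_closed cj_inv_cancel2)
qed

lemma pr_mult:
  assumes "A \<in> \<T>" "m \<in> N" "n \<in> N"
  shows "pr A (m \<otimes> n) = pr A m \<otimes> pr A n"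
proof (rule pr_eqI)
  have G: "pr A n \<in> carrier G" "n \<in> carrier G" "pr A m \<in> carrier G" "m \<in> carrier G"
    using assms TTG NG pr_in by auto
  fix x assume x: "x \<in> A"
  have xG: "x \<in> carrier G" using x assms TTG by blast
  have "cj (m \<otimes> n) x = cj m (cj n x)" using G xG by (simp add: cj_cj)
  also have "\<dots> = cj (pr A m) (cj (pr A n) x)"
    using pr_cj assms x cj_N_TT by metis
  finally show "cj (m \<otimes> n) x = cj (pr A m \<otimes> pr A n) x" using G xG by (simp add: cj_cj)
qed (use assms N_mult TT_mult pr_in in auto)

lemma pr_self: "A \<in> \<T> \<Longrightarrow> t \<in> A \<Longrightarrow> pr A t = t"
  by (rule pr_eqI) (use TTN in auto)

lemma pr_one: "A \<in> \<T> \<Longrightarrow> pr A \<one> = \<one>"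
  by (rule pr_self) (use TT_one in auto)

lemma pr_inv:
  assumes "A \<in> \<T>" "n \<in> N"
  shows "pr A (inv n) = inv (pr A n)"
proof -
  have "pr A (inv n) \<otimes> pr A n = \<one>" using assms pr_mult[OF assms(1) N_inv[OF assms(2)] assms(2)] NG pr_one by simp
  then show ?thesis using assms pr_in N_inv TTG by (metis inv_equality)
qed

lemma pr_other: "A \<in> \<T> \<Longrightarrow> B \<in> \<T> \<Longrightarrow> A \<noteq> B \<Longrightarrow> t \<in> B \<Longrightarrow> pr A t = \<one>"
  by (rule pr_eqI) (use TTN TT_one TT_commute TTG cj_eq_self_iff in auto)

lemma pr_equivariant:
  assumes A: "A \<in> \<T>" and g: "g \<in> carrier G" and n: "n \<in> N"
  shows "pr (cj g ` A) (cj g n) = cj g (pr A n)"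
proof (rule pr_eqI)
  show "cj g ` A \<in> \<T>" using TT_cj A g .
  show "cj g n \<in> N" using cjN g n .
  show "cj g (pr A n) \<in> cj g ` A" using pr_in[OF A n] by (rule imageI)
  fix y assume "y \<in> cj g ` A"
  then obtain x where x: "x \<in> A" "y = cj g x" by (rule imageE)
  have G: "x \<in> carrier G" "n \<in> carrier G" "pr A n \<in> carrier G" using x A n TTG NG pr_in by auto
  have *: "cj (cj g h) (cj g x) = cj g (cj h x)" if "h \<in> carrier G" for h
    using that G g by (simp add: cj_cj cj_mult_left)
  show "cj (cj g n) y = cj (cj g (pr A n)) y"
    unfolding x(2) using * G pr_cj[OF A n x(1)] by simp
qed

lemma eq_if_pr_eq:
  assumes "m \<in> N" "n \<in> N" "\<And>A. A \<in> \<T> \<Longrightarrow> pr A m = pr A n"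
  shows "m = n"
proof -
  have G: "m \<in> carrier G" "n \<in> carrier G" using assms NG by auto
  have "inv m \<otimes> n = \<one>"
  proof (rule centralizer_TT_trivial)
    show N: "inv m \<otimes> n \<in> N" using assms N_inv N_mult by simp
    fix A x assume A: "A \<in> \<T>" "x \<in> A"
    have "pr A (inv m \<otimes> n) = \<one>"
      using assms A pr_mult pr_inv N_inv TTG pr_in by simp
    then have "cj (inv m \<otimes> n) x = x" using pr_cj[OF A(1) N A(2)] TTG A by simp
    then show "inv m \<otimes> n \<otimes> x = x \<otimes> (inv m \<otimes> n)" using cj_eq_self_iff G TTG A by simp
  qed
  then show ?thesis using G by (metis inv_closed inv_equality inv_inv)
qed

text \<open>N acts on A by conjugation only through components in A, so a subgroup normalized by A
  is normalized by N, and minimality applies.\<close>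

lemma TT_simple:
  assumes A: "A \<in> \<T>" and M: "nrm A M" "M \<subseteq> A"
  shows "M = {\<one>} \<or> M = A"
proof -
  have "nrm N M" unfolding nrm_def
    using M nrm_subgroup nrm_cj pr_cj[OF A] pr_in[OF A] by (metis subsetD)
  then show ?thesis using min_nrm_TT[OF A] M by (simp add: min_nrm_def)
qed

definition "ca = card T"

lemma card_TT: "A \<in> \<T> \<Longrightarrow> card A = ca"
proof -
  assume "A \<in> \<T>"
  then obtain g where g: "g \<in> carrier G" "A = cj g ` T" by (auto simp: \<T>_def)
  have "t \<in> carrier G" if "t \<in> T" for t using that TN NG by blast
  then have "inj_on (cj g) T" using g(1) by (intro inj_onI) simp
  then show ?thesis using g(2) by (simp add: card_image ca_def)
qed

lemma finN: "finite N" using subN finG by (metis finite_subset subgroup.subset)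

lemma card_pr:
  assumes A: "A \<in> \<T>" and K: "subgroup K G" "K \<subseteq> N"
  shows "card K = card (pr A ` K) * card {n \<in> K. pr A n = \<one>}"
proof (rule card_subgroup_fibres[OF finG K(1)])
  fix x y assume xy: "x \<in> K" "y \<in> K"
  then have N: "x \<in> N" "y \<in> N" using K by auto
  have G: "pr A x \<in> carrier G" "pr A y \<in> carrier G" using pr_in A N TTG by auto
  have iK: "inv x \<otimes> y \<in> K" using K xy by (simp add: subgroup.m_closed subgroup.m_inv_closed)
  have "pr A (inv x \<otimes> y) = inv (pr A x) \<otimes> pr A y" using pr_mult pr_inv A N N_inv by simp
  moreover have "inv (pr A x) \<otimes> pr A y = \<one> \<longleftrightarrow> pr A x = pr A y"
    using G by (metis inv_closed inv_equality inv_inv l_inv)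
  ultimately show "pr A x = pr A y \<longleftrightarrow> inv x \<otimes> y \<in> {n \<in> K. pr A n = \<one>}" using iK by simp
qed auto

lemma pr_image_subgroup:
  assumes A: "A \<in> \<T>" and K: "subgroup K G" "K \<subseteq> N"
  shows "subgroup (pr A ` K) G"
proof (rule subgroupI)
  have KN: "n \<in> N" if "n \<in> K" for n using that K by blast
  show "pr A ` K \<subseteq> carrier G" using pr_in[OF A] TTG[OF A] KN by auto
  show "pr A ` K \<noteq> {}" using subgroup.one_closed[OF K(1)] by auto
  fix a assume "a \<in> pr A ` K"
  then obtain x where x: "x \<in> K" "a = pr A x" by (rule imageE)
  have "inv a = pr A (inv x)" using x pr_inv[OF A] KN by simp
  then show "inv a \<in> pr A ` K" using subgroup.m_inv_closed[OF K(1) x(1)] by (simp only: imageI)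
  fix b assume "b \<in> pr A ` K"
  then obtain y where y: "y \<in> K" "b = pr A y" by (rule imageE)
  have "a \<otimes> b = pr A (x \<otimes> y)" using x y pr_mult[OF A] KN by simp
  then show "a \<otimes> b \<in> pr A ` K" using subgroup.m_closed[OF K(1) x(1) y(1)] by (simp only: imageI)
qed

text \<open>For a set S of factors this is the product of the factors outside S, described by
  vanishing components so that no explicit product is needed.\<close>

definition Cs where "Cs S = {n \<in> N. \<forall>A\<in>S. pr A n = \<one>}"

lemma Cs_subgroup:
  assumes "S \<subseteq> \<T>"
  shows "subgroup (Cs S) G"
proof (rule subgroupI)
  show "Cs S \<subseteq> carrier G" using NG by (auto simp: Cs_def)
  show "Cs S \<noteq> {}" using N_one pr_one assms by (auto simp: Cs_def)
qed (use assms N_inv N_mult pr_inv pr_mult in \<open>auto simp: Cs_def subset_iff\<close>)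

lemma Cs_all: "Cs \<T> = {\<one>}"
  using eq_if_pr_eq[of _ \<one>] pr_one N_one by (auto simp: Cs_def)

text \<open>Each further component required to vanish divides the order by |T|, until only the
  identity remains.\<close>

lemma card_N: "card N = ca ^ card \<T>"
proof -
  have "card (Cs S) = ca ^ card (\<T> - S)" if "S \<subseteq> \<T>" for S
    using that
  proof (induction "card (\<T> - S)" arbitrary: S)
    case 0
    then have "S = \<T>" using fin\<T> by (metis Diff_eq_empty_iff card_0_eq finite_Diff subset_antisym)
    then show ?case using Cs_all by simp
  next
    case (Suc j)
    then obtain A where A: "A \<in> \<T>" "A \<notin> S" by (metis Diff_eq_empty_iff card.empty nat.simps(3) subsetI)
    have "\<T> - insert A S = (\<T> - S) - {A}" by blast
    then have j: "card (\<T> - insert A S) = j" using Suc.hyps(2) A fin\<T> by simp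
    have "card (Cs S) = card (pr A ` Cs S) * card {n \<in> Cs S. pr A n = \<one>}"
      using A Suc.prems by (intro card_pr Cs_subgroup) (auto simp: Cs_def)
    also have "pr A ` Cs S = A"
    proof (intro equalityI subsetI)
      show "x \<in> A" if "x \<in> pr A ` Cs S" for x using that pr_in A by (auto simp: Cs_def)
      show "x \<in> pr A ` Cs S" if x: "x \<in> A" for x
      proof (rule rev_image_eqI)
        have "pr B x = \<one>" if "B \<in> S" for B using pr_other[of B A x] A Suc.prems x that by auto
        then show "x \<in> Cs S" using x A TTN by (auto simp: Cs_def)
      qed (use pr_self A x in simp)
    qed
    also have "{n \<in> Cs S. pr A n = \<one>} = Cs (insert A S)" by (auto simp: Cs_def)
    also have "card (Cs (insert A S)) = ca ^ j" using Suc.hyps(1)[of "insert A S"] j A Suc.prems by simp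
    finally show ?case using Suc.hyps(2) card_TT A by (metis power_Suc)
  qed
  from this[of "{}"] show ?thesis by (simp add: Cs_def)
qed

end

section \<open>Primitive groups\<close>

lemma sign_fixed_point_free_involution:
  assumes "finite S" "p permutes S" "\<And>x. p (p x) = x" "\<And>x. x \<in> S \<Longrightarrow> p x \<noteq> x" "card S = 2 * j"
  shows "sign p = (-1) ^ j"
  using assms
proof (induction j arbitrary: S p)
  case 0
  then have "S = {}" by simp
  then have "p = id" using 0 by (simp add: permutes_empty)
  then show ?case by simp
next
  case (Suc j)
  then obtain a where a: "a \<in> S" by (metis card.empty ex_in_conv mult_eq_0_iff nat.simps(3) zero_neq_numeral)
  define b where "b = p a"
  have b: "b \<in> S" "b \<noteq> a" "p b = a" using Suc.prems a by (auto simp: b_def permutes_in_image)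
  \<comment> \<open>Splitting off the transposition of a and p a leaves a fixed-point-free
    involution of the other \<open>2 * j\<close> points.\<close>
  define q where "q = transpose a b \<circ> p"
  have qa: "q a = a" "q b = b" using b by (auto simp: q_def b_def[symmetric])
  have qx: "q x = p x" if "x \<noteq> a" "x \<noteq> b" for x
  proof -
    have "p (p x) \<noteq> p b" "p (p x) \<noteq> p a" using that b(3) b_def Suc.prems(3)[of x] by simp_all
    then have "p x \<noteq> b" "p x \<noteq> a" by auto
    then show ?thesis by (simp add: q_def)
  qed
  have "q permutes S" unfolding q_def
    by (rule permutes_compose[OF Suc.prems(2) permutes_swap_id[OF a b(1)]])
  then have qS: "q permutes S - {a, b}"
  proof (rule permutes_superset)
    show "q x = x" if "x \<in> S - (S - {a, b})" for x using that qa by blast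
  qed
  have "q (q x) = x" for x
  proof (cases "x = a \<or> x = b")
    case False
    then have "p (p x) \<noteq> p b" "p (p x) \<noteq> p a" using b(3) b_def Suc.prems(3)[of x] by simp_all
    then have "p x \<noteq> b" "p x \<noteq> a" by auto
    then show ?thesis using False qx Suc.prems(3) by simp
  qed (use qa in auto)
  moreover have "q x \<noteq> x" if "x \<in> S - {a, b}" for x using that qx Suc.prems(4) by auto
  moreover have "card (S - {a, b}) = 2 * j" using Suc.prems(1,5) a b by (simp add: card_Diff_subset)
  ultimately have "sign q = (-1) ^ j" using Suc.IH[OF _ qS] Suc.prems(1) by simp
  moreover have "p = transpose a b \<circ> q" by (simp add: q_def comp_assoc[symmetric])
  moreover have "permutation q" using qS Suc.prems(1) permutation_permutes by blast
  ultimately have "sign p = sign (transpose a b) * (-1) ^ j"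
    using sign_compose[OF permutation_swap_id, of q a b] by simp
  then show ?case using b(2) by (simp add: sign_swap_id)
qed

section \<open>Faithful and primitive actions of a finite group\<close>

locale perm_action = group G for G (structure) +
  fixes P :: "'p set" and act :: "_ \<Rightarrow> 'p \<Rightarrow> 'p"
  assumes finite_G: "finite (carrier G)" and finite_P: "finite P"
    and act_in: "g \<in> carrier G \<Longrightarrow> x \<in> P \<Longrightarrow> act g x \<in> P"
    and act_mult: "g \<in> carrier G \<Longrightarrow> h \<in> carrier G \<Longrightarrow> x \<in> P \<Longrightarrow> act (g \<otimes> h) x = act g (act h x)"
    and act_one: "x \<in> P \<Longrightarrow> act \<one> x = x"
    and faithful: "g \<in> carrier G \<Longrightarrow> (\<And>x. x \<in> P \<Longrightarrow> act g x = x) \<Longrightarrow> g = \<one>"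
begin

definition stab where "stab x = {g \<in> carrier G. act g x = x}"

lemma act_inv1 [simp]: "g \<in> carrier G \<Longrightarrow> x \<in> P \<Longrightarrow> act (inv g) (act g x) = x"
  by (metis act_mult act_one inv_closed l_inv)

lemma act_inv2 [simp]: "g \<in> carrier G \<Longrightarrow> x \<in> P \<Longrightarrow> act g (act (inv g) x) = x"
  by (metis act_mult act_one inv_closed r_inv)

lemma act_inj: "g \<in> carrier G \<Longrightarrow> inj_on (act g) P"
  by (metis act_inv1 inj_onI)

lemma act_eq_iff: "g \<in> carrier G \<Longrightarrow> x \<in> P \<Longrightarrow> y \<in> P \<Longrightarrow> act g x = act g y \<longleftrightarrow> x = y"
  by (metis act_inv1)

lemma act_bij: "g \<in> carrier G \<Longrightarrow> bij_betw (act g) P P"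
  by (metis act_in act_inj bij_betw_def endo_inj_surj finite_P image_subsetI)

lemma act_inv_eq_iff: "g \<in> carrier G \<Longrightarrow> x \<in> P \<Longrightarrow> y \<in> P \<Longrightarrow> act (inv g) x = y \<longleftrightarrow> x = act g y"
  by (metis act_inv1 act_inv2)

lemma act_eq_act_iff:
  "g \<in> carrier G \<Longrightarrow> h \<in> carrier G \<Longrightarrow> x \<in> P \<Longrightarrow> act g x = act h x \<longleftrightarrow> act (inv g \<otimes> h) x = x"
  by (simp add: act_mult act_inv_eq_iff act_in) (metis)

lemma act_cj: "g \<in> carrier G \<Longrightarrow> n \<in> carrier G \<Longrightarrow> x \<in> P \<Longrightarrow> act (cj g n) (act g x) = act g (act n x)"
  by (simp add: cj_mult_left flip: act_mult)

lemma act_cj_fix: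
  "g \<in> carrier G \<Longrightarrow> n \<in> carrier G \<Longrightarrow> x \<in> P \<Longrightarrow> act g x = x \<Longrightarrow> act (cj g n) x = act g (act n x)"
  using act_cj by metis

lemma stab_subgroup: "x \<in> P \<Longrightarrow> subgroup (stab x) G"
proof (rule subgroupI)
  assume x: "x \<in> P"
  show "stab x \<subseteq> carrier G" by (auto simp: stab_def)
  show "stab x \<noteq> {}" using x act_one by (auto simp: stab_def)
  show "inv a \<in> stab x" if "a \<in> stab x" for a using that x act_inv1 unfolding stab_def by (metis (mono_tags, lifting) inv_closed mem_Collect_eq)
  show "a \<otimes> b \<in> stab x" if "a \<in> stab x" "b \<in> stab x" for a b using that x by (simp add: stab_def act_mult)
qed

lemma orbit_stabilizer:
  assumes K: "subgroup K G" and x: "x \<in> P"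
  shows "card K = card ((\<lambda>g. act g x) ` K) * card {g \<in> K. act g x = x}"
proof (rule card_subgroup_fibres[OF finite_G K])
  fix g h assume gh: "g \<in> K" "h \<in> K"
  then have "inv g \<otimes> h \<in> K" using K by (simp add: subgroup.m_closed subgroup.m_inv_closed)
  moreover have "g \<in> carrier G" "h \<in> carrier G" using gh subgroup.mem_carrier[OF K] by auto
  ultimately show "act g x = act h x \<longleftrightarrow> inv g \<otimes> h \<in> {g \<in> K. act g x = x}"
    using act_eq_act_iff x by simp
qed auto

text \<open>Extended by the identity outside P, as \<open>permutes\<close> and \<open>sign\<close>
  require.\<close>

definition perm where "perm g = (\<lambda>x. if x \<in> P then act g x else x)"

lemma perm_permutes: "g \<in> carrier G \<Longrightarrow> perm g permutes P"
  using act_bij by (intro bij_imp_permutes) (auto simp: perm_def cong: bij_betw_cong)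

lemma permutation_perm: "g \<in> carrier G \<Longrightarrow> permutation (perm g)"
  using perm_permutes finite_P permutation_permutes by metis

lemma perm_mult: "g \<in> carrier G \<Longrightarrow> h \<in> carrier G \<Longrightarrow> perm (g \<otimes> h) = perm g \<circ> perm h"
  by (auto simp: perm_def act_mult act_in fun_eq_iff)

lemma sign_perm_mult: "g \<in> carrier G \<Longrightarrow> h \<in> carrier G \<Longrightarrow> sign (perm (g \<otimes> h)) = sign (perm g) * sign (perm h)"
  by (simp add: perm_mult sign_compose permutation_perm)

end

locale prim_action = perm_action +
  assumes trans: "x \<in> P \<Longrightarrow> y \<in> P \<Longrightarrow> \<exists>g\<in>carrier G. act g x = y"
    and prim: "D \<subseteq> P \<Longrightarrow> D \<noteq> {} \<Longrightarrow> (\<And>g. g \<in> carrier G \<Longrightarrow> act g ` D = D \<or> act g ` D \<inter> D = {})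
      \<Longrightarrow> card D = 1 \<or> D = P"
begin

text \<open>The K-orbit of x is a block of imprimitivity. In group terms: the product of K and the
  stabilizer is a subgroup above the stabilizer, which is maximal.\<close>

lemma stab_invariant_subgroup:
  assumes x: "x \<in> P" and K: "nrm (stab x) K"
  shows "(\<forall>n\<in>K. act n x = x) \<or> (\<forall>y\<in>P. \<exists>n\<in>K. act n x = y)"
proof -
  have sK: "subgroup K G" using K by (rule nrm_subgroup)
  have KG: "n \<in> carrier G" if "n \<in> K" for n using subgroup.mem_carrier[OF sK that] .
  let ?D = "(\<lambda>n. act n x) ` K"
  have DP: "?D \<subseteq> P" using KG act_in x by auto
  have xD: "x \<in> ?D" using subgroup.one_closed[OF sK] act_one[OF x] by force
  have blk: "act g ` ?D = ?D \<or> act g ` ?D \<inter> ?D = {}" if g: "g \<in> carrier G" for g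
  proof (rule disjCI)
    assume "act g ` ?D \<inter> ?D \<noteq> {}"
    then obtain n m where nm: "n \<in> K" "m \<in> K" "act g (act n x) = act m x" by auto
    \<comment> \<open>This h fixes x and normalizes K, so \<open>g l = m h (n^-1 l)\<close> becomes
      an element of K followed after h, and g maps the orbit into itself.\<close>
    define h where "h = inv m \<otimes> (g \<otimes> n)"
    have hG: "h \<in> carrier G" using g nm KG by (simp add: h_def)
    have "act h x = x" unfolding h_def using nm g KG x by (simp add: act_mult act_in)
    then have h: "h \<in> stab x" using hG by (simp add: stab_def)
    have "act g ` ?D \<subseteq> ?D"
    proof
      fix y assume "y \<in> act g ` ?D"
      then obtain l where l: "l \<in> K" "y = act g (act l x)" by auto
      define c where "c = cj h (inv n \<otimes> l)"
      have "inv n \<otimes> l \<in> K" using nm l sK by (simp add: subgroup.m_closed subgroup.m_inv_closed)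
      then have c: "c \<in> K" using nrm_cj[OF K h] by (simp add: c_def)
      have G: "l \<in> carrier G" "n \<in> carrier G" "m \<in> carrier G" "c \<in> carrier G" using nm l c KG by auto
      have "g \<otimes> l = m \<otimes> (h \<otimes> (inv n \<otimes> l))"
        unfolding h_def using G g by (simp add: m_assoc inv_solve_left) (simp add: m_assoc[symmetric])
      also have "h \<otimes> (inv n \<otimes> l) = c \<otimes> h" unfolding c_def using hG G by (simp add: cj_mult_left)
      finally have "y = act (m \<otimes> (c \<otimes> h)) x" using l(2) act_mult[of g l x] G g x by simp
      also have "\<dots> = act (m \<otimes> c) x" using \<open>act h x = x\<close> G hG x by (simp add: act_mult act_in)
      finally show "y \<in> ?D" using subgroup.m_closed[OF sK nm(2) c] by simp
    qed
    moreover have "card (act g ` ?D) = card ?D" using act_inj[OF g] DP by (meson card_image inj_on_subset)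
    moreover have "finite ?D" using DP finite_P finite_subset by blast
    ultimately show "act g ` ?D = ?D" using card_subset_eq by metis
  qed
  have "card ?D = 1 \<or> ?D = P" by (rule prim[OF DP _ blk]) (use xD in auto)
  then show ?thesis
  proof
    assume "card ?D = 1"
    then have "?D = {x}" using xD by (metis card_1_singletonE singletonD)
    then show ?thesis by auto
  next
    assume D: "?D = P"
    then have "\<exists>n\<in>K. act n x = y" if "y \<in> P" for y using that unfolding D[symmetric] by auto
    then show ?thesis by blast
  qed
qed

lemma normal_transitive:
  assumes N: "nrm (carrier G) N" "N \<noteq> {\<one>}" and x: "x \<in> P" "y \<in> P"
  shows "\<exists>n\<in>N. act n x = y"
proof -
  have sN: "subgroup N G" using N(1) by (rule nrm_subgroup)
  have NG: "n \<in> carrier G" if "n \<in> N" for n using subgroup.mem_carrier[OF sN that] .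
  have "nrm (stab x) N" using N(1) by (rule nrm_mono) (auto simp: stab_def)
  then consider "\<forall>n\<in>N. act n x = x" | "\<forall>y\<in>P. \<exists>n\<in>N. act n x = y"
    using stab_invariant_subgroup[OF x(1)] by blast
  then show ?thesis
  proof cases
    case 1
    have "n = \<one>" if n: "n \<in> N" for n
    proof (rule faithful[OF NG[OF n]])
      fix z assume "z \<in> P"
      then obtain g where g: "g \<in> carrier G" "act g x = z" using trans x(1) by blast
      have "cj (inv g) n \<in> N" using nrm_cj[OF N(1)] g n by simp
      then have "act (cj (inv g) n) x = x" using 1 by blast
      then have "act (cj g (cj (inv g) n)) (act g x) = act g x" using act_cj[of g "cj (inv g) n" x] g NG n x by simp
      then show "act n z = z" using g NG n by simp
    qed
    then have "N \<subseteq> {\<one>}" by (metis singletonI subsetI)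
    then have "N = {\<one>}" using subgroup.one_closed[OF sN] by auto
    then show ?thesis using N by simp
  next
    case 2
    then show ?thesis using x by blast
  qed
qed

text \<open>N is transitive, and c carries its fixed point x along:
  \<open>c (n x) = n (c x) = n x\<close>.\<close>

lemma centralizer_semiregular:
  assumes N: "nrm (carrier G) N" "N \<noteq> {\<one>}" and c: "c \<in> carrier G" "\<And>n. n \<in> N \<Longrightarrow> c \<otimes> n = n \<otimes> c"
    and x: "x \<in> P" "act c x = x"
  shows "c = \<one>"
proof (rule faithful[OF c(1)])
  fix y assume "y \<in> P"
  then obtain n where n: "n \<in> N" "act n x = y" using normal_transitive[OF N x(1)] by blast
  have nG: "n \<in> carrier G" using n N(1) by (meson nrm_subgroup subgroup.mem_carrier)
  have "act c y = act (c \<otimes> n) x" using act_mult[of c n x] n nG c(1) x by simp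
  also have "\<dots> = act (n \<otimes> c) x" using c(2) n by simp
  also have "\<dots> = y" using act_mult[of n c x] n nG c(1) x by simp
  finally show "act c y = y" .
qed

end

section \<open>The point stabilizer in a nonabelian minimal normal subgroup\<close>

locale prim_min = prim_action G P act + min_normal G N T
  for G (structure) and P :: "'p set" and act N T +
  fixes \<alpha> assumes \<alpha>: "\<alpha> \<in> P"
begin

lemma N_trans: "x \<in> P \<Longrightarrow> y \<in> P \<Longrightarrow> \<exists>n\<in>N. act n x = y"
  using normal_transitive minN by (simp add: min_nrm_def)

definition Na where "Na = {n \<in> N. act n \<alpha> = \<alpha>}"

lemma Na_subgroup: "subgroup Na G"
proof -
  have "subgroup (stab \<alpha> \<inter> N) G" by (intro subgroups_Inter_pair stab_subgroup \<alpha> subN)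
  moreover have "stab \<alpha> \<inter> N = Na" using NG by (auto simp: Na_def stab_def)
  ultimately show ?thesis by simp
qed

lemma card_N_orbit: "card N = card P * card Na"
proof -
  have "(\<lambda>g. act g \<alpha>) ` N = P" using N_trans[OF \<alpha>] act_in NG \<alpha> by force
  then show ?thesis using orbit_stabilizer[OF subN \<alpha>] by (simp add: Na_def)
qed

lemma cj_stab_Na: "g \<in> stab \<alpha> \<Longrightarrow> n \<in> Na \<Longrightarrow> cj g n \<in> Na"
  using cjN act_cj_fix NG \<alpha> by (simp add: Na_def stab_def)

text \<open>A is normal in the transitive group N, so a point fixed by all of A would make A act
  trivially.\<close>

lemma TT_moves:
  assumes A: "A \<in> \<T>" and x: "x \<in> P"
  shows "\<exists>a\<in>A. act a x \<noteq> x"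
proof (rule ccontr)
  assume "\<not> ?thesis"
  then have fx: "act a x = x" if "a \<in> A" for a using that by blast
  have "a = \<one>" if a: "a \<in> A" for a
  proof (rule faithful[OF TTG[OF A a]])
    fix y assume "y \<in> P"
    then obtain n where n: "n \<in> N" "act n x = y" using N_trans x by blast
    have "cj (inv n) a \<in> A" using cj_N_TT[OF A N_inv a] n by simp
    then have "act (cj (inv n) a) x = x" by (rule fx)
    then have "act (cj n (cj (inv n) a)) (act n x) = act n x" using act_cj[of n "cj (inv n) a" x] n NG TTG A a x by simp
    then show "act a y = y" using n NG TTG A a by simp
  qed
  then have "A \<subseteq> {\<one>}" by (metis singletonI subsetI)
  then have "A = {\<one>}" using TT_one[OF A] by auto
  then show False using min_nrm_TT[OF A] by (simp add: min_nrm_def)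
qed

text \<open>The product of the projections of \<open>N\<^sub>\<alpha>\<close> is normalized by
  \<open>G\<^sub>\<alpha>\<close>, which permutes the factors. By primitivity it fixes \<alpha> or
  is transitive on P. In the second case it is all of N, because it contains
  \<open>N\<^sub>\<alpha>\<close>, and every projection is onto.\<close>

lemma projection_dichotomy:
  "(\<forall>n\<in>N. (\<forall>A\<in>\<T>. pr A n \<in> pr A ` Na) \<longrightarrow> n \<in> Na) \<or> (\<forall>A\<in>\<T>. pr A ` Na = A)"
proof -
  let ?K = "{n \<in> N. \<forall>A\<in>\<T>. pr A n \<in> pr A ` Na}"
  have sR: "subgroup (pr A ` Na) G" if "A \<in> \<T>" for A
    by (rule pr_image_subgroup[OF that Na_subgroup]) (auto simp: Na_def)
  have "subgroup ?K G"
  proof (rule subgroupI)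
    show "?K \<subseteq> carrier G" using NG by auto
    have "\<one> \<in> ?K" using N_one pr_one subgroup.one_closed[OF sR] by simp
    then show "?K \<noteq> {}" by blast
    show "inv a \<in> ?K" if "a \<in> ?K" for a
      using that N_inv pr_inv subgroup.m_inv_closed[OF sR] by simp
    show "a \<otimes> b \<in> ?K" if "a \<in> ?K" "b \<in> ?K" for a b
      using that N_mult pr_mult subgroup.m_closed[OF sR] by simp
  qed
  moreover have "cj g n \<in> ?K" if g: "g \<in> stab \<alpha>" and n: "n \<in> ?K" for g n
  proof -
    have gG: "g \<in> carrier G" using g by (simp add: stab_def)
    have "pr B (cj g n) \<in> pr B ` Na" if B: "B \<in> \<T>" for B
    proof -
      let ?A = "cj (inv g) ` B"
      have A: "?A \<in> \<T>" using TT_cj[OF B] gG by simp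
      have BA: "B = cj g ` ?A"
        using TTG[OF B] gG by (force simp: image_image image_iff)
      have "pr ?A n \<in> pr ?A ` Na" using n A by blast
      then obtain m where m: "m \<in> Na" "pr ?A n = pr ?A m" by (rule imageE)
      have mN: "m \<in> N" using m by (simp add: Na_def)
      have "pr (cj g ` ?A) (cj g n) = pr (cj g ` ?A) (cj g m)"
        using pr_equivariant[OF A gG] n mN m(2) by simp
      then show ?thesis unfolding BA[symmetric] using cj_stab_Na[OF g m(1)] by (simp only: imageI)
    qed
    then show ?thesis using cjN gG n by simp
  qed
  ultimately have "nrm (stab \<alpha>) ?K" by (simp add: nrm_def)
  then consider "\<forall>n\<in>?K. act n \<alpha> = \<alpha>" | "\<forall>y\<in>P. \<exists>n\<in>?K. act n \<alpha> = y"
    using stab_invariant_subgroup[OF \<alpha>] by blast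
  then show ?thesis
  proof cases
    case 1
    have "n \<in> Na" if n: "n \<in> N" "\<forall>A\<in>\<T>. pr A n \<in> pr A ` Na" for n
    proof -
      have "n \<in> ?K" using n by simp
      then have "act n \<alpha> = \<alpha>" by (rule bspec[OF 1])
      then show ?thesis using n(1) by (simp add: Na_def)
    qed
    then show ?thesis by blast
  next
    case 2
    have NaK: "n \<in> ?K" if n: "n \<in> Na" for n
    proof -
      have "n \<in> N" using n by (simp add: Na_def)
      moreover have "\<forall>A\<in>\<T>. pr A n \<in> pr A ` Na" using n by simp
      ultimately show ?thesis by simp
    qed
    have NK: "n \<in> ?K" if n: "n \<in> N" for n
    proof -
      obtain m where m: "m \<in> ?K" "act m \<alpha> = act n \<alpha>" using bspec[OF 2 act_in[OF NG[OF n] \<alpha>]] by (rule bexE)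
      have mN: "m \<in> N" using m(1) by simp
      have "inv m \<otimes> n \<in> Na"
        using m(2) mN n act_eq_act_iff[of m n \<alpha>] NG \<alpha> N_mult N_inv by (simp add: Na_def)
      then have "m \<otimes> (inv m \<otimes> n) \<in> ?K" using NaK m(1) subgroup.m_closed[OF \<open>subgroup ?K G\<close>] by blast
      moreover have "m \<otimes> (inv m \<otimes> n) = n" using mN n NG by (simp add: m_assoc[symmetric])
      ultimately show ?thesis by simp
    qed
    have "pr A ` Na = A" if A: "A \<in> \<T>" for A
    proof (intro equalityI subsetI)
      show "x \<in> A" if "x \<in> pr A ` Na" for x using that pr_in[OF A] by (auto simp: Na_def)
      show "x \<in> pr A ` Na" if x: "x \<in> A" for x
      proof -
        have "x \<in> ?K" using NK TTN A x by blast
        then have "pr A x \<in> pr A ` Na" using A by blast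
        then show ?thesis using pr_self[OF A x] by simp
      qed
    qed
    then show ?thesis by blast
  qed
qed

text \<open>\<open>N\<^sub>\<alpha>\<close> induces all inner automorphisms of A, so its
  intersection with A is normal in the simple group A. It is not A, which moves \<alpha>; hence it
  is trivial, and transitivity of N moves the conclusion to other points.\<close>

lemma semiregular_if_surj:
  assumes surj: "\<And>A. A \<in> \<T> \<Longrightarrow> pr A ` Na = A" and A: "A \<in> \<T>" and t: "t \<in> A" and x: "x \<in> P" "act t x = x"
  shows "t = \<one>"
proof -
  have sub: "subgroup (A \<inter> Na) G" by (intro subgroups_Inter_pair TT_sub[OF A] Na_subgroup)
  have "cj s y \<in> A \<inter> Na" if s: "s \<in> A" and y: "y \<in> A \<inter> Na" for s y
  proof -
    have "s \<in> pr A ` Na" using surj[OF A] s by simp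
    then obtain n where n: "n \<in> Na" "s = pr A n" by (rule imageE)
    have "cj s y = cj n y" using pr_cj[OF A, of n y] n y by (simp add: Na_def)
    moreover have "cj n y \<in> Na" using cj_stab_Na n y NG by (simp add: Na_def stab_def)
    moreover have "cj n y \<in> A" using cj_N_TT[OF A] n y by (simp add: Na_def)
    ultimately show ?thesis by simp
  qed
  then have "nrm A (A \<inter> Na)" using sub by (simp add: nrm_def)
  then have "A \<inter> Na = {\<one>} \<or> A \<inter> Na = A" using TT_simple[OF A] by blast
  moreover have "A \<inter> Na \<noteq> A" using TT_moves[OF A \<alpha>] by (auto simp: Na_def)
  ultimately have triv: "A \<inter> Na = {\<one>}" by blast
  obtain n where n: "n \<in> N" "act n x = \<alpha>" using N_trans x(1) \<alpha> by blast
  have c: "cj n t \<in> A" using cj_N_TT[OF A n(1) t] .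
  have "act (cj n t) \<alpha> = \<alpha>" using act_cj[of n t x] n NG TTG A t x by simp
  then have "cj n t \<in> A \<inter> Na" using c TTN A by (simp add: Na_def)
  then have "cj n t = \<one>" using triv by blast
  then show ?thesis using n NG TTG A t by (metis cj_eq_iff cj_one_right one_closed)
qed

text \<open>If \<open>N\<^sub>\<alpha>\<close> is subdirect, a minimal nonempty set \<open>J\<close> of factors supporting a nontrivial element of
  \<open>N\<^sub>\<alpha>\<close> has at least two members, and killing one component in \<open>J\<close> kills all of them; so removing
  \<open>J\<close> costs one factor \<open>|T|\<close> of the order.\<close>

lemma card_Na_power:
  assumes surj: "\<And>A. A \<in> \<T> \<Longrightarrow> pr A ` Na = A"
  shows "\<exists>l. card Na = ca ^ l \<and> 2 * l \<le> card \<T>"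
proof -
  have sub: "subgroup (Na \<inter> Cs S) G" if "S \<subseteq> \<T>" for S
    using that by (intro subgroups_Inter_pair Na_subgroup Cs_subgroup)
  have NaN: "n \<in> N" if "n \<in> Na" for n using that by (simp add: Na_def)
  have one: "\<one> \<in> Na \<inter> Cs S" if "S \<subseteq> \<T>" for S using subgroup.one_closed[OF sub[OF that]] .
  have key: "\<exists>l. card (Na \<inter> Cs S) = ca ^ l \<and> 2 * l \<le> card (\<T> - S)" if "S \<subseteq> \<T>" for S
    using that
  proof (induction "card (\<T> - S)" arbitrary: S rule: less_induct)
    case less
    show ?case
    proof (cases "Na \<inter> Cs S = {\<one>}")
      case True
      then show ?thesis by (intro exI[of _ 0]) simp
    next
      case False
      \<comment> \<open>A maximal set S' of vanishing components has as complement a minimal support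
        J.\<close>
      let ?Q = "\<lambda>S'. S \<subseteq> S' \<and> S' \<subseteq> \<T> \<and> Na \<inter> Cs S' \<noteq> {\<one>}"
      have "finite {S'. ?Q S'}" using fin\<T> by (rule_tac finite_subset[of _ "Pow \<T>"]) auto
      moreover have "S \<in> {S'. ?Q S'}" using False less.prems by simp
      ultimately obtain S' where S': "S' \<in> {S'. ?Q S'}" and mx: "\<And>U. U \<in> {S'. ?Q S'} \<Longrightarrow> S' \<subseteq> U \<Longrightarrow> U = S'"
        using finite_has_maximal2[of "{S'. ?Q S'}" S] by (metis (no_types, lifting))
      have S'S: "S \<subseteq> S'" "S' \<subseteq> \<T>" "Na \<inter> Cs S' \<noteq> {\<one>}" using S' by auto
      define J where "J = \<T> - S'"
      have "S' \<noteq> \<T>" using S'S(3) Cs_all one[of \<T>] by auto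
      then obtain j where j: "j \<in> J" using S'S(2) by (auto simp: J_def)
      have J\<T>: "A \<in> \<T>" if "A \<in> J" for A using that by (simp add: J_def)
      have triv: "n = \<one>" if A: "A \<in> J" and n: "n \<in> Na \<inter> Cs S'" "pr A n = \<one>" for A n
      proof -
        have "insert A S' \<noteq> S'" using A by (auto simp: J_def)
        then have "insert A S' \<notin> {S'. ?Q S'}" using mx by blast
        then have "Na \<inter> Cs (insert A S') = {\<one>}" using A S'S by (auto simp: J_def)
        moreover have "n \<in> Na \<inter> Cs (insert A S')" using n by (simp add: Cs_def)
        ultimately show ?thesis by blast
      qed
      \<comment> \<open>The image is normal in A because \<open>N\<^sub>\<alpha>\<close> projects
        onto A, and it is nontrivial by the choice of J; simplicity makes it A.\<close>
      have nrmpr: "pr A ` (Na \<inter> Cs U) = A" if A: "A \<in> J" and U: "U \<subseteq> S'" for A U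
      proof -
        have A\<T>: "A \<in> \<T>" using J\<T>[OF A] .
        have U\<T>: "U \<subseteq> \<T>" using U S'S(2) by (rule subset_trans)
        have "subgroup (pr A ` (Na \<inter> Cs U)) G"
          by (rule pr_image_subgroup[OF A\<T> sub[OF U\<T>]]) (use NaN in blast)
        moreover have "cj s y \<in> pr A ` (Na \<inter> Cs U)" if s: "s \<in> A" and y: "y \<in> pr A ` (Na \<inter> Cs U)" for s y
        proof -
          have "s \<in> pr A ` Na" using surj[OF A\<T>] s by simp
          then obtain n where n: "n \<in> Na" "s = pr A n" by (rule imageE)
          obtain m where m: "m \<in> Na \<inter> Cs U" "y = pr A m" using y by (rule imageE)
          have N: "n \<in> N" "m \<in> N" using n m NaN by auto
          have prc: "pr B (cj n m) = cj (pr B n) (pr B m)" if "B \<in> \<T>" for B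
            using that N N_mult N_inv by (simp add: cj_def pr_mult pr_inv)
          have "pr B (cj n m) = \<one>" if B: "B \<in> U" for B
          proof -
            have B\<T>: "B \<in> \<T>" using B U\<T> by blast
            have "pr B m = \<one>" using m B by (simp add: Cs_def)
            then show ?thesis using prc[OF B\<T>] TTG[OF B\<T> pr_in[OF B\<T> N(1)]] by simp
          qed
          then have "cj n m \<in> Cs U" using cjN NG N by (simp add: Cs_def)
          moreover have "cj n m \<in> Na" using cj_stab_Na n m NG N by (simp add: Na_def stab_def)
          ultimately have "pr A (cj n m) \<in> pr A ` (Na \<inter> Cs U)" by blast
          then show ?thesis using prc[OF A\<T>] n(2) m(2) by simp
        qed
        ultimately have "nrm A (pr A ` (Na \<inter> Cs U))" by (simp add: nrm_def)
        moreover have "pr A ` (Na \<inter> Cs U) \<subseteq> A" using pr_in[OF A\<T>] NaN by auto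
        ultimately have "pr A ` (Na \<inter> Cs U) = {\<one>} \<or> pr A ` (Na \<inter> Cs U) = A" using TT_simple[OF A\<T>] by blast
        moreover have "pr A ` (Na \<inter> Cs U) \<noteq> {\<one>}"
        proof
          assume *: "pr A ` (Na \<inter> Cs U) = {\<one>}"
          have "n = \<one>" if n: "n \<in> Na \<inter> Cs S'" for n
          proof (rule triv[OF A n])
            have "n \<in> Na \<inter> Cs U" using n U by (auto simp: Cs_def)
            then have "pr A n \<in> pr A ` (Na \<inter> Cs U)" by (rule imageI)
            then show "pr A n = \<one>" unfolding * by simp
          qed
          then have "Na \<inter> Cs S' \<subseteq> {\<one>}" by (metis singletonI subsetI)
          then show False using S'S(3) one[OF S'S(2)] by auto
        qed
        ultimately show ?thesis by blast
      qed
      \<comment> \<open>If the j-component of n vanishes, so does that of the commutator of n with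
        any m supported on J; by minimality of J the commutator is trivial. The i-components of such
        m fill the factor i, so the i-component of n is central, hence trivial.\<close>
      have collapse: "Na \<inter> Cs (insert j S) = Na \<inter> Cs (S \<union> J)"
      proof (intro equalityI subsetI)
        show "n \<in> Na \<inter> Cs (insert j S)" if "n \<in> Na \<inter> Cs (S \<union> J)" for n using that j by (auto simp: Cs_def)
        fix n assume n: "n \<in> Na \<inter> Cs (insert j S)"
        have nN: "n \<in> N" using n NaN by blast
        have "pr i n = \<one>" if i: "i \<in> J" for i
        proof (rule TT_center[OF J\<T>[OF i]])
          show "pr i n \<in> i" using pr_in[OF J\<T>[OF i] nN] .
          fix y assume y: "y \<in> i"
          have "y \<in> pr i ` (Na \<inter> Cs S')" using nrmpr[OF i subset_refl] y by simp
          then obtain m where m: "m \<in> Na \<inter> Cs S'" "y = pr i m" by (rule imageE)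
          have mN: "m \<in> N" using m NaN by blast
          have G: "n \<in> carrier G" "m \<in> carrier G" using nN mN NG by auto
          let ?c = "cj n m \<otimes> inv m"
          have cN: "cj n m \<in> N" "inv m \<in> N" using cjN N_inv G mN by auto
          have prc: "pr B ?c = cj (pr B n) (pr B m) \<otimes> inv (pr B m)" if "B \<in> \<T>" for B
            using that nN mN N_mult N_inv cN by (simp add: cj_def pr_mult pr_inv)
          have prG: "pr B n \<in> carrier G" "pr B m \<in> carrier G" if "B \<in> \<T>" for B
            using that nN mN pr_in TTG by auto
          have "?c \<in> Na"
            using subgroup.m_closed[OF Na_subgroup] subgroup.m_inv_closed[OF Na_subgroup] cj_stab_Na n m G
            by (simp add: stab_def Na_def)
          moreover have "pr B ?c = \<one>" if B: "B \<in> S'" for B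
          proof -
            have B\<T>: "B \<in> \<T>" using B S'S(2) by blast
            have "pr B m = \<one>" using m B by (simp add: Cs_def)
            then show ?thesis using prc[OF B\<T>] prG[OF B\<T>] by simp
          qed
          then have "?c \<in> Cs S'" using N_mult cN by (simp add: Cs_def)
          moreover have "pr j ?c = \<one>" using prc[OF J\<T>[OF j]] prG[OF J\<T>[OF j]] n by (simp add: Cs_def)
          ultimately have "?c = \<one>" using triv[OF j] by blast
          then have "cj (pr i n) (pr i m) \<otimes> inv (pr i m) = \<one>" using prc[OF J\<T>[OF i]] pr_one[OF J\<T>[OF i]] by simp
          then have "cj (pr i n) y = y" using prG[OF J\<T>[OF i]] m(2) by (metis cj_closed inv_closed inv_equality inv_inv)
          then show "pr i n \<otimes> y = y \<otimes> pr i n" using cj_eq_self_iff prG[OF J\<T>[OF i]] m(2) by simp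
        qed
        then show "n \<in> Na \<inter> Cs (S \<union> J)" using n by (auto simp: Cs_def)
      qed
      \<comment> \<open>A support with one member would put a nontrivial element of a factor into
        \<open>N\<^sub>\<alpha>\<close>. This is the source of the 2 in
        \<open>2 * l\<close>.\<close>
      have "J \<noteq> {j}"
      proof
        assume J: "J = {j}"
        have j\<T>: "j \<in> \<T>" using J\<T>[OF j] .
        have "n = \<one>" if n: "n \<in> Na \<inter> Cs S'" for n
        proof -
          have nN: "n \<in> N" using n NaN by blast
          have "n = pr j n"
          proof (rule eq_if_pr_eq[OF nN])
            show "pr j n \<in> N" using pr_in[OF j\<T> nN] TTN[OF j\<T>] by blast
            fix A assume A: "A \<in> \<T>"
            show "pr A n = pr A (pr j n)"
            proof (cases "A = j")
              case True
              then show ?thesis using pr_self pr_in j\<T> nN by metis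
            next
              case F: False
              then have "A \<in> S'" using A J by (auto simp: J_def)
              then have "pr A n = \<one>" using n by (simp add: Cs_def)
              then show ?thesis using pr_other[OF A j\<T> F pr_in[OF j\<T> nN]] by simp
            qed
          qed
          then have "n \<in> j" using pr_in[OF j\<T> nN] by simp
          then show ?thesis using semiregular_if_surj[OF surj j\<T> _ \<alpha>] n by (simp add: Na_def)
        qed
        then have "Na \<inter> Cs S' \<subseteq> {\<one>}" by (metis singletonI subsetI)
        then show False using S'S(3) one[OF S'S(2)] by auto
      qed
      then obtain i where i: "i \<in> J" "i \<noteq> j" using j by blast
      have finJ: "finite J" using fin\<T> by (simp add: J_def)
      have "card {i, j} \<le> card J" using i j finJ by (intro card_mono) auto
      then have cJ: "2 \<le> card J" using i by simp
      have JS: "J \<subseteq> \<T> - S" using S'S by (auto simp: J_def)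
      have "\<T> - (S \<union> J) = (\<T> - S) - J" by blast
      then have cc: "card (\<T> - (S \<union> J)) + card J = card (\<T> - S)"
        using JS finJ fin\<T> card_mono[of "\<T> - S" J] by (simp add: card_Diff_subset)
      have "\<exists>l. card (Na \<inter> Cs (S \<union> J)) = ca ^ l \<and> 2 * l \<le> card (\<T> - (S \<union> J))"
        using less.hyps[of "S \<union> J"] cc cJ less.prems JS by auto
      then obtain l where l: "card (Na \<inter> Cs (S \<union> J)) = ca ^ l" "2 * l \<le> card (\<T> - (S \<union> J))" by blast
      have "card (Na \<inter> Cs S) = card (pr j ` (Na \<inter> Cs S)) * card {n \<in> Na \<inter> Cs S. pr j n = \<one>}"
        using J\<T>[OF j] sub[OF less.prems] NaN by (intro card_pr) auto
      also have "{n \<in> Na \<inter> Cs S. pr j n = \<one>} = Na \<inter> Cs (insert j S)" by (auto simp: Cs_def)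
      also have "card (pr j ` (Na \<inter> Cs S)) = ca" using nrmpr[OF j S'S(1)] card_TT[OF J\<T>[OF j]] by simp
      finally have "card (Na \<inter> Cs S) = ca ^ Suc l" using collapse l(1) by simp
      moreover have "2 * Suc l \<le> card (\<T> - S)" using l(2) cc cJ by simp
      ultimately show ?thesis by blast
    qed
  qed
  have "Na \<inter> Cs {} = Na" using NaN by (auto simp: Cs_def)
  then show ?thesis using key[of "{}"] by simp
qed

end

section \<open>Exclusion of the other types\<close>

locale design_group = steiner3 v k P \<B> + prim_action G P act
  for v k and P :: "'p set" and \<B> and G (structure) and act +
  assumes act_block: "g \<in> carrier G \<Longrightarrow> B \<in> \<B> \<Longrightarrow> act g ` B \<in> \<B>"
    and block_trans: "B \<in> \<B> \<Longrightarrow> C \<in> \<B> \<Longrightarrow> \<exists>g\<in>carrier G. act g ` B = C"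
begin

lemma block_trans': "B \<in> \<B> \<Longrightarrow> C \<in> \<B> \<Longrightarrow> \<exists>g\<in>act ` carrier G. g ` B = C"
  using block_trans by auto

text \<open>Tagging by ordered triples makes the size of the family the index of the pointwise
  stabilizer, without regard to elements permuting x, y and z.\<close>

lemma card_blocks_dvd_orbit:
  assumes "x \<in> P" "y \<in> P" "z \<in> P" "x \<noteq> y" "x \<noteq> z" "y \<noteq> z"
  shows "card \<B> dvd card ((\<lambda>g. (act g x, act g y, act g z)) ` carrier G)"
proof (rule card_blocks_dvd[where s = "\<lambda>(a, b, c). {a, b, c}" and H = "act ` carrier G"])
  let ?\<Omega> = "(\<lambda>g. (act g x, act g y, act g z)) ` carrier G"
  show "finite ?\<Omega>" using finite_G by simp
  show "(case w of (a, b, c) \<Rightarrow> {a, b, c}) \<subseteq> P \<and> card (case w of (a, b, c) \<Rightarrow> {a, b, c}) = 3"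
    if w: "w \<in> ?\<Omega>" for w
  proof -
    obtain g where g: "g \<in> carrier G" "w = (act g x, act g y, act g z)" using w by (rule imageE)
    have "act g x \<noteq> act g y" "act g x \<noteq> act g z" "act g y \<noteq> act g z" using g(1) assms by (simp_all add: act_eq_iff)
    then show ?thesis using g assms act_in by simp
  qed
  show "\<exists>g\<in>act ` carrier G. g ` B = C" if "B \<in> \<B>" "C \<in> \<B>" for B C using block_trans'[OF that] .
  fix g' assume "g' \<in> act ` carrier G"
  then obtain g where g: "g \<in> carrier G" "g' = act g" by (rule imageE)
  let ?F = "\<lambda>(a, b, c). (act g a, act g b, act g c)"
  have el: "fst w \<in> P \<and> fst (snd w) \<in> P \<and> snd (snd w) \<in> P" if "w \<in> ?\<Omega>" for w
    using that assms act_in by auto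
  have injF: "inj_on ?F ?\<Omega>"
  proof (rule inj_onI)
    fix w w' assume ww: "w \<in> ?\<Omega>" "w' \<in> ?\<Omega>" "?F w = ?F w'"
    obtain a b c a' b' c' where w: "w = (a, b, c)" "w' = (a', b', c')" by (cases w, cases w')
    show "w = w'" using el[OF ww(1)] el[OF ww(2)] ww(3) g(1) unfolding w by (simp add: act_eq_iff)
  qed
  have mapF: "?F w \<in> ?\<Omega> \<and> (case ?F w of (a, b, c) \<Rightarrow> {a, b, c}) = g' ` (case w of (a, b, c) \<Rightarrow> {a, b, c})"
    if w: "w \<in> ?\<Omega>" for w
  proof -
    obtain h where h: "h \<in> carrier G" "w = (act h x, act h y, act h z)" using w by (rule imageE)
    have "?F w = (act (g \<otimes> h) x, act (g \<otimes> h) y, act (g \<otimes> h) z)"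
      unfolding h(2) using g(1) h(1) assms by (simp add: act_mult)
    then have "?F w \<in> ?\<Omega>" using g(1) h(1) by (metis (no_types, lifting) imageI m_closed)
    then show ?thesis unfolding h(2) g(2) by simp
  qed
  show "\<exists>F. inj_on F ?\<Omega> \<and> (\<forall>w\<in>?\<Omega>. F w \<in> ?\<Omega> \<and> (case F w of (a, b, c) \<Rightarrow> {a, b, c}) = g' ` (case w of (a, b, c) \<Rightarrow> {a, b, c}))"
    using injF by (rule exI[of _ ?F, OF conjI]) (rule ballI, erule mapF)
qed

end

section \<open>The semiregular, diagonal and product cases on a Steiner 3-design\<close>

locale design_min = design_group v k P \<B> G act + prim_min G P act N T \<alpha>
  for v k and P :: "'p set" and \<B> and G (structure) and act N T \<alpha>
begin

text \<open>If v = |T| is twice an odd number, an involution of T has no fixed points and is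
  therefore an odd permutation. The even permutations in N then form a proper G-invariant subgroup,
  trivial by minimality; it contains all squares, so N would be abelian.\<close>

lemma odd_or_4_dvd:
  assumes reg: "\<And>t x. t \<in> T \<Longrightarrow> x \<in> P \<Longrightarrow> act t x = x \<Longrightarrow> t = \<one>" and v: "v = ca"
  shows "odd v \<or> 4 dvd v"
proof (rule ccontr)
  assume neg: "\<not> ?thesis"
  then obtain j where j: "v = 2 * j" by blast
  have oddj: "odd j" using neg j by auto
  interpret T: group "G\<lparr>carrier := T\<rparr>" using subT subgroup.subgroup_is_group is_group by blast
  have "order (G\<lparr>carrier := T\<rparr>) = 2 ^ 1 * j" using v j by (simp add: order_def ca_def)
  moreover have "finite (carrier (G\<lparr>carrier := T\<rparr>))" using TN finN finite_subset by simp
  ultimately obtain H where H: "subgroup H (G\<lparr>carrier := T\<rparr>)" "card H = 2"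
    using sylow_thm[of 2 "G\<lparr>carrier := T\<rparr>" 1 j] T.is_group by auto
  have HT: "H \<subseteq> T" using subgroup.subset[OF H(1)] by simp
  have oneH: "\<one> \<in> H" using subgroup.one_closed[OF H(1)] by simp
  obtain a b where ab: "H = {a, b}" "a \<noteq> b" using H(2) by (auto simp: card_2_iff)
  then obtain t where t: "t \<in> H" "t \<noteq> \<one>" by auto
  have Ht: "H = {\<one>, t}" using ab t oneH by auto
  have tT: "t \<in> T" using t HT by blast
  have tG: "t \<in> carrier G" using tT TN NG by blast
  have "t \<otimes> t \<in> H" using subgroup.m_closed[OF H(1) t(1) t(1)] by simp
  moreover have "t \<otimes> t \<noteq> t" using t(2) tG by (metis l_cancel_one)
  ultimately have tt: "t \<otimes> t = \<one>" using Ht by auto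
  have "sign (perm t) = (-1) ^ j"
  proof (rule sign_fixed_point_free_involution[OF finite_P perm_permutes[OF tG]])
    show "perm t (perm t x) = x" for x
      using act_mult[OF tG tG, of x] tt act_one by (simp add: perm_def act_in tG)
    show "perm t x \<noteq> x" if "x \<in> P" for x using reg[OF tT that] that t(2) by (auto simp: perm_def)
    show "card P = 2 * j" using cardP j by simp
  qed
  then have st: "sign (perm t) = -1" using oddj by simp
  have s1: "sign (perm \<one>) = 1"
  proof -
    have "perm \<one> = id" using act_one by (auto simp: perm_def)
    then show ?thesis by simp
  qed
  have sinv: "sign (perm (inv g)) = sign (perm g)" if g: "g \<in> carrier G" for g
  proof -
    have "sign (perm (inv g)) * sign (perm g) = 1" using sign_perm_mult[of "inv g" g] g s1 by simp
    then show ?thesis by (metis mult.commute mult.left_commute mult.right_neutral sign_idempotent)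
  qed
  let ?M = "{n \<in> N. sign (perm n) = 1}"
  have "subgroup ?M G"
  proof (rule subgroupI)
    show "?M \<subseteq> carrier G" using NG by auto
    have "\<one> \<in> ?M" using N_one s1 by simp
    then show "?M \<noteq> {}" by blast
    show "inv a \<in> ?M" if "a \<in> ?M" for a using that N_inv sinv NG by simp
    show "a \<otimes> b \<in> ?M" if "a \<in> ?M" "b \<in> ?M" for a b using that N_mult sign_perm_mult NG by simp
  qed
  moreover have "cj g n \<in> ?M" if "g \<in> carrier G" "n \<in> ?M" for g n
  proof -
    have nG: "n \<in> carrier G" using that NG by simp
    have "sign (perm (cj g n)) = sign (perm g) * sign (perm n) * sign (perm g)"
      unfolding cj_def using that nG sinv by (simp add: sign_perm_mult)
    then show ?thesis using that cjN by simp
  qed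
  ultimately have "nrm (carrier G) ?M" by (simp add: nrm_def)
  moreover have "?M \<subseteq> N" by auto
  ultimately have "?M = {\<one>} \<or> ?M = N" using minN unfolding min_nrm_def by metis
  moreover have "?M \<noteq> N"
  proof
    assume "?M = N"
    then have "t \<in> ?M" using tT TN by blast
    then show False using st by simp
  qed
  ultimately have M: "?M = {\<one>}" by simp
  have sq: "n \<otimes> n = \<one>" if n: "n \<in> N" for n
  proof -
    have "n \<otimes> n \<in> ?M" using n N_mult sign_perm_mult NG by simp
    then show ?thesis using M by simp
  qed
  have "x \<otimes> y = y \<otimes> x" if xy: "x \<in> N" "y \<in> N" for x y
  proof -
    have i: "inv n = n" if "n \<in> N" for n using sq[OF that] NG[OF that] by (simp add: inv_equality)
    have "inv (x \<otimes> y) = inv y \<otimes> inv x" using xy NG by (simp add: inv_mult_group)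
    then show ?thesis using i xy N_mult by simp
  qed
  then show False using nonab by metis
qed

text \<open>Serves both the case of a regular N and that of an \<open>N\<^sub>\<alpha>\<close>
  projecting onto the factors. Two things are asked of g in \<open>inner\<close>: it acts on T as t,
  so that the class of x is reached, and on N as some inner automorphism, so that it lies in a
  subgroup \<open>M\<close> normal in \<open>G\<^sub>\<alpha>\<close>. Normality spreads the orbit
  length h from x\<alpha> to its whole \<open>G\<^sub>\<alpha>\<close>-orbit, whence h divides
  d.\<close>

lemma no_semiregular_factor:
  assumes reg: "\<And>A t x. A \<in> \<T> \<Longrightarrow> t \<in> A \<Longrightarrow> x \<in> P \<Longrightarrow> act t x = x \<Longrightarrow> t = \<one>"
    and v: "v = ca ^ \<mu>" and \<mu>: "\<mu> \<ge> 1" "card \<T> \<le> 2 * \<mu>"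
    and inner: "\<And>t. t \<in> T \<Longrightarrow> \<exists>g\<in>stab \<alpha>. (\<exists>n\<in>N. \<forall>y\<in>N. cj g y = cj n y) \<and> (\<forall>y\<in>T. cj g y = cj t y)"
  shows False
proof -
  have TG: "t \<in> carrier G" if "t \<in> T" for t using that TTG[OF T_in] by blast
  have T_m: "s \<otimes> t \<in> T" if "s \<in> T" "t \<in> T" for s t using that TT_mult[OF T_in] by blast
  have T_i: "inv t \<in> T" if "t \<in> T" for t using that TT_inv[OF T_in] by blast
  have T_cj: "cj s t \<in> T" if "s \<in> T" "t \<in> T" for s t using that TTN[OF T_in] cj_N_TT[OF T_in] by blast
  have regT: "s = t" if "s \<in> T" "t \<in> T" "x \<in> P" "act s x = act t x" for s t x
  proof -
    have "inv s \<otimes> t = \<one>" using reg[OF T_in, of "inv s \<otimes> t" x] that act_eq_act_iff[of s t x] TG T_m T_i by simp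
    then show ?thesis using that TG by (metis inv_closed inv_equality inv_inv)
  qed
  obtain x where x: "x \<in> T" "x \<otimes> x \<noteq> \<one>" using ex_nonelementary by blast
  have xG: "x \<in> carrier G" using TG x by blast
  have x1: "x \<noteq> \<one>" using x by auto
  define \<beta> where "\<beta> = act x \<alpha>"
  define \<gamma> where "\<gamma> = act (inv x) \<alpha>"
  have bP: "\<beta> \<in> P" "\<gamma> \<in> P" using act_in xG \<alpha> by (auto simp: \<beta>_def \<gamma>_def)
  have ab: "\<alpha> \<noteq> \<beta>" using reg[OF T_in x(1) \<alpha>] x1 by (auto simp: \<beta>_def)
  have ac: "\<alpha> \<noteq> \<gamma>" using reg[OF T_in T_i[OF x(1)] \<alpha>] x1 xG by (auto simp: \<gamma>_def)
  have bc: "\<beta> \<noteq> \<gamma>"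
  proof
    assume "\<beta> = \<gamma>"
    then have "x = inv x" using regT[OF x(1) T_i[OF x(1)] \<alpha>] by (simp add: \<beta>_def \<gamma>_def)
    then show False using x xG by (metis l_inv)
  qed
  have stabG: "g \<in> carrier G" "act g \<alpha> = \<alpha>" if "g \<in> stab \<alpha>" for g using that by (auto simp: stab_def)
  \<comment> \<open>The conjugate x' of x by g satisfies \<open>x' \<alpha> = x \<alpha>\<close>.
    Either x' lies in T and equals x, or it lies in another factor; both times it commutes with x,
    so the inverses of x and x' also agree at \<alpha>.\<close>
  have fixg: "act g \<gamma> = \<gamma>" if g: "g \<in> stab \<alpha>" "act g \<beta> = \<beta>" for g
  proof -
    note gG = stabG[OF g(1)]
    define x' where "x' = cj g x"
    have x'A: "x' \<in> cj g ` T" using x by (simp add: x'_def)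
    have A: "cj g ` T \<in> \<T>" using TT_cj[OF T_in gG(1)] .
    have x'G: "x' \<in> carrier G" using x'A TTG[OF A] by blast
    have e: "act x' \<alpha> = act x \<alpha>" using act_cj_fix[OF gG(1) xG \<alpha> gG(2)] g(2) by (simp add: x'_def \<beta>_def)
    have com: "x \<otimes> x' = x' \<otimes> x"
    proof (cases "cj g ` T = T")
      case True
      then have "x' = x" using regT[of x' x \<alpha>] x'A x(1) \<alpha> e by simp
      then show ?thesis by simp
    next
      case False
      then show ?thesis using TT_commute[OF T_in A _ x(1) x'A] by auto
    qed
    have "act (inv x' \<otimes> x) \<alpha> = \<alpha>" using e act_eq_act_iff[OF x'G xG \<alpha>] by simp
    moreover have "inv x' \<otimes> x = x \<otimes> inv x'" using commute_inv[OF x'G xG] com by simp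
    ultimately have "act x (act (inv x') \<alpha>) = \<alpha>" using act_mult[of x "inv x'" \<alpha>] xG x'G \<alpha> by simp
    then have "act (inv x) (act x (act (inv x') \<alpha>)) = act (inv x) \<alpha>" by simp
    then have "act (inv x') \<alpha> = \<gamma>" using xG x'G \<alpha> act_in by (simp add: \<gamma>_def)
    moreover have "inv x' = cj g (inv x)" using cj_inv[OF gG(1) xG] by (simp add: x'_def)
    ultimately show ?thesis using act_cj_fix[of g "inv x" \<alpha>] gG xG \<alpha> by (simp add: \<gamma>_def)
  qed
  define O' where "O' = (\<lambda>g. act g \<beta>) ` stab \<alpha>"
  define d where "d = card O'"
  have sS: "subgroup (stab \<alpha>) G" using stab_subgroup[OF \<alpha>] .
  have finO: "finite O'" unfolding O'_def using finite_G by (rule_tac finite_imageI, rule_tac finite_subset[of _ "carrier G"]) (auto simp: stab_def)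
  \<comment> \<open>By \<open>fixg\<close> the stabilizer of the triple is that of the pair
    \<alpha>, \<beta>, so the orbit of the ordered triple has length \<open>v * d\<close>.\<close>
  have bvd: "card \<B> dvd v * d"
  proof -
    let ?\<Omega> = "(\<lambda>g. (act g \<alpha>, act g \<beta>, act g \<gamma>)) ` carrier G"
    let ?L = "{g \<in> stab \<alpha>. act g \<beta> = \<beta>}"
    have "card (carrier G) = card ?\<Omega> * card ?L"
    proof (rule card_subgroup_fibres[OF finite_G subgroup_self])
      show "?L \<subseteq> carrier G" by (auto simp: stab_def)
      fix g h assume gh: "g \<in> carrier G" "h \<in> carrier G"
      have "(act g \<alpha>, act g \<beta>, act g \<gamma>) = (act h \<alpha>, act h \<beta>, act h \<gamma>) \<longleftrightarrow>
        act (inv g \<otimes> h) \<alpha> = \<alpha> \<and> act (inv g \<otimes> h) \<beta> = \<beta> \<and> act (inv g \<otimes> h) \<gamma> = \<gamma>"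
        using act_eq_act_iff[OF gh] \<alpha> bP by simp
      also have "\<dots> \<longleftrightarrow> inv g \<otimes> h \<in> ?L" using fixg[of "inv g \<otimes> h"] gh by (auto simp: stab_def)
      finally show "(act g \<alpha>, act g \<beta>, act g \<gamma>) = (act h \<alpha>, act h \<beta>, act h \<gamma>) \<longleftrightarrow> inv g \<otimes> h \<in> ?L" .
    qed
    moreover have "card (carrier G) = v * card (stab \<alpha>)"
    proof -
      have "(\<lambda>g. act g \<alpha>) ` carrier G = P" using trans[OF \<alpha>] act_in \<alpha> by force
      then show ?thesis using orbit_stabilizer[OF subgroup_self \<alpha>] cardP by (simp add: stab_def)
    qed
    moreover have "card (stab \<alpha>) = d * card ?L" unfolding d_def O'_def by (rule orbit_stabilizer[OF sS bP(1)])
    ultimately have "card ?\<Omega> * card ?L = v * d * card ?L" by (metis mult.assoc)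
    moreover have "card ?L > 0"
    proof -
      have "\<one> \<in> ?L" using act_one bP \<alpha> by (simp add: stab_def)
      moreover have "finite ?L" using finite_G by (rule_tac finite_subset[of _ "carrier G"]) (auto simp: stab_def)
      ultimately show ?thesis by (metis card_gt_0_iff empty_iff)
    qed
    ultimately have "card ?\<Omega> = v * d" by simp
    then show ?thesis using card_blocks_dvd_orbit[OF \<alpha> bP ab ac bc] by simp
  qed
  define cl where "cl = (\<lambda>t. cj t x) ` T"
  define h where "h = card cl"
  define CT where "CT = {t \<in> T. t \<otimes> x = x \<otimes> t}"
  define f where "f = card CT"
  have clT: "cl \<subseteq> T" using T_cj x(1) by (auto simp: cl_def)
  have finT: "finite T" using finN TN finite_subset by blast
  have fincl: "finite cl" using finT by (simp add: cl_def)
  have hf: "ca = h * f"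
    unfolding ca_def h_def f_def cl_def
  proof (rule card_subgroup_fibres[OF finite_G subT])
    show "CT \<subseteq> T" by (auto simp: CT_def)
    fix s t assume st: "s \<in> T" "t \<in> T"
    have G: "s \<in> carrier G" "t \<in> carrier G" using st TG by auto
    have "cj s x = cj t x \<longleftrightarrow> cj (inv s) (cj s x) = cj (inv s) (cj t x)" using G xG by (simp del: cj_inv_cancel)
    also have "\<dots> \<longleftrightarrow> cj (inv s \<otimes> t) x = x" using G xG by (auto simp: cj_cj)
    also have "\<dots> \<longleftrightarrow> inv s \<otimes> t \<in> CT" using cj_eq_self_iff[of "inv s \<otimes> t" x] G xG st T_m T_i by (simp add: CT_def)
    finally show "cj s x = cj t x \<longleftrightarrow> inv s \<otimes> t \<in> CT" .
  qed
  have f3: "f \<ge> 3"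
  proof -
    have "{\<one>, x, x \<otimes> x} \<subseteq> CT" using TT_one[OF T_in] x(1) T_m xG by (auto simp: CT_def m_assoc)
    moreover have "finite CT" using finT by (simp add: CT_def)
    ultimately have "card {\<one>, x, x \<otimes> x} \<le> f" unfolding f_def by (intro card_mono)
    moreover have "x \<otimes> x \<noteq> x" using x1 xG by (metis l_cancel_one)
    then have "card {\<one>, x, x \<otimes> x} = 3" using x1 x(2) by (auto simp: card_insert_if)
    ultimately show ?thesis by simp
  qed
  \<comment> \<open>T acts faithfully by conjugation on the class of x: the kernel is normal, and it
    is not T because x is not central.\<close>
  have le: "ca \<le> fact h"
  proof -
    let ?p = "\<lambda>t z. if z \<in> cl then cj t z else z"
    have clcl: "cj t z \<in> cl" if t: "t \<in> T" and z: "z \<in> cl" for t z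
    proof -
      obtain s where s: "s \<in> T" "z = cj s x" using z unfolding cl_def by (rule imageE)
      have "cj t z = cj (t \<otimes> s) x" using s t TG xG by (simp add: cj_cj)
      then show ?thesis using T_m[OF t s(1)] unfolding cl_def by (rule image_eqI)
    qed
    have clG: "z \<in> carrier G" if "z \<in> cl" for z using that clT TG by blast
    have sub: "?p ` T \<subseteq> {p. p permutes cl}"
    proof (rule image_subsetI, rule CollectI)
      fix t assume t: "t \<in> T"
      have "inj_on (cj t) cl" using TG[OF t] clG by (intro inj_onI) simp
      then have "bij_betw (cj t) cl cl" using clcl[OF t] fincl by (simp add: bij_betw_def endo_inj_surj image_subset_iff)
      then have "bij_betw (?p t) cl cl" by (simp cong: bij_betw_cong)
      then show "?p t permutes cl" by (rule bij_imp_permutes) simp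
    qed
    have inj: "inj_on ?p T"
    proof (rule inj_onI)
      fix s t assume st: "s \<in> T" "t \<in> T" "?p s = ?p t"
      have e: "cj s z = cj t z" if "z \<in> cl" for z using fun_cong[OF st(3), of z] that by simp
      let ?D = "{u \<in> T. \<forall>z\<in>cl. u \<otimes> z = z \<otimes> u}"
      have "subgroup ({g \<in> carrier G. \<forall>z\<in>cl. g \<otimes> z = z \<otimes> g} \<inter> T) G"
        using clG by (intro subgroups_Inter_pair subgroup_centralizer subT) auto
      moreover have "{g \<in> carrier G. \<forall>z\<in>cl. g \<otimes> z = z \<otimes> g} \<inter> T = ?D" using TG by auto
      ultimately have "subgroup ?D G" by simp
      moreover have "cj w u \<in> ?D" if w: "w \<in> T" and u: "u \<in> ?D" for w u
      proof -
        have "cj w u \<otimes> z = z \<otimes> cj w u" if z: "z \<in> cl" for z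
        proof -
          have z': "cj (inv w) z \<in> cl" using clcl T_i w z by blast
          have "u \<otimes> cj (inv w) z = cj (inv w) z \<otimes> u" using u z' by simp
          then have "cj w u \<otimes> cj w (cj (inv w) z) = cj w (cj (inv w) z) \<otimes> cj w u"
            using commute_cj[of w u "cj (inv w) z"] TG w u clG z z' by (simp del: cj_inv_cancel2)
          then show ?thesis using TG w clG z by simp
        qed
        then show ?thesis using T_cj w u by simp
      qed
      ultimately have "nrm T ?D" by (simp add: nrm_def)
      then have "?D = {\<one>} \<or> ?D = T" by (rule TT_simple[OF T_in]) auto
      moreover have "?D \<noteq> T"
      proof
        assume D: "?D = T"
        have xcl: "x \<in> cl" unfolding cl_def using TT_one[OF T_in] xG by (intro rev_image_eqI[of \<one>]) auto
        have "x \<otimes> y = y \<otimes> x" if "y \<in> T" for y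
        proof -
          have "y \<in> ?D" using D that by simp
          then show ?thesis using xcl by simp
        qed
        then have "x = \<one>" by (rule TT_center[OF T_in x(1)])
        then show False using x1 by simp
      qed
      ultimately have D: "?D = {\<one>}" by simp
      have G: "s \<in> carrier G" "t \<in> carrier G" using st TG by auto
      have "inv s \<otimes> t \<in> ?D"
      proof -
        have "(inv s \<otimes> t) \<otimes> z = z \<otimes> (inv s \<otimes> t)" if z: "z \<in> cl" for z
        proof -
          have "cj (inv s) (cj t z) = z" using e[OF z, symmetric] G clG[OF z] by simp
          then have "cj (inv s \<otimes> t) z = z" using G clG[OF z] by (simp add: cj_cj)
          then show ?thesis using cj_eq_self_iff[of "inv s \<otimes> t" z] G clG[OF z] by simp
        qed
        then show ?thesis using st T_m T_i by simp
      qed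
      then have "inv s \<otimes> t = \<one>" unfolding D by simp
      then show "s = t" using G by (metis inv_closed inv_equality inv_inv)
    qed
    have "finite {p. p permutes cl}" using fincl by (rule finite_permutations)
    then have "card T \<le> card {p. p permutes cl}" by (rule card_inj_on_le[OF inj sub])
    then show ?thesis using card_permutations[of cl h] fincl by (simp add: ca_def h_def)
  qed
  \<comment> \<open>\<open>3 * h \<le> |T| \<le> h!\<close> fails for h = 1, 2, 3.\<close>
  have h4: "h \<ge> 4"
  proof -
    have "3 * h \<le> ca" unfolding hf using f3 by simp
    then have "3 * h \<le> fact h" using le by simp
    show ?thesis
    proof (rule ccontr)
      assume "\<not> h \<ge> 4"
      then have "h = 0 \<or> h = 1 \<or> h = 2 \<or> h = 3" by linarith
      moreover have "h \<noteq> 0" using fincl x(1) by (auto simp: h_def cl_def)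
      ultimately show False using \<open>3 * h \<le> fact h\<close> by (auto simp: numeral_eq_Suc)
    qed
  qed
  have ca12: "ca \<ge> 12" using mult_le_mono[OF h4 f3] hf by simp
  \<comment> \<open>The elements of \<open>G\<^sub>\<alpha>\<close> that act on N as inner
    automorphisms of N; they form a normal subgroup of \<open>G\<^sub>\<alpha>\<close>.\<close>
  define M where "M = {g \<in> stab \<alpha>. \<exists>n\<in>N. \<forall>y\<in>N. cj g y = cj n y}"
  have MG: "g \<in> carrier G" if "g \<in> M" for g using that by (simp add: M_def stab_def)
  have Mm: "g \<otimes> g' \<in> M" if "g \<in> M" "g' \<in> M" for g g'
  proof -
    obtain n n' where n: "n \<in> N" "\<forall>y\<in>N. cj g y = cj n y" "n' \<in> N" "\<forall>y\<in>N. cj g' y = cj n' y"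
      using \<open>g \<in> M\<close> \<open>g' \<in> M\<close> by (auto simp: M_def)
    have "cj (g \<otimes> g') y = cj (n \<otimes> n') y" if y: "y \<in> N" for y
    proof -
      have "cj (g \<otimes> g') y = cj g (cj g' y)" using MG \<open>g \<in> M\<close> \<open>g' \<in> M\<close> y NG by (simp add: cj_cj)
      also have "\<dots> = cj n (cj n' y)" using n y cjN NG by simp
      finally show ?thesis using n y NG by (simp add: cj_cj)
    qed
    moreover have "g \<otimes> g' \<in> stab \<alpha>" using \<open>g \<in> M\<close> \<open>g' \<in> M\<close> subgroup.m_closed[OF sS] by (simp add: M_def)
    ultimately show ?thesis using N_mult[OF n(1,3)] unfolding M_def by blast
  qed
  have Mc: "cj s g \<in> M" if s: "s \<in> stab \<alpha>" and g: "g \<in> M" for s g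
  proof -
    obtain n where n: "n \<in> N" "\<forall>y\<in>N. cj g y = cj n y" using g by (auto simp: M_def)
    have sG: "s \<in> carrier G" and gG: "g \<in> carrier G" using stabG s MG g by auto
    have eq: "cj (cj s w) y = cj s (cj w (cj (inv s) y))" if "w \<in> carrier G" "y \<in> carrier G" for w y
      using that sG by (simp add: cj_def m_assoc inv_mult_group)
    have "cj (cj s g) y = cj (cj s n) y" if y: "y \<in> N" for y
      using eq[of g y] eq[of n y] n y NG gG sG cjN[of "inv s" y] by simp
    moreover have "cj s g \<in> stab \<alpha>"
      using act_cj_fix[of s g \<alpha>] stabG[OF s] g \<alpha> gG by (simp add: M_def stab_def)
    ultimately show ?thesis using cjN[OF sG n(1)] unfolding M_def by blast
  qed
  have Mi: "inv g \<in> M" if g: "g \<in> M" for g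
  proof -
    obtain n where n: "n \<in> N" "\<forall>y\<in>N. cj g y = cj n y" using g by (auto simp: M_def)
    have gG: "g \<in> carrier G" using MG g .
    have "cj (inv g) y = cj (inv n) y" if y: "y \<in> N" for y
    proof -
      have y': "cj (inv n) y \<in> N" using cjN n y NG by simp
      have "cj g (cj (inv n) y) = y" using n y y' NG by simp
      then have "cj (inv g) (cj g (cj (inv n) y)) = cj (inv g) y" by simp
      then show ?thesis using gG y' NG by simp
    qed
    moreover have "inv g \<in> stab \<alpha>" using g subgroup.m_inv_closed[OF sS] by (simp add: M_def)
    ultimately show ?thesis using N_inv[OF n(1)] unfolding M_def by blast
  qed
  have M1: "\<one> \<in> M"
  proof -
    have "\<one> \<in> stab \<alpha>" using subgroup.one_closed[OF sS] .
    then show ?thesis unfolding M_def using N_one by blast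
  qed
  have cl_M: "(\<lambda>g. cj g x) ` M = cl"
  proof (intro equalityI subsetI)
    fix y assume "y \<in> (\<lambda>g. cj g x) ` M"
    then obtain g where g: "g \<in> M" "y = cj g x" by (rule imageE)
    then obtain n where n: "n \<in> N" "cj g x = cj n x" using x(1) TN by (auto simp: M_def)
    then have "y = cj (pr T n) x" using g(2) pr_cj[OF T_in n(1) x(1)] by simp
    then show "y \<in> cl" using pr_in[OF T_in n(1)] unfolding cl_def by (rule image_eqI)
  next
    fix y assume "y \<in> cl"
    then obtain t where t: "t \<in> T" "y = cj t x" unfolding cl_def by (rule imageE)
    obtain g where g: "g \<in> stab \<alpha>" "\<exists>n\<in>N. \<forall>y\<in>N. cj g y = cj n y" "\<forall>y\<in>T. cj g y = cj t y" using inner[OF t(1)] by auto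
    have "g \<in> M" using g by (simp add: M_def)
    moreover have "y = cj g x" using g(3) x(1) t(2) by simp
    ultimately show "y \<in> (\<lambda>g. cj g x) ` M" by (rule rev_image_eqI)
  qed
  \<comment> \<open>The M-orbit of y. The orbit of \<beta> = x\<alpha> corresponds to the class of
    x, and the other M-orbits in \<open>O'\<close> are its translates.\<close>
  define q where "q y = (\<lambda>g. act g y) ` M" for y
  have Mstab: "g \<in> stab \<alpha>" if "g \<in> M" for g using that by (simp add: M_def)
  have q\<beta>: "card (q \<beta>) = h"
  proof -
    have "q \<beta> = (\<lambda>z. act z \<alpha>) ` cl"
      unfolding cl_M[symmetric] q_def image_image
      using act_cj_fix[OF _ xG \<alpha>] Mstab stabG by (intro image_cong refl) (simp add: \<beta>_def)
    moreover have "inj_on (\<lambda>z. act z \<alpha>) cl" using regT[OF _ _ \<alpha>] clT by (intro inj_onI) blast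
    ultimately show ?thesis by (simp add: card_image h_def)
  qed
  have OP: "O' \<subseteq> P" using act_in bP stabG by (auto simp: O'_def)
  have de: "d = card (q ` O') * h"
    unfolding d_def
  proof (rule card_eq_fibre_mult[OF finO])
    fix Z assume "Z \<in> q ` O'"
    then obtain y where y: "y \<in> O'" "Z = q y" by (rule imageE)
    have yP: "y \<in> P" using y OP by blast
    obtain s where s: "s \<in> stab \<alpha>" "y = act s \<beta>" using y(1) unfolding O'_def by (rule imageE)
    have sG: "s \<in> carrier G" using stabG s by blast
    have qy: "q y = act s ` q \<beta>"
    proof (intro equalityI subsetI)
      fix z assume "z \<in> q y"
      then obtain g where g: "g \<in> M" "z = act g y" unfolding q_def by (rule imageE)
      have iS: "inv s \<in> stab \<alpha>" using subgroup.m_inv_closed[OF sS s(1)] .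
      have g': "cj (inv s) g \<in> M" using Mc[OF iS g(1)] .
      have "z = act (cj s (cj (inv s) g)) (act s \<beta>)" using g s(2) sG MG by simp
      also have "\<dots> = act s (act (cj (inv s) g) \<beta>)" using act_cj[OF sG MG[OF g'] bP(1)] .
      finally have "z = act s (act (cj (inv s) g) \<beta>)" .
      moreover have "act (cj (inv s) g) \<beta> \<in> q \<beta>" using g' unfolding q_def by (rule imageI)
      ultimately show "z \<in> act s ` q \<beta>" by (rule image_eqI)
    next
      fix z assume "z \<in> act s ` q \<beta>"
      then obtain g where g: "g \<in> M" "z = act s (act g \<beta>)" unfolding q_def by auto
      have "z = act (cj s g) y" using act_cj[OF sG MG[OF g(1)] bP(1)] g(2) s(2) by simp
      then show "z \<in> q y" using Mc[OF s(1) g(1)] unfolding q_def by (rule image_eqI)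
    qed
    have q\<beta>P: "q \<beta> \<subseteq> P" using act_in MG bP by (auto simp: q_def)
    have cardq: "card (q y) = h"
      unfolding qy using q\<beta> act_inj[OF sG] q\<beta>P by (metis card_image inj_on_subset)
    have "{z \<in> O'. q z = Z} = q y"
    proof (intro equalityI subsetI)
      fix z assume z: "z \<in> {z \<in> O'. q z = Z}"
      have zP: "z \<in> P" using z OP by blast
      have "act \<one> z \<in> q z" unfolding q_def using M1 by (rule imageI)
      then show "z \<in> q y" using z y(2) act_one[OF zP] by simp
    next
      fix z assume "z \<in> q y"
      then obtain g where g: "g \<in> M" "z = act g y" unfolding q_def by (rule imageE)
      have gG: "g \<in> carrier G" using MG g by blast
      have "z = act (g \<otimes> s) \<beta>" using g s gG sG bP by (simp add: act_mult)
      moreover have "g \<otimes> s \<in> stab \<alpha>" using subgroup.m_closed[OF sS Mstab[OF g(1)] s(1)] .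
      ultimately have zO: "z \<in> O'" unfolding O'_def by (rule image_eqI)
      have zP: "z \<in> P" using zO OP by blast
      have yz: "y = act (inv g) z" using g(2) gG yP by simp
      have "q z = q y"
      proof (intro equalityI subsetI)
        fix w assume "w \<in> q z"
        then obtain m where m: "m \<in> M" "w = act m z" unfolding q_def by (rule imageE)
        have "w = act (m \<otimes> g) y" using m g(2) MG gG yP by (simp add: act_mult)
        then show "w \<in> q y" using Mm[OF m(1) g(1)] unfolding q_def by (rule image_eqI)
      next
        fix w assume "w \<in> q y"
        then obtain m where m: "m \<in> M" "w = act m y" unfolding q_def by (rule imageE)
        have "w = act (m \<otimes> inv g) z" unfolding m(2) yz using m(1) MG gG zP by (simp add: act_mult)
        then show "w \<in> q z" using Mm[OF m(1) Mi[OF g(1)]] unfolding q_def by (rule image_eqI)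
      qed
      then show "z \<in> {z \<in> O'. q z = Z}" using zO y(2) by simp
    qed
    then show "card {z \<in> O'. q z = Z} = h" using cardq by simp
  qed
  define e where "e = card (q ` O')"
  have d0: "d > 0"
  proof -
    have "\<one> \<in> stab \<alpha>" using subgroup.one_closed[OF sS] .
    then have "O' \<noteq> {}" unfolding O'_def by blast
    then show ?thesis using finO by (simp add: d_def card_gt_0_iff)
  qed
  have e0: "e > 0" using d0 de by (cases e) (auto simp: e_def)
  have hv: "h dvd v" unfolding v using \<mu>(1) hf by (metis dvd_power dvd_triv_left dvd_trans less_eq_Suc_le One_nat_def)
  \<comment> \<open>For \<mu> \<ge> 2 this holds for any power of |T|; the sign argument is needed
    for \<mu> = 1.\<close>
  have par: "odd v \<or> 4 dvd v"
  proof (cases "\<mu> = 1")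
    case True
    then show ?thesis using odd_or_4_dvd[OF reg[OF T_in]] v by simp
  next
    case False
    then have "ca ^ 2 dvd v" unfolding v using \<mu>(1) by (intro le_imp_power_dvd) simp
    moreover have "4 dvd ca ^ 2" if "even ca"
    proof -
      obtain c where "ca = 2 * c" using \<open>even ca\<close> by (rule evenE)
      then show ?thesis by (simp add: power2_eq_square)
    qed
    moreover have "odd v" if "odd ca" unfolding v using that by simp
    ultimately show ?thesis by (meson dvd_trans)
  qed
  define Y where "Y = k * (k - 1) * (k - 2)"
  have Y0: "Y > 0" using k4 by (simp add: Y_def)
  have evY: "even Y" unfolding Y_def using k4 by auto
  have v3: "v \<ge> 3" using kv by simp
  have "(v - 1) * (v - 2) dvd Y * (e * h)"
  proof -
    obtain w where w: "v * d = card \<B> * w" using bvd by (rule dvdE)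
    have "v * (Y * d) = Y * (v * d)" by (simp only: mult.left_commute)
    also have "\<dots> = (card \<B> * Y) * w" unfolding w by (simp only: mult_ac)
    also have "card \<B> * Y = v * (v - 1) * (v - 2)" unfolding Y_def by (rule card_blocks)
    finally have "v * (Y * d) = v * ((v - 1) * (v - 2) * w)" by (simp only: mult.assoc)
    then have "Y * d = (v - 1) * (v - 2) * w" using v3 by simp
    then show ?thesis using de unfolding e_def by (metis dvd_triv_left)
  qed
  then have le1: "(v - 1) * (v - 2) \<le> Y * e" by (rule cancel_coprime_factor[OF _ hv evY Y0 e0 v3 par])
  have hr: "h * rep \<le> k * d"
  proof -
    have "(k - 1) * (k - 2) * rep = (k - 2) * ((k - 1) * rep)" by (simp only: mult_ac)
    also have "\<dots> = (v - 1) * ((k - 2) * lam)" unfolding rep_mult by (simp only: mult_ac)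
    also have "\<dots> = (v - 1) * (v - 2)" unfolding lam_mult by (rule refl)
    finally have r: "(k - 1) * (k - 2) * rep = (v - 1) * (v - 2)" .
    have "((k - 1) * (k - 2)) * (h * rep) = h * ((k - 1) * (k - 2) * rep)" by (simp only: mult_ac)
    also have "\<dots> \<le> h * (Y * e)" unfolding r using le1 by (rule mult_le_mono2)
    also have "\<dots> = ((k - 1) * (k - 2)) * (k * d)" unfolding de e_def[symmetric] Y_def by (simp only: mult_ac)
    finally show ?thesis using k4 by simp
  qed
  \<comment> \<open>An element of \<open>G\<^sub>\<alpha>\<close> carries x\<alpha> to the image of
    \<alpha> under a conjugate of x, a nontrivial element of some factor.\<close>
  have dm: "d \<le> card \<T> * (ca - 1)"
  proof -
    have sub: "O' \<subseteq> (\<Union>A\<in>\<T>. (\<lambda>t. act t \<alpha>) ` (A - {\<one>}))"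
    proof
      fix y assume "y \<in> O'"
      then obtain g where g: "g \<in> stab \<alpha>" "y = act g \<beta>" unfolding O'_def by (rule imageE)
      note gG = stabG[OF g(1)]
      have "y = act (cj g x) \<alpha>" using act_cj_fix[OF gG(1) xG \<alpha> gG(2)] g(2) by (simp add: \<beta>_def)
      moreover have "cj g x \<in> cj g ` T - {\<one>}" using x(1) x1 gG(1) xG by (metis DiffI cj_eq_iff cj_one_right imageI one_closed singletonD)
      ultimately have "y \<in> (\<lambda>t. act t \<alpha>) ` (cj g ` T - {\<one>})" by (rule_tac rev_image_eqI)
      then show "y \<in> (\<Union>A\<in>\<T>. (\<lambda>t. act t \<alpha>) ` (A - {\<one>}))" by (rule UN_I[OF TT_cj[OF T_in gG(1)]])
    qed
    have finA: "finite A" if "A \<in> \<T>" for A using TTN[OF that] finN by (meson finite_subset subsetI)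
    have "d \<le> card (\<Union>A\<in>\<T>. (\<lambda>t. act t \<alpha>) ` (A - {\<one>}))"
      unfolding d_def using fin\<T> finA by (intro card_mono[OF _ sub]) auto
    also have "\<dots> \<le> (\<Sum>A\<in>\<T>. card ((\<lambda>t. act t \<alpha>) ` (A - {\<one>})))" by (rule card_UN_le[OF fin\<T>])
    also have "\<dots> \<le> (\<Sum>A\<in>\<T>. ca - 1)"
    proof (rule sum_mono)
      fix A assume A: "A \<in> \<T>"
      have "card ((\<lambda>t. act t \<alpha>) ` (A - {\<one>})) \<le> card (A - {\<one>})" using finA[OF A] by (intro card_image_le) simp
      also have "\<dots> = ca - 1" using TT_one[OF A] card_TT[OF A] by simp
      finally show "card ((\<lambda>t. act t \<alpha>) ` (A - {\<one>})) \<le> ca - 1" .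
    qed
    finally show ?thesis by simp
  qed
  show False
  proof (cases "\<mu> = 1")
    case False
    then have \<mu>2: "\<mu> \<ge> 2" using \<mu>(1) by simp
    have "h * (v - 1) \<le> h * rep" using rep_ge by simp
    also have "\<dots> \<le> k * d" by (rule hr)
    also have "\<dots> \<le> k * (card \<T> * (ca - 1))" using dm by simp
    finally show False by (rule no_semiregular_parameters[OF h4 ca12 \<mu>2 \<mu>(2) v k4 lam_mult lam_ge])
  next
    case True
    have vca: "h * f = v" using v True hf by simp
    \<comment> \<open>There may be two factors here, so \<open>dm\<close> could lose a factor 2
      against this trivial bound.\<close>
    have "d \<le> card (P - {\<alpha>})"
    proof -
      have "O' \<subseteq> P - {\<alpha>}"
      proof
        fix y assume y: "y \<in> O'"
        then obtain g where g: "g \<in> stab \<alpha>" "y = act g \<beta>" unfolding O'_def by (rule imageE)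
        have "act g \<beta> \<noteq> act g \<alpha>" using act_eq_iff[OF stabG(1)[OF g(1)] bP(1) \<alpha>] ab by metis
        then show "y \<in> P - {\<alpha>}" using y OP g stabG[OF g(1)] by auto
      qed
      then show ?thesis unfolding d_def using finite_P by (intro card_mono) auto
    qed
    then have dv: "d \<le> v - 1" using \<alpha> cardP by simp
    have le: "h * rep \<le> k * (v - 1)" using hr mult_le_mono2[OF dv, of k] by linarith
    \<comment> \<open>This g fixes \<alpha> and acts on T like x, so it fixes t\<alpha> for all f
      elements t of the centralizer of x. It is not an involution since
      \<open>x^2 \<noteq> 1\<close>, and the bound on fixed points applies.\<close>
    obtain g where g: "g \<in> stab \<alpha>" "\<forall>y\<in>T. cj g y = cj x y" using inner[OF x(1)] by auto
    note gG = stabG[OF g(1)]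
    have "\<exists>y\<in>P. act g (act g y) \<noteq> y"
    proof (rule ccontr)
      assume "\<not> ?thesis"
      then have "act (g \<otimes> g) y = y" if "y \<in> P" for y using that gG act_mult by auto
      then have gg: "g \<otimes> g = \<one>" using faithful[of "g \<otimes> g"] gG by simp
      have "x \<otimes> x = \<one>"
      proof (rule TT_center[OF T_in T_m[OF x(1) x(1)]])
        fix y assume y: "y \<in> T"
        have "cj (x \<otimes> x) y = cj x (cj x y)" using xG y TG by (simp add: cj_cj)
        also have "\<dots> = cj g (cj g y)" using g(2) y T_cj x(1) by simp
        also have "\<dots> = y" using gg gG y TG by (simp add: cj_cj)
        finally show "x \<otimes> x \<otimes> y = y \<otimes> (x \<otimes> x)" using cj_eq_self_iff[of "x \<otimes> x" y] xG TG y by simp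
      qed
      then show False using x(2) by simp
    qed
    then obtain y where y: "y \<in> P" "act g (act g y) \<noteq> y" by blast
    have "card {z \<in> P. act g z = z} \<le> lam + 1"
      by (rule card_fixed_points_le[OF act_bij[OF gG(1)] act_block[OF gG(1)] y])
    moreover have "f \<le> card {z \<in> P. act g z = z}"
      unfolding f_def
    proof (rule card_inj_on_le[of "\<lambda>t. act t \<alpha>"])
      have CTT: "t \<in> T" if "t \<in> CT" for t using that by (simp add: CT_def)
      show "inj_on (\<lambda>t. act t \<alpha>) CT" using regT[OF _ _ \<alpha>] CTT by (intro inj_onI) blast
      show "(\<lambda>t. act t \<alpha>) ` CT \<subseteq> {z \<in> P. act g z = z}"
      proof (rule image_subsetI)
        fix t assume t: "t \<in> CT"
        have tG: "t \<in> carrier G" using t CTT TG by blast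
        have "act g (act t \<alpha>) = act (cj g t) \<alpha>" using act_cj_fix[OF gG(1) tG \<alpha> gG(2)] by simp
        also have "cj g t = cj x t" using g(2) CTT[OF t] by simp
        also have "cj x t = t" using cj_eq_self_iff[OF xG tG] t by (simp add: CT_def)
        finally show "act t \<alpha> \<in> {z \<in> P. act g z = z}" using act_in tG \<alpha> by simp
      qed
      show "finite {z \<in> P. act g z = z}" using finite_P by simp
    qed
    ultimately have "f \<le> lam + 1" by simp
    then show False
      by (rule no_regular_parameters[OF h4 f3 vca k4 _ lam_mult lam_ge rep_mult flag_count le])
  qed
qed


text \<open>The centralizer C of N is normal in G, hence transitive, so N is regular and v = |N|.
  For t in T some z in C brings t\<alpha> back to \<alpha>; then z t fixes \<alpha> and acts on N as
  t does.\<close>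

lemma no_nontrivial_centralizer:
  assumes c: "c \<in> carrier G" "\<And>n. n \<in> N \<Longrightarrow> c \<otimes> n = n \<otimes> c" "c \<noteq> \<one>"
  shows False
proof -
  let ?C = "{g \<in> carrier G. \<forall>n\<in>N. g \<otimes> n = n \<otimes> g}"
  have sC: "subgroup ?C G" using NG by (intro subgroup_centralizer) auto
  have "cj g z \<in> ?C" if g: "g \<in> carrier G" and z: "z \<in> ?C" for g z
  proof -
    have zG: "z \<in> carrier G" using z by simp
    have "cj g z \<otimes> n = n \<otimes> cj g z" if n: "n \<in> N" for n
    proof -
      have n': "cj (inv g) n \<in> N" using cjN g n by simp
      have "z \<otimes> cj (inv g) n = cj (inv g) n \<otimes> z" using z n' by simp
      then have "cj g z \<otimes> cj g (cj (inv g) n) = cj g (cj (inv g) n) \<otimes> cj g z"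
        using commute_cj[of g z "cj (inv g) n"] g zG NG[OF n'] by (simp del: cj_inv_cancel2)
      then show ?thesis using g NG[OF n] by simp
    qed
    then show ?thesis using g zG by simp
  qed
  then have nC: "nrm (carrier G) ?C" using sC by (simp add: nrm_def)
  have "c \<in> ?C" using c by simp
  then have C1: "?C \<noteq> {\<one>}" using c(3) by blast
  have Nreg: "n = \<one>" if n: "n \<in> N" "x \<in> P" "act n x = x" for n x
  proof (rule centralizer_semiregular[OF nC C1 NG[OF n(1)] _ n(2,3)])
    show "n \<otimes> m = m \<otimes> n" if "m \<in> ?C" for m using that n(1) by simp
  qed
  have "Na \<subseteq> {\<one>}" using Nreg[OF _ \<alpha>] by (auto simp: Na_def)
  then have "Na = {\<one>}" using subgroup.one_closed[OF Na_subgroup] by auto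
  then have v: "v = ca ^ card \<T>" using card_N_orbit card_N cardP by simp
  have m1: "card \<T> \<ge> 1" using T_in fin\<T> by (metis One_nat_def Suc_leI card_gt_0_iff empty_iff)
  show False
  proof (rule no_semiregular_factor[OF _ v m1])
    show "t = \<one>" if "A \<in> \<T>" "t \<in> A" "x \<in> P" "act t x = x" for A t x
      using Nreg[OF TTN[OF that(1,2)] that(3,4)] .
    fix t assume t: "t \<in> T"
    have tN: "t \<in> N" using t TN by blast
    have tG: "t \<in> carrier G" using NG tN by blast
    obtain z where z: "z \<in> ?C" "act z (act t \<alpha>) = \<alpha>"
      using normal_transitive[OF nC C1 act_in[OF tG \<alpha>] \<alpha>] by (rule bexE)
    have zG: "z \<in> carrier G" using z(1) by simp
    have "z \<otimes> t \<in> stab \<alpha>" using z(2) zG tG \<alpha> by (simp add: stab_def act_mult)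
    moreover have e: "cj (z \<otimes> t) y = cj t y" if y: "y \<in> N" for y
    proof -
      have yc: "cj t y \<in> N" using cjN[OF tG y] .
      have "cj (z \<otimes> t) y = cj z (cj t y)" using zG tG NG[OF y] by (simp add: cj_cj)
      also have "\<dots> = cj t y" using cj_eq_self_iff[OF zG NG[OF yc]] z(1) yc by simp
      finally show ?thesis .
    qed
    moreover have "\<forall>y\<in>T. cj (z \<otimes> t) y = cj t y" using e TN by blast
    ultimately show "\<exists>g\<in>stab \<alpha>. (\<exists>n\<in>N. \<forall>y\<in>N. cj g y = cj n y) \<and> (\<forall>y\<in>T. cj g y = cj t y)"
      using tN by blast
  qed simp
qed

text \<open>The index of \<open>N\<^sub>\<alpha>\<close> in N is |T| to the power
  \<open>card \<T> - l\<close>, and \<open>2 * l \<le> card \<T>\<close> bounds the number of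
  factors by twice this exponent.\<close>

lemma no_diagonal:
  assumes m2: "card \<T> \<ge> 2" and surj: "\<And>A. A \<in> \<T> \<Longrightarrow> pr A ` Na = A"
  shows False
proof -
  obtain l where l: "card Na = ca ^ l" "2 * l \<le> card \<T>" using card_Na_power[OF surj] by blast
  define \<mu> where "\<mu> = card \<T> - l"
  have ca0: "ca > 0"
  proof -
    have "finite T" using finN TN finite_subset by blast
    then show ?thesis unfolding ca_def using TT_one[OF T_in] by (metis card_gt_0_iff empty_iff)
  qed
  have "card \<T> = \<mu> + l" using l(2) by (simp add: \<mu>_def)
  then have "ca ^ \<mu> * ca ^ l = v * ca ^ l" using card_N_orbit card_N cardP l(1) by (simp add: power_add)
  then have v: "v = ca ^ \<mu>" using ca0 by simp
  show False
  proof (rule no_semiregular_factor[OF _ v])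
    show "t = \<one>" if "A \<in> \<T>" "t \<in> A" "x \<in> P" "act t x = x" for A t x
      using semiregular_if_surj[OF surj that] .
    show "1 \<le> \<mu>" "card \<T> \<le> 2 * \<mu>" using l(2) m2 by (auto simp: \<mu>_def)
    fix t assume t: "t \<in> T"
    then have "t \<in> pr T ` Na" using surj[OF T_in] by simp
    then obtain n where n: "n \<in> Na" "t = pr T n" by (rule imageE)
    have nN: "n \<in> N" using n(1) by (simp add: Na_def)
    have "n \<in> stab \<alpha>" using n(1) NG by (simp add: Na_def stab_def)
    moreover have "\<forall>y\<in>T. cj n y = cj t y" using pr_cj[OF T_in nN] n(2) by simp
    ultimately show "\<exists>g\<in>stab \<alpha>. (\<exists>n\<in>N. \<forall>y\<in>N. cj g y = cj n y) \<and> (\<forall>y\<in>T. cj g y = cj t y)"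
      using nN by blast
  qed
qed

text \<open>The orbits of the factors are the lines of the cartesian structure. As
  \<open>N\<^sub>\<alpha>\<close> contains the components of its elements, it is the product of its
  intersections with the factors, which gives \<open>v = n^m\<close> and lets lines in different
  directions meet only once.\<close>

lemma no_product:
  assumes m2: "card \<T> \<ge> 2"
    and prod: "\<And>n. n \<in> N \<Longrightarrow> (\<And>A. A \<in> \<T> \<Longrightarrow> pr A n \<in> pr A ` Na) \<Longrightarrow> n \<in> Na"
  shows False
proof -
  have NaN: "n \<in> N" if "n \<in> Na" for n using that by (simp add: Na_def)
  have prNa: "pr A n \<in> Na" if A: "A \<in> \<T>" and n: "n \<in> Na" for A n
  proof (rule prod)
    note pA = pr_in[OF A NaN[OF n]]
    show "pr A n \<in> N" using TTN[OF A pA] .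
    fix B assume B: "B \<in> \<T>"
    show "pr B (pr A n) \<in> pr B ` Na"
    proof (cases "B = A")
      case True
      then show ?thesis using pr_self[OF A pA] n by simp
    next
      case False
      then have "pr B (pr A n) = pr B \<one>" using pr_other[OF B A False pA] pr_one[OF B] by simp
      then show ?thesis using subgroup.one_closed[OF Na_subgroup] by (simp only: imageI)
    qed
  qed
  define cls where "cls A x = (\<lambda>t. act t x) ` A" for A x
  have cls_act: "act g ` cls A x = cls (cj g ` A) (act g x)" if g: "g \<in> carrier G" and A: "A \<in> \<T>" and x: "x \<in> P" for g A x
  proof -
    have "act g ` cls A x = (\<lambda>t. act g (act t x)) ` A" by (simp add: cls_def image_image)
    also have "\<dots> = (\<lambda>t. act (cj g t) (act g x)) ` A"
      using act_cj[OF g TTG[OF A] x] by (intro image_cong refl) simp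
    finally show ?thesis by (simp add: cls_def image_image)
  qed
  have cjA: "cj m ` A = A" if m: "m \<in> N" and A: "A \<in> \<T>" for m A
  proof (intro equalityI subsetI)
    show "y \<in> A" if "y \<in> cj m ` A" for y using that cj_N_TT[OF A m] by auto
    show "y \<in> cj m ` A" if y: "y \<in> A" for y
    proof (rule image_eqI)
      show "y = cj m (cj (inv m) y)" using NG[OF m] TTG[OF A y] by simp
      show "cj (inv m) y \<in> A" using cj_N_TT[OF A N_inv[OF m] y] .
    qed
  qed
  define n where "n = card (cls T \<alpha>)"
  have clsP: "cls A x \<subseteq> P" if "A \<in> \<T>" "x \<in> P" for A x
    using that act_in TTG by (auto simp: cls_def)
  have card_cls: "card (cls A x) = n" if A: "A \<in> \<T>" and x: "x \<in> P" for A x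
  proof -
    have ci: "card (act g ` cls B y) = card (cls B y)" if "g \<in> carrier G" "B \<in> \<T>" "y \<in> P" for g B y
      using act_inj[OF that(1)] clsP[OF that(2,3)] by (meson card_image inj_on_subset)
    obtain g where g: "g \<in> carrier G" "cj g ` T = A" using TT_transitive[OF T_in A] .
    have gaP: "act g \<alpha> \<in> P" using act_in[OF g(1) \<alpha>] .
    obtain m where m: "m \<in> N" "act m (act g \<alpha>) = x" using N_trans[OF gaP x] by (rule bexE)
    have "cls A x = act m ` cls A (act g \<alpha>)" using cls_act[OF NG[OF m(1)] A gaP] cjA[OF m(1) A] m(2) by simp
    also have "card \<dots> = card (cls A (act g \<alpha>))" using ci[OF NG[OF m(1)] A gaP] .
    also have "cls A (act g \<alpha>) = act g ` cls T \<alpha>" using cls_act[OF g(1) T_in \<alpha>] g(2) by simp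
    also have "card \<dots> = n" using ci[OF g(1) T_in \<alpha>] by (simp add: n_def)
    finally show ?thesis .
  qed
  have self: "x \<in> cls A x" if "A \<in> \<T>" "x \<in> P" for A x
    unfolding cls_def using act_one[OF that(2)] TT_one[OF that(1)] by (rule_tac image_eqI[of _ _ \<one>]) auto
  have cls_eq: "cls A y = cls A x" if A: "A \<in> \<T>" and x: "x \<in> P" and y: "y \<in> cls A x" for A x y
  proof -
    obtain t where t: "t \<in> A" "y = act t x" using y unfolding cls_def by (rule imageE)
    have tG: "t \<in> carrier G" using TTG[OF A t(1)] .
    have sub: "cls A y \<subseteq> cls A x"
    proof
      fix z assume "z \<in> cls A y"
      then obtain s where s: "s \<in> A" "z = act s y" unfolding cls_def by (rule imageE)
      have "z = act (s \<otimes> t) x" using s t tG TTG[OF A] x by (simp add: act_mult)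
      then show "z \<in> cls A x" using TT_mult[OF A s(1) t(1)] unfolding cls_def by (rule image_eqI)
    qed
    have yP: "y \<in> P" using t act_in tG x by simp
    have "finite (cls A x)" using clsP[OF A x] finite_P finite_subset by blast
    then show ?thesis using sub card_cls[OF A x] card_cls[OF A yP] by (metis card_subset_eq)
  qed
  \<comment> \<open>The element \<open>a^-1 b\<close> fixes \<alpha> and has A-component
    \<open>a^-1\<close>, which must fix \<alpha> as well.\<close>
  have int\<alpha>: "act a \<alpha> = \<alpha>" if AB: "A \<in> \<T>" "B \<in> \<T>" "A \<noteq> B" and a: "a \<in> A" and b: "b \<in> B" and e: "act a \<alpha> = act b \<alpha>" for A B a b
  proof -
    have G: "a \<in> carrier G" "b \<in> carrier G" using TTG AB a b by auto
    have iab: "inv a \<otimes> b \<in> Na"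
      using act_eq_act_iff[OF G \<alpha>] e N_mult N_inv TTN AB a b by (simp add: Na_def)
    have "pr A (inv a \<otimes> b) = inv a"
      using pr_mult[OF AB(1) N_inv[OF TTN[OF AB(1) a]] TTN[OF AB(2) b]] pr_self[OF AB(1) TT_inv[OF AB(1) a]]
        pr_other[OF AB b] G by simp
    then have "inv a \<in> Na" using prNa[OF AB(1) iab] by simp
    then show ?thesis using G \<alpha> act_inv_eq_iff[of a \<alpha> \<alpha>] by (simp add: Na_def)
  qed
  have cls_int: "y = x" if AB: "A \<in> \<T>" "B \<in> \<T>" and x: "x \<in> P" and ne: "A \<noteq> B" and y: "y \<in> cls A x" "y \<in> cls B x" for A B x y
  proof -
    obtain a where a: "a \<in> A" "y = act a x" using y(1) unfolding cls_def by (rule imageE)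
    obtain b where b: "b \<in> B" "y = act b x" using y(2) unfolding cls_def by (rule imageE)
    obtain m where m: "m \<in> N" "act m x = \<alpha>" using N_trans[OF x \<alpha>] by (rule bexE)
    have G: "a \<in> carrier G" "b \<in> carrier G" "m \<in> carrier G" using TTG AB a b NG m by auto
    have "act (cj m a) \<alpha> = act m y" "act (cj m b) \<alpha> = act m y"
      using act_cj[OF G(3) G(1) x] act_cj[OF G(3) G(2) x] m a b by simp_all
    then have "act (cj m a) \<alpha> = \<alpha>"
      using int\<alpha>[OF AB ne cj_N_TT[OF AB(1) m(1) a(1)] cj_N_TT[OF AB(2) m(1) b(1)]] by simp
    then have "act m y = act m x" using \<open>act (cj m a) \<alpha> = act m y\<close> m(2) by simp
    moreover have "y \<in> P" using a act_in G x by simp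
    ultimately show ?thesis using act_eq_iff[OF G(3)] x by metis
  qed
  define \<rho> where "\<rho> = card {t \<in> T. act t \<alpha> = \<alpha>}"
  have orb: "ca = n * card {t \<in> A. act t \<alpha> = \<alpha>}" if A: "A \<in> \<T>" for A
    using orbit_stabilizer[OF TT_sub[OF A] \<alpha>] card_TT[OF A] card_cls[OF A \<alpha>] by (simp add: cls_def)
  have n0: "n > 0"
  proof -
    have "finite (cls T \<alpha>)" using clsP[OF T_in \<alpha>] finite_P finite_subset by blast
    then show ?thesis unfolding n_def using self[OF T_in \<alpha>] by (metis card_gt_0_iff empty_iff)
  qed
  have \<rho>A: "card {t \<in> A. act t \<alpha> = \<alpha>} = \<rho>" if A: "A \<in> \<T>" for A
  proof -
    have "n * card {t \<in> A. act t \<alpha> = \<alpha>} = n * \<rho>"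
      by (simp only: \<rho>_def orb[OF A, symmetric] orb[OF T_in, symmetric])
    then show ?thesis using n0 by simp
  qed
  have sub: "subgroup (Na \<inter> Cs S) G" if "S \<subseteq> \<T>" for S
    using that by (intro subgroups_Inter_pair Na_subgroup Cs_subgroup)
  have key: "card (Na \<inter> Cs S) = \<rho> ^ card (\<T> - S)" if "S \<subseteq> \<T>" for S
    using that
  proof (induction "card (\<T> - S)" arbitrary: S)
    case 0
    then have "S = \<T>" using fin\<T> by (metis Diff_eq_empty_iff card_0_eq finite_Diff subset_antisym)
    then show ?case using Cs_all subgroup.one_closed[OF Na_subgroup] by simp
  next
    case (Suc j)
    then obtain A where A: "A \<in> \<T>" "A \<notin> S" by (metis Diff_eq_empty_iff card.empty nat.simps(3) subsetI)
    have "\<T> - insert A S = (\<T> - S) - {A}" by blast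
    then have j: "card (\<T> - insert A S) = j" using Suc.hyps(2) A fin\<T> by simp
    have "card (Na \<inter> Cs S) = card (pr A ` (Na \<inter> Cs S)) * card {n \<in> Na \<inter> Cs S. pr A n = \<one>}"
      using A(1) sub[OF Suc.prems] NaN by (intro card_pr) auto
    also have "pr A ` (Na \<inter> Cs S) = {t \<in> A. act t \<alpha> = \<alpha>}"
    proof (intro equalityI subsetI)
      fix y assume "y \<in> pr A ` (Na \<inter> Cs S)"
      then obtain m where m: "m \<in> Na \<inter> Cs S" "y = pr A m" by (rule imageE)
      have "y \<in> Na" using prNa[OF A(1)] m by simp
      then show "y \<in> {t \<in> A. act t \<alpha> = \<alpha>}" using pr_in[OF A(1) NaN] m by (simp add: Na_def)
    next
      fix y assume y: "y \<in> {t \<in> A. act t \<alpha> = \<alpha>}"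
      have "pr B y = \<one>" if "B \<in> S" for B using pr_other[of B A y] A Suc.prems y that by auto
      then have "y \<in> Na \<inter> Cs S" using y TTN[OF A(1)] by (simp add: Cs_def Na_def)
      moreover have "y = pr A y" using pr_self[OF A(1)] y by simp
      ultimately show "y \<in> pr A ` (Na \<inter> Cs S)" by (rule_tac image_eqI)
    qed
    also have "{n \<in> Na \<inter> Cs S. pr A n = \<one>} = Na \<inter> Cs (insert A S)" by (auto simp: Cs_def)
    also have "card (Na \<inter> Cs (insert A S)) = \<rho> ^ j" using Suc.hyps(1)[of "insert A S"] j A Suc.prems by simp
    finally show ?case using Suc.hyps(2) \<rho>A[OF A(1)] by (metis power_Suc)
  qed
  have "Na \<inter> Cs {} = Na" using NaN by (auto simp: Cs_def)
  then have cNa: "card Na = \<rho> ^ card \<T>" using key[of "{}"] by simp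
  have \<rho>0: "\<rho> > 0"
  proof -
    have "finite {t \<in> T. act t \<alpha> = \<alpha>}" by (rule finite_subset[OF _ finN]) (use TN in auto)
    moreover have "\<one> \<in> {t \<in> T. act t \<alpha> = \<alpha>}" using TT_one[OF T_in] act_one[OF \<alpha>] by simp
    ultimately show ?thesis unfolding \<rho>_def by (metis card_gt_0_iff empty_iff)
  qed
  have "n ^ card \<T> * \<rho> ^ card \<T> = v * \<rho> ^ card \<T>"
    using card_N_orbit card_N cardP cNa orb[OF T_in] by (simp add: \<rho>_def power_mult_distrib)
  then have v: "v = n ^ card \<T>" using \<rho>0 by simp
  \<comment> \<open>On lines with at most two points every t in T would act with trivial
    square.\<close>
  have n3: "n \<ge> 3"
  proof (rule ccontr)
    assume "\<not> n \<ge> 3"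
    then have n2: "n \<le> 2" by simp
    have "act t (act t x) = x" if t: "t \<in> T" and x: "x \<in> P" for t x
    proof (rule ccontr)
      assume ne: "act t (act t x) \<noteq> x"
      have tG: "t \<in> carrier G" using TTG[OF T_in t] .
      have txP: "act t x \<in> P" using act_in[OF tG x] .
      have ne2: "act t x \<noteq> x" using ne by auto
      then have ne3: "act t (act t x) \<noteq> act t x" using act_eq_iff[OF tG txP x] by simp
      have "act (t \<otimes> t) x = act t (act t x)" using act_mult[OF tG tG x] .
      then have "{x, act t x, act t (act t x)} \<subseteq> cls T x"
        using self[OF T_in x] t TT_mult[OF T_in t t] unfolding cls_def by (auto intro: image_eqI[of _ _ "t \<otimes> t"])
      moreover have "finite (cls T x)" using clsP[OF T_in x] finite_P finite_subset by blast
      ultimately have "card {x, act t x, act t (act t x)} \<le> n" using card_mono card_cls[OF T_in x] by metis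
      then show False using ne ne2 ne3 n2 by (simp add: card_insert_if split: if_splits)
    qed
    then have "t \<otimes> t = \<one>" if "t \<in> T" for t
      using faithful[of "t \<otimes> t"] act_mult[of t t] TTG[OF T_in that] that by simp
    then show False using ex_nonelementary by blast
  qed
  show False
  proof (rule no_invariant_cartesian_decomposition[where H = "act ` carrier G" and I = \<T> and cls = cls, OF _ _ fin\<T> refl m2 n3 v])
    show "\<exists>g\<in>act ` carrier G. g ` B = C" if "B \<in> \<B>" "C \<in> \<B>" for B C using block_trans'[OF that] .
    show "bij_betw g P P" if "g \<in> act ` carrier G" for g using that act_bij by auto
    show "cls A x \<subseteq> P \<and> x \<in> cls A x \<and> card (cls A x) = n" if "A \<in> \<T>" "x \<in> P" for A x
      using clsP[OF that] self[OF that] card_cls[OF that] by simp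
    show "cls A y = cls A x" if "A \<in> \<T>" "x \<in> P" "y \<in> cls A x" for A x y using cls_eq[OF that] .
    show "y = x" if "A \<in> \<T>" "B \<in> \<T>" "x \<in> P" "A \<noteq> B" "y \<in> cls A x" "y \<in> cls B x" for A B x y using cls_int[OF that] .
    fix g' assume "g' \<in> act ` carrier G"
    then obtain g where g: "g \<in> carrier G" "g' = act g" by (rule_tac imageE)
    have "inj_on ((`) (cj g)) \<T>"
    proof (rule inj_onI)
      fix A B assume AB: "A \<in> \<T>" "B \<in> \<T>" "cj g ` A = cj g ` B"
      have inj: "inj_on (cj g) (carrier G)" using g(1) by (intro inj_onI) simp
      have "A \<subseteq> carrier G" "B \<subseteq> carrier G" using TTG AB by auto
      then show "A = B" using inj_on_image_eq_iff[OF inj] AB(3) by blast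
    qed
    moreover have "\<forall>A\<in>\<T>. cj g ` A \<in> \<T> \<and> (\<forall>x\<in>P. g' ` cls A x = cls (cj g ` A) (g' x))"
      using TT_cj g cls_act by simp
    ultimately show "\<exists>\<sigma>. inj_on \<sigma> \<T> \<and> (\<forall>A\<in>\<T>. \<sigma> A \<in> \<T> \<and> (\<forall>x\<in>P. g' ` cls A x = cls (\<sigma> A) (g' x)))"
      by (rule_tac exI[of _ "(`) (cj g)"]) (rule conjI)
  qed
qed

lemma socle_simple:
  "N = T" "\<And>c. c \<in> carrier G \<Longrightarrow> (\<And>n. n \<in> N \<Longrightarrow> c \<otimes> n = n \<otimes> c) \<Longrightarrow> c = \<one>"
proof -
  have "\<not> card \<T> \<ge> 2"
  proof
    assume m2: "card \<T> \<ge> 2"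
    show False using projection_dichotomy
    proof
      assume "\<forall>n\<in>N. (\<forall>A\<in>\<T>. pr A n \<in> pr A ` Na) \<longrightarrow> n \<in> Na"
      then show False using no_product[OF m2] by blast
    next
      assume "\<forall>A\<in>\<T>. pr A ` Na = A"
      then show False using no_diagonal[OF m2] by blast
    qed
  qed
  then have "\<T> = {T}" using T_in fin\<T>
    by (metis One_nat_def Suc_1 Suc_leI card_1_singletonE card_gt_0_iff empty_iff le_antisym not_less_eq_eq singletonD)
  then have "N \<subseteq> T" by (intro N_subset[OF subT]) auto
  then show "N = T" using TN by blast
  show "c = \<one>" if "c \<in> carrier G" "\<And>n. n \<in> N \<Longrightarrow> c \<otimes> n = n \<otimes> c" for c
    using no_nontrivial_centralizer that by blast
qed

end

section \<open>Almost simple and affine groups\<close>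

text \<open>Conjugation embeds G into the automorphism group of N because \<open>cent\<close> makes
  the kernel trivial; the elements of N give all inner automorphisms.\<close>

lemma almost_simple_typeI:
  fixes G :: "'g monoid" (structure)
  assumes "group G" and fin: "finite (carrier G)" and N: "group.nrm G (carrier G) N" "N \<noteq> {\<one>}"
    and simple: "\<And>M. group.nrm G N M \<Longrightarrow> M \<subseteq> N \<Longrightarrow> M = {\<one>} \<or> M = N"
    and nonab: "\<exists>x\<in>N. \<exists>y\<in>N. x \<otimes> y \<noteq> y \<otimes> x"
    and cent: "\<And>c. c \<in> carrier G \<Longrightarrow> (\<And>n. n \<in> N \<Longrightarrow> c \<otimes> n = n \<otimes> c) \<Longrightarrow> c = \<one>"
  shows "almost_simple_type G"
proof -
  interpret group G by fact
  define T where "T = G\<lparr>carrier := N\<rparr>"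
  have sN: "subgroup N G" using N(1) by (rule nrm_subgroup)
  have NG: "n \<in> carrier G" if "n \<in> N" for n using subgroup.mem_carrier[OF sN that] .
  have cT: "carrier T = N" by (simp add: T_def)
  have mT: "x \<otimes>\<^bsub>T\<^esub> y = x \<otimes> y" for x y by (simp add: T_def)
  interpret T: group T unfolding T_def using sN by (rule subgroup.subgroup_is_group) fact
  have invT: "inv\<^bsub>T\<^esub> x = inv x" if "x \<in> N" for x unfolding T_def using m_inv_consistent[OF sN that] .
  have simT: "simple_group T"
  proof
    have "finite N" using fin sN by (meson finite_subset subgroup.subset)
    moreover have "\<one> \<in> N" using subgroup.one_closed[OF sN] .
    ultimately have "card N > 0" "card N \<noteq> 1" using N(2) by (auto simp: card_gt_0_iff card_1_singleton_iff)
    then show "1 < order T" by (simp add: order_def cT)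
    fix H assume H: "H \<lhd> T"
    have HT: "subgroup H T" using H by (simp add: T.normal_inv_iff)
    then have sH: "subgroup H G" unfolding T_def by (rule incl_subgroup[OF sN])
    have HN: "H \<subseteq> N" using subgroup.subset[OF HT] by (simp add: cT)
    have "cj g x \<in> H" if "g \<in> N" "x \<in> H" for g x
    proof -
      have "g \<otimes>\<^bsub>T\<^esub> x \<otimes>\<^bsub>T\<^esub> inv\<^bsub>T\<^esub> g \<in> H" using H that by (simp add: T.normal_inv_iff cT)
      then show ?thesis using invT[OF that(1)] by (simp add: mT cj_def)
    qed
    then have "nrm N H" using sH by (simp add: nrm_def)
    then have "H = {\<one>} \<or> H = N" using simple HN by blast
    then show "H = carrier T \<or> H = {\<one>\<^bsub>T\<^esub>}" unfolding cT by (auto simp: T_def)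
  qed
  have ncomm: "\<not> comm_group T"
  proof
    assume "comm_group T"
    then interpret c: comm_group T .
    have "x \<otimes> y = y \<otimes> x" if "x \<in> N" "y \<in> N" for x y using c.m_comm[of x y] that by (simp add: mT cT)
    then show False using nonab by metis
  qed
  define \<Phi> where "\<Phi> g = (\<lambda>x\<in>N. cj g x)" for g
  have cjN: "cj g x \<in> N" if "g \<in> carrier G" "x \<in> N" for g x using nrm_cj[OF N(1) that] .
  have \<Phi>bij: "\<Phi> g \<in> Bij N" if g: "g \<in> carrier G" for g
  proof -
    have "bij_betw (cj g) N N"
    proof (rule bij_betwI[where g = "cj (inv g)"])
      show "cj g \<in> N \<rightarrow> N" "cj (inv g) \<in> N \<rightarrow> N" using cjN g by auto
      show "cj (inv g) (cj g x) = x" "cj g (cj (inv g) x) = x" if "x \<in> N" for x using g NG[OF that] by auto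
    qed
    then show ?thesis unfolding \<Phi>_def Bij_def by (simp add: bij_betw_restrict_eq)
  qed
  have \<Phi>auto: "\<Phi> g \<in> carrier (AutoGroup T)" if g: "g \<in> carrier G" for g
  proof -
    have "\<Phi> g \<in> hom T T"
      unfolding hom_def cT mT using cjN[OF g] subgroup.m_closed[OF sN] NG g by (auto simp: \<Phi>_def cj_mult)
    then show ?thesis using \<Phi>bij[OF g] by (simp add: AutoGroup_def auto_def cT)
  qed
  have \<Phi>hom: "\<Phi> (g \<otimes> h) = \<Phi> g \<otimes>\<^bsub>AutoGroup T\<^esub> \<Phi> h" if gh: "g \<in> carrier G" "h \<in> carrier G" for g h
  proof -
    have "\<Phi> g \<otimes>\<^bsub>AutoGroup T\<^esub> \<Phi> h = compose N (\<Phi> g) (\<Phi> h)"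
      using \<Phi>bij gh by (simp add: AutoGroup_def BijGroup_def cT)
    also have "\<dots> = \<Phi> (g \<otimes> h)"
      using gh cjN NG by (auto simp: \<Phi>_def compose_def cj_cj fun_eq_iff)
    finally show ?thesis by simp
  qed
  interpret A: group "AutoGroup T" by (rule T.AutoGroup)
  interpret h: group_hom G "AutoGroup T" \<Phi>
    using \<Phi>auto \<Phi>hom by unfold_locales (auto simp: hom_def)
  have sub: "subgroup (\<Phi> ` carrier G) (AutoGroup T)" by (rule h.img_is_subgroup)
  have "inj_on \<Phi> (carrier G)"
  proof (rule inj_onI)
    fix g g' assume gg: "g \<in> carrier G" "g' \<in> carrier G" "\<Phi> g = \<Phi> g'"
    have "inv g \<otimes> g' = \<one>"
    proof (rule cent)
      fix n assume n: "n \<in> N"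
      have "cj g n = cj g' n" using fun_cong[OF gg(3), of n] n by (simp add: \<Phi>_def)
      then have "cj (inv g) (cj g n) = cj (inv g) (cj g' n)" by simp
      then have "cj (inv g \<otimes> g') n = n" using gg NG[OF n] by (simp add: cj_cj)
      then show "inv g \<otimes> g' \<otimes> n = n \<otimes> (inv g \<otimes> g')" using cj_eq_self_iff[of "inv g \<otimes> g'" n] gg NG[OF n] by simp
    qed (use gg in simp)
    then show "g = g'" using gg by (metis inv_closed inv_equality inv_inv)
  qed
  then have "\<Phi> \<in> iso G (AutoGroup T\<lparr>carrier := \<Phi> ` carrier G\<rparr>)"
    using \<Phi>hom by (auto simp: iso_def hom_def bij_betw_def)
  then have iso: "G \<cong> AutoGroup T\<lparr>carrier := \<Phi> ` carrier G\<rparr>" by (rule is_isoI)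
  have "inner_auto T \<subseteq> \<Phi> ` carrier G"
  proof
    fix y assume "y \<in> inner_auto T"
    then obtain t where t: "t \<in> N" "y = (\<lambda>x\<in>N. t \<otimes> x \<otimes> inv\<^bsub>T\<^esub> t)" by (auto simp: inner_auto_def cT mT)
    then have "y = \<Phi> t" using invT by (simp add: \<Phi>_def cj_def)
    then show "y \<in> \<Phi> ` carrier G" using NG t by blast
  qed
  then show ?thesis unfolding almost_simple_type_def using simT ncomm sub iso by blast
qed

section \<open>Coordinates on an elementary abelian group\<close>

context group
begin

text \<open>The linear combination of the vectors \<open>b i\<close> with coefficients
  \<open>x i\<close>, written multiplicatively. Coefficients are natural numbers, so reduction
  modulo p can be postponed.\<close>

primrec pw :: "nat \<Rightarrow> (nat \<Rightarrow> 'a) \<Rightarrow> (nat \<Rightarrow> nat) \<Rightarrow> 'a" where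
  "pw 0 b x = \<one>"
| "pw (Suc d) b x = pw d b x \<otimes> b d [^] x d"

lemma pw_cong: "(\<And>i. i < d \<Longrightarrow> x i = y i) \<Longrightarrow> (\<And>i. i < d \<Longrightarrow> b i = c i) \<Longrightarrow> pw d b x = pw d c y"
  by (induction d) auto

lemma pw_zero: "(\<And>i. i < d \<Longrightarrow> b i \<in> carrier G) \<Longrightarrow> pw d b (\<lambda>i. 0) = \<one>"
  by (induction d) auto

lemma pw_closed: "(\<And>i. i < d \<Longrightarrow> b i \<in> carrier G) \<Longrightarrow> pw d b x \<in> carrier G"
  by (induction d) auto

end

locale elementary_abelian = group G for G (structure) +
  fixes N p
  assumes sN: "subgroup N G" and finN: "finite N" and p: "prime (p :: nat)"
    and ab: "x \<in> N \<Longrightarrow> y \<in> N \<Longrightarrow> x \<otimes> y = y \<otimes> x"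
    and ex: "x \<in> N \<Longrightarrow> x [^] p = \<one>"
begin

lemma NG: "x \<in> N \<Longrightarrow> x \<in> carrier G" using sN by (rule subgroup.mem_carrier)

lemma N_m: "x \<in> N \<Longrightarrow> y \<in> N \<Longrightarrow> x \<otimes> y \<in> N" using sN by (rule subgroup.m_closed)

lemma N_pow: "x \<in> N \<Longrightarrow> x [^] (n::nat) \<in> N"
  by (induction n) (use subgroup.one_closed[OF sN] N_m in auto)

lemma pow_mod: "x \<in> N \<Longrightarrow> x [^] (n mod p) = x [^] n"
proof -
  assume x: "x \<in> N"
  have "x [^] n = x [^] (p * (n div p) + n mod p)" by simp
  also have "\<dots> = (x [^] p) [^] (n div p) \<otimes> x [^] (n mod p)"
    using NG[OF x] by (simp add: nat_pow_mult nat_pow_pow)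
  also have "\<dots> = x [^] (n mod p)" using ex[OF x] NG[OF x] by simp
  finally show ?thesis by simp
qed

lemma pw_N: "(\<And>i. i < d \<Longrightarrow> b i \<in> N) \<Longrightarrow> pw d b x \<in> N"
  by (induction d) (use subgroup.one_closed[OF sN] N_m N_pow in auto)

lemma pw_add: "(\<And>i. i < d \<Longrightarrow> b i \<in> N) \<Longrightarrow> pw d b (\<lambda>i. x i + y i) = pw d b x \<otimes> pw d b y"
proof (induction d)
  case 0
  then show ?case by simp
next
  case (Suc d)
  have b: "b d \<in> N" using Suc.prems by simp
  have IH: "pw d b (\<lambda>i. x i + y i) = pw d b x \<otimes> pw d b y" using Suc by simp
  have N: "pw d b x \<in> N" "pw d b y \<in> N" using Suc.prems pw_N[of d b] by auto
  have N2: "b d [^] x d \<in> N" "b d [^] y d \<in> N" using N_pow b by auto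
  note G = NG[OF N(1)] NG[OF N(2)] NG[OF N2(1)] NG[OF N2(2)]
  have "pw d b x \<otimes> pw d b y \<otimes> (b d [^] x d \<otimes> b d [^] y d) = pw d b x \<otimes> (pw d b y \<otimes> b d [^] x d) \<otimes> b d [^] y d"
    using G by (simp add: m_assoc)
  also have "\<dots> = pw d b x \<otimes> (b d [^] x d \<otimes> pw d b y) \<otimes> b d [^] y d" using ab[OF N(2) N2(1)] by simp
  also have "\<dots> = (pw d b x \<otimes> b d [^] x d) \<otimes> (pw d b y \<otimes> b d [^] y d)" using G by (simp add: m_assoc)
  finally show ?case using IH NG[OF b] by (simp add: nat_pow_mult[symmetric])
qed

lemma pw_times: "(\<And>i. i < d \<Longrightarrow> b i \<in> N) \<Longrightarrow> pw d b (\<lambda>i. x i * m) = pw d b x [^] m"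
proof (induction m)
  case 0
  then show ?case using pw_zero[of d b] NG by simp
next
  case (Suc m)
  have "pw d b (\<lambda>i. x i * Suc m) = pw d b (\<lambda>i. x i * m + x i)" by (simp add: add.commute)
  also have "\<dots> = pw d b (\<lambda>i. x i * m) \<otimes> pw d b x" using Suc.prems by (rule pw_add)
  finally show ?case using Suc by simp
qed

lemma pw_mod: "(\<And>i. i < d \<Longrightarrow> b i \<in> N) \<Longrightarrow> pw d b (\<lambda>i. x i mod p) = pw d b x"
  by (induction d) (auto simp: pow_mod)

definition V where "V d = fp_space p d"

lemma restrict_V: "(\<lambda>i\<in>{..<d}. x i mod p) \<in> V d"
  using prime_gt_0_nat[OF p] by (auto simp: V_def fp_space_def)

lemma pw_restrict:
  assumes "\<And>i. i < d \<Longrightarrow> b i \<in> N"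
  shows "pw d b (\<lambda>i\<in>{..<d}. x i mod p) = pw d b x"
proof -
  have "pw d b (\<lambda>i\<in>{..<d}. x i mod p) = pw d b (\<lambda>i. x i mod p)" by (rule pw_cong) auto
  then show ?thesis using pw_mod[OF assms] by simp
qed

lemma V_ext: "x \<in> V d \<Longrightarrow> y \<in> V d \<Longrightarrow> (\<And>i. i < d \<Longrightarrow> x i = y i) \<Longrightarrow> x = y"
  unfolding V_def fp_space_def by (rule PiE_ext) auto

lemma card_V: "card (V d) = p ^ d"
  by (simp add: V_def fp_space_def card_PiE)

text \<open>A longest family with injective \<open>pw\<close> spans N: if z were outside the span,
  so would be all \<open>z^e\<close> with 0 < e < p, as e is invertible modulo p, and z could be
  appended. Lengths are bounded by \<open>p^d \<le> card N\<close>.\<close>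

lemma ex_basis:
  "\<exists>d b. (\<forall>i. b i \<in> N) \<and> bij_betw (pw d b) (V d) N"
proof -
  let ?Q = "\<lambda>d. \<exists>b. (\<forall>i. b i \<in> N) \<and> inj_on (pw d b) (V d)"
  have "?Q 0"
    using subgroup.one_closed[OF sN] by (intro exI[of _ "\<lambda>_. \<one>"]) (auto simp: inj_on_def V_def fp_space_def)
  moreover have bound: "d \<le> card N" if Q: "?Q d" for d
  proof -
    obtain b where b: "\<forall>i. b i \<in> N" "inj_on (pw d b) (V d)" using Q by blast
    have "card (V d) \<le> card N" by (rule card_inj_on_le[OF b(2) _ finN]) (use pw_N b(1) in auto)
    moreover have "d < 2 ^ d" by (rule less_exp)
    moreover have "(2::nat) ^ d \<le> p ^ d" using prime_ge_2_nat[OF p] by (rule power_mono) simp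
    ultimately show ?thesis unfolding card_V by linarith
  qed
  ultimately obtain d where d: "?Q d" and dmax: "\<And>e. ?Q e \<Longrightarrow> e \<le> d"
    using GreatestI_nat[of ?Q 0 "card N"] Greatest_le_nat[of ?Q _ "card N"] by blast
  obtain b where b: "\<And>i. b i \<in> N" "inj_on (pw d b) (V d)" using d by blast
  have img: "pw d b x \<in> pw d b ` V d" for x
    using restrict_V[of x d] pw_restrict[of d b x] b(1) by (metis imageI)
  have "N \<subseteq> pw d b ` V d"
  proof (rule ccontr)
    assume "\<not> N \<subseteq> pw d b ` V d"
    then obtain z where z: "z \<in> N" "z \<notin> pw d b ` V d" by blast
    have zG: "z \<in> carrier G" using NG[OF z(1)] .
    let ?b = "b(d := z)"
    have pwb: "pw (Suc d) ?b x = pw d b x \<otimes> z [^] x d" for x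
      using pw_cong[of d x x ?b b] by simp
    have noz: False if e: "0 < e" "e < p" "z [^] e = pw d b x" for e x
    proof -
      have "coprime e p" using e p by (metis coprime_commute dvd_imp_le not_le prime_imp_coprime)
      then obtain c y where "e * c = p * y + 1" using bezout_nat[of e p] e(1) by auto
      then have c: "(e * c) mod p = 1" using prime_gt_1_nat[OF p] mod_mult_self4[of p y 1] by simp
      have "z = z [^] ((e * c) mod p)" using c zG by simp
      also have "\<dots> = z [^] (e * c)" using pow_mod[OF z(1)] .
      also have "\<dots> = (z [^] e) [^] c" using zG by (simp add: nat_pow_pow)
      also have "\<dots> = pw d b (\<lambda>i. x i * c)" using e(3) pw_times[of d b] b(1) by simp
      finally show False using z(2) img by simp
    qed
    have lt: False if xy: "x \<in> V (Suc d)" "y \<in> V (Suc d)" "pw (Suc d) ?b x = pw (Suc d) ?b y" "x d < y d" for x y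
    proof -
      have yp: "y i < p" if "i \<le> d" for i using xy(2) that by (auto simp: V_def fp_space_def PiE_iff)
      have N: "pw d b x \<in> N" "pw d b y \<in> N" using pw_N[of d b] b(1) by auto
      define e where "e = y d - x d"
      have ye: "y d = x d + e" using xy(4) by (simp add: e_def)
      have "pw d b x \<otimes> z [^] x d = pw d b y \<otimes> (z [^] e \<otimes> z [^] x d)"
        using xy(3) zG unfolding pwb ye by (simp add: nat_pow_mult add.commute)
      then have "pw d b x \<otimes> z [^] x d = (pw d b y \<otimes> z [^] e) \<otimes> z [^] x d" using NG N zG by (simp add: m_assoc)
      then have 1: "pw d b x = pw d b y \<otimes> z [^] e" using NG N zG by simp
      \<comment> \<open>Coefficients of the inverse of \<open>pw d b y\<close>, kept among the
        natural numbers.\<close>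
      let ?y = "\<lambda>i. p - y i"
      have "pw d b (\<lambda>i. ?y i + y i) = pw d b (\<lambda>i. p)" using yp by (intro pw_cong) (auto simp: less_imp_le)
      also have "\<dots> = pw d b (\<lambda>i. 0)" using pw_mod[of d b "\<lambda>i. p"] b(1) by simp
      also have "\<dots> = \<one>" using pw_zero[of d b] NG b(1) by simp
      finally have 2: "pw d b ?y \<otimes> pw d b y = \<one>" using pw_add[of d b] b(1) by simp
      have Ny: "pw d b ?y \<in> N" using pw_N[of d b] b(1) by auto
      have "pw d b (\<lambda>i. ?y i + x i) = pw d b ?y \<otimes> (pw d b y \<otimes> z [^] e)" using pw_add[of d b] b(1) 1 by simp
      also have "\<dots> = z [^] e" using 2 NG[OF Ny] NG[OF N(2)] zG by (simp add: m_assoc[symmetric])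
      finally have "z [^] e = pw d b (\<lambda>i. ?y i + x i)" by simp
      moreover have "0 < e" "e < p" using xy(4) yp[of d] by (auto simp: e_def)
      ultimately show False using noz by blast
    qed
    have "inj_on (pw (Suc d) ?b) (V (Suc d))"
    proof (rule inj_onI)
      fix x y assume xy: "x \<in> V (Suc d)" "y \<in> V (Suc d)" "pw (Suc d) ?b x = pw (Suc d) ?b y"
      have xd: "x d = y d" using lt[OF xy] lt[OF xy(2,1) xy(3)[symmetric]] by (metis nat_neq_iff)
      have N: "pw d b x \<in> carrier G" "pw d b y \<in> carrier G" using pw_N[of d b] b(1) NG by auto
      have e: "pw d b x = pw d b y" using xy(3) N zG unfolding pwb xd by simp
      have r: "(\<lambda>i\<in>{..<d}. w i mod p) = (\<lambda>i\<in>{..<d}. w i)" if "w \<in> V (Suc d)" for w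
        using that by (auto simp: V_def fp_space_def PiE_iff fun_eq_iff)
      have "pw d b (\<lambda>i\<in>{..<d}. x i mod p) = pw d b (\<lambda>i\<in>{..<d}. y i mod p)"
        using e pw_restrict[of d b] b(1) by simp
      then have "(\<lambda>i\<in>{..<d}. x i mod p) = (\<lambda>i\<in>{..<d}. y i mod p)" using inj_onD[OF b(2)] restrict_V by blast
      then have eq: "(\<lambda>i\<in>{..<d}. x i) = (\<lambda>i\<in>{..<d}. y i)" using r xy by simp
      show "x = y"
      proof (rule V_ext[OF xy(1,2)])
        fix i assume "i < Suc d"
        then show "x i = y i" using fun_cong[OF eq, of i] xd by (cases "i = d") auto
      qed
    qed
    then have "?Q (Suc d)" using b(1) z(1) by (intro exI[of _ ?b]) auto
    then show False using dmax by fastforce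
  qed
  moreover have "pw d b ` V d \<subseteq> N" using pw_N[of d b] b(1) by auto
  ultimately have "bij_betw (pw d b) (V d) N" using b(2) by (auto simp: bij_betw_def)
  then show ?thesis using b(1) by blast
qed

end

section \<open>Affine type from an abelian minimal normal subgroup\<close>

context prim_action
begin

text \<open>For a prime p dividing |N| the elements with trivial p-th power form a G-invariant
  subgroup of N; it is nontrivial by the Sylow theorem and equals N by minimality.\<close>

lemma abelian_min_normal_exponent:
  assumes min: "min_nrm (carrier G) N" and ab: "\<And>x y. x \<in> N \<Longrightarrow> y \<in> N \<Longrightarrow> x \<otimes> y = y \<otimes> x"
  shows "\<exists>p. prime (p::nat) \<and> (\<forall>n\<in>N. n [^] p = \<one>)"
proof -
  have nN: "nrm (carrier G) N" and N1: "N \<noteq> {\<one>}" using min by (auto simp: min_nrm_def)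
  have sN: "subgroup N G" using nN by (rule nrm_subgroup)
  have NG: "n \<in> carrier G" if "n \<in> N" for n using subgroup.mem_carrier[OF sN that] .
  have finN: "finite N" using finite_G sN by (meson finite_subset subgroup.subset)
  have one: "\<one> \<in> N" using subgroup.one_closed[OF sN] .
  have "card N \<noteq> 1" using one N1 by (auto simp: card_1_singleton_iff)
  then obtain p where p: "prime p" "p dvd card N" using prime_factor_nat by blast
  interpret S: group "G\<lparr>carrier := N\<rparr>" using sN by (rule subgroup.subgroup_is_group) (rule is_group)
  obtain m where m: "card N = p * m" using p(2) by (rule dvdE)
  have "\<exists>H. subgroup H (G\<lparr>carrier := N\<rparr>) \<and> card H = p ^ 1"
    by (rule sylow_thm[OF p(1) S.is_group]) (use m finN in \<open>auto simp: order_def\<close>)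
  then obtain H where H: "subgroup H (G\<lparr>carrier := N\<rparr>)" "card H = p" by auto
  have sH: "subgroup H G" by (rule incl_subgroup[OF sN H(1)])
  have HN: "H \<subseteq> N" using subgroup.subset[OF H(1)] by simp
  have Hp: "n [^] p = \<one>" if n: "n \<in> H" for n
  proof -
    interpret T: group "G\<lparr>carrier := H\<rparr>" using sH by (rule subgroup.subgroup_is_group) (rule is_group)
    have "n [^]\<^bsub>G\<lparr>carrier := H\<rparr>\<^esub> p = \<one>\<^bsub>G\<lparr>carrier := H\<rparr>\<^esub>"
      using T.pow_order_eq_1[of n] n H(2) by (simp add: order_def)
    then show ?thesis by (simp add: nat_pow_consistent[symmetric])
  qed
  let ?M = "{n \<in> N. n [^] p = \<one>}"
  have "subgroup ?M G"
  proof (rule subgroupI)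
    show "?M \<subseteq> carrier G" using NG by auto
    show "?M \<noteq> {}" using one by auto
    show "inv a \<in> ?M" if "a \<in> ?M" for a
      using that NG subgroup.m_inv_closed[OF sN] by (auto simp: nat_pow_inv)
    show "a \<otimes> b \<in> ?M" if a: "a \<in> ?M" and b: "b \<in> ?M" for a b
    proof -
      have "a \<otimes> b = b \<otimes> a" using ab a b by simp
      then have "(a \<otimes> b) [^] p = a [^] p \<otimes> b [^] p" using a b NG by (intro pow_mult_distrib) auto
      then show ?thesis using a b subgroup.m_closed[OF sN] by simp
    qed
  qed
  moreover have "cj g n \<in> ?M" if g: "g \<in> carrier G" and n: "n \<in> ?M" for g n
  proof -
    have nG: "n \<in> carrier G" using n NG by simp
    have "cj g n [^] q = cj g (n [^] q)" for q :: nat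
      by (induction q) (use g nG in \<open>auto simp: cj_mult\<close>)
    then show ?thesis using nrm_cj[OF nN g] n g by simp
  qed
  ultimately have "nrm (carrier G) ?M" by (simp add: nrm_def)
  moreover have "?M \<subseteq> N" by auto
  ultimately have "?M = {\<one>} \<or> ?M = N" using min unfolding min_nrm_def by metis
  moreover have "?M \<noteq> {\<one>}"
  proof
    assume M: "?M = {\<one>}"
    have "H \<subseteq> ?M" using Hp HN by blast
    then have "card H \<le> card {\<one>}" unfolding M by (intro card_mono) auto
    then show False using H(2) prime_ge_2_nat[OF p(1)] by simp
  qed
  ultimately have "?M = N" by simp
  then have "\<forall>n\<in>N. n [^] p = \<one>" by blast
  then show ?thesis using p(1) by blast
qed

text \<open>An abelian N acts regularly, so the points correspond to N and, by a basis, to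
  \<open>fp_space p d\<close> with \<alpha> as origin. From
  \<open>g (n \<alpha>) = (g n g^-1) (g \<alpha>)\<close> the linear part of g is conjugation and
  its translation part is g\<alpha>; the elements of N become the translations.\<close>

lemma abelian_min_normal_affine:
  assumes min: "min_nrm (carrier G) N" and ab: "\<And>x y. x \<in> N \<Longrightarrow> y \<in> N \<Longrightarrow> x \<otimes> y = y \<otimes> x"
    and \<alpha>: "\<alpha> \<in> P"
  shows "\<exists>p d H \<psi> f. prime p \<and> d \<ge> 1 \<and> subgroup H (BijGroup (fp_space p d)) \<and>
    fp_translations d p \<subseteq> H \<and> H \<subseteq> AGL d p \<and> \<psi> \<in> iso G (BijGroup (fp_space p d) \<lparr>carrier := H\<rparr>) \<and>
    bij_betw f P (fp_space p d) \<and> (\<forall>g\<in>carrier G. \<forall>x\<in>P. f (act g x) = \<psi> g (f x))"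
proof -
  have nN: "nrm (carrier G) N" and N1: "N \<noteq> {\<one>}" using min by (auto simp: min_nrm_def)
  have sN: "subgroup N G" using nN by (rule nrm_subgroup)
  have NG: "n \<in> carrier G" if "n \<in> N" for n using subgroup.mem_carrier[OF sN that] .
  have finN: "finite N" using finite_G sN by (meson finite_subset subgroup.subset)
  obtain p where p: "prime (p::nat)" "\<forall>n\<in>N. n [^] p = \<one>" using abelian_min_normal_exponent[OF min ab] by blast
  interpret E: elementary_abelian G N p
    using sN finN p ab is_group by (simp add: elementary_abelian_def elementary_abelian_axioms_def)
  obtain d b where b': "\<forall>i. b i \<in> N" and bij: "bij_betw (pw d b) (E.V d) N" using E.ex_basis by blast
  have b: "b i \<in> N" for i using b' by simp
  define V where "V = fp_space p d"
  have VV: "E.V d = V" by (simp add: V_def E.V_def)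
  have inj: "inj_on (pw d b) V" and img: "pw d b ` V = N" using bij by (auto simp: bij_betw_def VV)
  have pwN: "pw d b x \<in> N" for x using E.pw_N[of d b] b by simp
  have pwG: "pw d b x \<in> carrier G" for x using NG[OF pwN] .
  define red where "red x = (\<lambda>i\<in>{..<d}. x i mod p)" for x :: "nat \<Rightarrow> nat"
  have redV: "red x \<in> V" for x using E.restrict_V[of x d] by (simp add: red_def VV)
  have pw_red: "pw d b (red x) = pw d b x" for x unfolding red_def using E.pw_restrict[of d b x] b by simp
  have d1: "d \<ge> 1"
  proof (rule ccontr)
    assume "\<not> d \<ge> 1"
    then have "d = 0" by simp
    then have "N \<subseteq> {\<one>}" using img by auto
    then show False using N1 subgroup.one_closed[OF sN] by auto
  qed
  define e where "e x = act (pw d b x) \<alpha>" for x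
  have reg: "m = n" if "m \<in> N" "n \<in> N" "act m \<alpha> = act n \<alpha>" for m n
  proof -
    have "inv m \<otimes> n = \<one>"
    proof (rule centralizer_semiregular[OF nN N1 _ _ \<alpha>])
      have iN: "inv m \<otimes> n \<in> N" using that sN by (simp add: subgroup.m_closed subgroup.m_inv_closed)
      show "inv m \<otimes> n \<in> carrier G" using NG[OF iN] .
      show "inv m \<otimes> n \<otimes> y = y \<otimes> (inv m \<otimes> n)" if "y \<in> N" for y using ab[OF iN that] .
      show "act (inv m \<otimes> n) \<alpha> = \<alpha>" using act_eq_act_iff[of m n \<alpha>] that NG \<alpha> by simp
    qed
    then show ?thesis using that NG by (metis inv_closed inv_equality inv_inv)
  qed
  have ebij: "bij_betw e V P"
  proof -
    have "inj_on e V"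
    proof (rule inj_onI)
      fix x y assume xy: "x \<in> V" "y \<in> V" "e x = e y"
      then have "pw d b x = pw d b y" using reg[OF pwN pwN] by (simp add: e_def)
      then show "x = y" using inj_onD[OF inj] xy by blast
    qed
    moreover have "e ` V = P"
    proof (intro equalityI subsetI)
      show "y \<in> P" if "y \<in> e ` V" for y using that act_in[OF pwG \<alpha>] by (auto simp: e_def)
      fix y assume "y \<in> P"
      then obtain n where n: "n \<in> N" "act n \<alpha> = y" using normal_transitive[OF nN N1 \<alpha>] by blast
      then obtain x where x: "x \<in> V" "n = pw d b x" unfolding img[symmetric] by (rule_tac imageE) auto
      then show "y \<in> e ` V" using n by (auto simp: e_def)
    qed
    ultimately show ?thesis by (simp add: bij_betw_def)
  qed
  have eP: "e x \<in> P" for x using act_in[OF pwG \<alpha>] by (simp add: e_def)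
  define f where "f = inv_into V e"
  have fbij: "bij_betw f P V" unfolding f_def using ebij by (rule bij_betw_inv_into)
  have fe: "f (e x) = x" if "x \<in> V" for x unfolding f_def using ebij that by (rule bij_betw_inv_into_left)
  have ef: "e (f y) = y" if "y \<in> P" for y unfolding f_def using ebij that by (rule bij_betw_inv_into_right)
  have fV: "f y \<in> V" if "y \<in> P" for y using fbij that by (auto simp: bij_betw_def)
  define \<psi> where "\<psi> g = (\<lambda>x\<in>V. f (act g (e x)))" for g
  have \<psi>f: "f (act g y) = \<psi> g (f y)" if "y \<in> P" for g y using fV[OF that] ef[OF that] by (simp add: \<psi>_def)
  have \<psi>bij: "\<psi> g \<in> Bij V" if g: "g \<in> carrier G" for g
  proof -
    have "bij_betw (f \<circ> (act g \<circ> e)) V V"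
      by (rule bij_betw_trans[OF bij_betw_trans[OF ebij act_bij[OF g]] fbij])
    then have "bij_betw (\<lambda>x. f (act g (e x))) V V" by (simp add: comp_def)
    then show ?thesis unfolding \<psi>_def Bij_def by (simp add: bij_betw_restrict_eq)
  qed
  interpret B: group "BijGroup V" by (rule group_BijGroup)
  have \<psi>hom: "\<psi> (g \<otimes> h) = \<psi> g \<otimes>\<^bsub>BijGroup V\<^esub> \<psi> h" if gh: "g \<in> carrier G" "h \<in> carrier G" for g h
  proof -
    have "\<psi> g \<otimes>\<^bsub>BijGroup V\<^esub> \<psi> h = compose V (\<psi> g) (\<psi> h)" using \<psi>bij gh by (simp add: BijGroup_def)
    also have "\<dots> = \<psi> (g \<otimes> h)"
    proof
      fix x
      show "compose V (\<psi> g) (\<psi> h) x = \<psi> (g \<otimes> h) x"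
      proof (cases "x \<in> V")
        case True
        have hP: "act h (e x) \<in> P" using act_in[OF gh(2) eP] .
        have "compose V (\<psi> g) (\<psi> h) x = \<psi> g (f (act h (e x)))" using True by (simp add: compose_def \<psi>_def)
        also have "\<dots> = f (act g (act h (e x)))" using \<psi>f[OF hP] by simp
        also have "\<dots> = \<psi> (g \<otimes> h) x" using True act_mult[OF gh eP] by (simp add: \<psi>_def)
        finally show ?thesis .
      qed (simp add: compose_def \<psi>_def)
    qed
    finally show ?thesis by simp
  qed
  interpret h: group_hom G "BijGroup V" \<psi>
    using \<psi>bij \<psi>hom by unfold_locales (auto simp: hom_def BijGroup_def)
  define H where "H = \<psi> ` carrier G"
  have sub: "subgroup H (BijGroup V)" unfolding H_def by (rule h.img_is_subgroup)
  have "inj_on \<psi> (carrier G)"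
  proof (rule inj_onI)
    fix g g' assume gg: "g \<in> carrier G" "g' \<in> carrier G" "\<psi> g = \<psi> g'"
    have "inv g \<otimes> g' = \<one>"
    proof (rule faithful)
      fix y assume y: "y \<in> P"
      have "f (act g y) = f (act g' y)" using \<psi>f[OF y] gg(3) by simp
      then have "act g y = act g' y" using ef act_in gg y by metis
      then show "act (inv g \<otimes> g') y = y" using act_eq_act_iff gg y by simp
    qed (use gg in simp)
    then show "g = g'" using gg by (metis inv_closed inv_equality inv_inv)
  qed
  then have iso: "\<psi> \<in> iso G (BijGroup V\<lparr>carrier := H\<rparr>)"
    using \<psi>hom by (auto simp: iso_def hom_def bij_betw_def H_def)
  have affV: "fp_affine_map p d A c = (\<lambda>x\<in>V. red (\<lambda>i. (\<Sum>j<d. A i j * x j) + c i))" for A c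
    by (simp add: fp_affine_map_def V_def red_def)
  have agl: "\<psi> g \<in> AGL d p" if g: "g \<in> carrier G" for g
  proof -
    have cjN: "cj g (b j) \<in> N" for j using nrm_cj[OF nN g b] .
    have "\<exists>a. cj g (b j) = pw d b a" for j using cjN[of j] unfolding img[symmetric] by auto
    then obtain A' where A': "\<And>j. cj g (b j) = pw d b (A' j)" by metis
    \<comment> \<open>Column j holds the coordinates of the conjugate of the j-th basis element, and
      c those of the image of the origin.\<close>
    define A where "A i j = A' j i" for i j
    define c where "c = f (act g \<alpha>)"
    have ec: "act (pw d b c) \<alpha> = act g \<alpha>" using ef[OF act_in[OF g \<alpha>]] by (simp add: c_def e_def)
    have lin: "pw d b (\<lambda>i. \<Sum>j<m. A i j * x j) = pw m (\<lambda>j. cj g (b j)) x" for m x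
    proof (induction m)
      case 0
      then show ?case using pw_zero[of d b] NG[OF b] by simp
    next
      case (Suc m)
      have "pw d b (\<lambda>i. \<Sum>j<Suc m. A i j * x j) = pw d b (\<lambda>i. \<Sum>j<m. A i j * x j) \<otimes> pw d b (\<lambda>i. A i m * x m)"
        using E.pw_add[of d b "\<lambda>i. \<Sum>j<m. A i j * x j" "\<lambda>i. A i m * x m"] b by simp
      also have "pw d b (\<lambda>i. A i m * x m) = cj g (b m) [^] x m"
        using E.pw_times[of d b "A' m" "x m"] b A'[of m] by (simp add: A_def)
      finally show ?case using Suc by simp
    qed
    have cjpw: "cj g (pw m b x) = pw m (\<lambda>j. cj g (b j)) x" for m x
    proof (induction m)
      case (Suc m)
      have "cj g (b m [^] q) = cj g (b m) [^] q" for q :: nat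
        by (induction q) (use g NG[OF b] in \<open>auto simp: cj_mult\<close>)
      then show ?case using Suc g NG[OF b] pw_closed[of m b x] by (simp add: cj_mult)
    qed (use g in simp)
    have "\<psi> g = fp_affine_map p d A c"
    proof
      fix x
      show "\<psi> g x = fp_affine_map p d A c x"
      proof (cases "x \<in> V")
        case True
        let ?u = "red (\<lambda>i. (\<Sum>j<d. A i j * x j) + c i)"
        have "e ?u = act (cj g (pw d b x) \<otimes> pw d b c) \<alpha>"
          unfolding e_def pw_red using E.pw_add[of d b "\<lambda>i. \<Sum>j<d. A i j * x j" c] b lin[where m = d] cjpw[where m = d] by simp
        also have "\<dots> = act (cj g (pw d b x)) (act g \<alpha>)"
          using act_mult[OF _ pwG \<alpha>] cj_closed[OF g pwG] ec by simp
        also have "\<dots> = act g (e x)" using act_cj[OF g pwG \<alpha>] by (simp add: e_def)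
        finally have "?u = f (act g (e x))" using fe[OF redV] by metis
        then show ?thesis using True by (simp add: \<psi>_def affV)
      qed (simp add: \<psi>_def affV)
    qed
    then show ?thesis using \<psi>bij[OF g] unfolding AGL_def V_def by blast
  qed
  have tr: "fp_translations d p \<subseteq> H"
  proof
    fix t assume "t \<in> fp_translations d p"
    then obtain c where t: "t = fp_affine_map p d (\<lambda>i j. if i = j then 1 else 0) c" by (auto simp: fp_translations_def)
    have "t = \<psi> (pw d b c)"
    proof
      fix x
      show "t x = \<psi> (pw d b c) x"
      proof (cases "x \<in> V")
        case True
        have s: "red (\<lambda>i. (\<Sum>j<d. (if i = j then 1 else 0) * x j) + c i) = red (\<lambda>i. c i + x i)"
        proof -
          have "(\<Sum>j<d. (if i = j then 1 else 0) * x j) = x i" if "i < d" for i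
          proof -
            have "(\<Sum>j<d. (if i = j then 1 else 0) * x j) = (\<Sum>j<d. if i = j then x j else 0)" by (rule sum.cong) auto
            then show ?thesis using that by simp
          qed
          then show ?thesis unfolding red_def by (intro restrict_ext) (simp add: add.commute)
        qed
        have "e (red (\<lambda>i. c i + x i)) = act (pw d b c \<otimes> pw d b x) \<alpha>"
          unfolding e_def pw_red using E.pw_add[of d b c x] b by simp
        also have "\<dots> = act (pw d b c) (e x)" using act_mult[OF pwG pwG \<alpha>] by (simp add: e_def)
        finally have "red (\<lambda>i. c i + x i) = f (act (pw d b c) (e x))" using fe[OF redV] by metis
        then show ?thesis using True s unfolding t affV by (simp add: \<psi>_def)
      qed (simp add: \<psi>_def t affV)
    qed
    then show "t \<in> H" using pwG by (simp add: H_def)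
  qed
  have "H \<subseteq> AGL d p" using agl by (auto simp: H_def)
  then show ?thesis
    using p(1) d1 sub tr iso fbij \<psi>f unfolding V_def by blast
qed

end

section \<open>Transfer of the abstract results to permutation groups on the points\<close>

theorem theorem1p2:
  fixes P :: "'a set" and \<B> :: "'a set set" and G :: "('a \<Rightarrow> 'a) set" and v k :: nat
  assumes "nontrivial_steiner_3_design v k P \<B>"
    and "subgroup G (design_Aut P \<B>)"
    and "transitive_action (design_Aut P \<B> \<lparr>carrier := G\<rparr>) \<B> (block_action \<B>)"
    and "primitive_action (design_Aut P \<B> \<lparr>carrier := G\<rparr>) P (\<lambda>g. g)"
  shows "affine_type (design_Aut P \<B> \<lparr>carrier := G\<rparr>) P \<or>
         almost_simple_type (design_Aut P \<B> \<lparr>carrier := G\<rparr>)"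
proof -
  define \<G> where "\<G> = design_Aut P \<B> \<lparr>carrier := G\<rparr>"
  interpret S: steiner3 v k P \<B> by unfold_locales fact
  have grp: "group \<G>" unfolding \<G>_def
    by (rule subgroup.subgroup_is_group[OF assms(2) group_design_Aut[OF S.finP S.blockP]])
  have cG: "carrier \<G> = G" by (simp add: \<G>_def)
  have GA: "g \<in> Bij P \<and> (\<forall>B\<in>\<B>. g ` B \<in> \<B>)" if "g \<in> G" for g
    using subgroup.mem_carrier[OF assms(2) that] by (simp add: design_Aut_def)
  have oneG: "\<one>\<^bsub>\<G>\<^esub> = (\<lambda>x\<in>P. x)" by (simp add: \<G>_def design_Aut_def BijGroup_def)
  have multG: "g \<otimes>\<^bsub>\<G>\<^esub> h = compose P g h" if "g \<in> G" "h \<in> G" for g h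
    using GA that by (simp add: \<G>_def design_Aut_def BijGroup_def)
  have gP: "g x \<in> P" if "g \<in> G" "x \<in> P" for g x
    using GA[OF that(1)] that(2) by (auto simp: Bij_def bij_betw_def)
  have finBij: "finite (Bij P)"
  proof (rule finite_subset)
    show "Bij P \<subseteq> P \<rightarrow>\<^sub>E P" by (auto simp: Bij_def PiE_def bij_betw_def)
    show "finite (P \<rightarrow>\<^sub>E P)" using S.finP by (simp add: finite_PiE)
  qed
  have tr: "transitive_action \<G> P (\<lambda>g. g)"
    and pr: "\<And>D. D \<subseteq> P \<Longrightarrow> D \<noteq> {} \<Longrightarrow> (\<forall>g\<in>carrier \<G>. g ` D = D \<or> g ` D \<inter> D = {}) \<Longrightarrow> card D = 1 \<or> D = P"
    using assms(4) unfolding primitive_action_def \<G>_def[symmetric] by blast+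
  interpret group \<G> by (rule grp)
  interpret D: design_group v k P \<B> \<G> "\<lambda>g. g"
  proof unfold_locales
    show "finite (carrier \<G>)" unfolding cG by (rule finite_subset[OF _ finBij]) (use GA in auto)
    show "finite P" by (rule S.finP)
    show "g x \<in> P" if "g \<in> carrier \<G>" "x \<in> P" for g x using gP that cG by simp
    show "(g \<otimes>\<^bsub>\<G>\<^esub> h) x = g (h x)" if "g \<in> carrier \<G>" "h \<in> carrier \<G>" "x \<in> P" for g h x
      using multG that cG by (simp add: compose_def)
    show "\<one>\<^bsub>\<G>\<^esub> x = x" if "x \<in> P" for x using that oneG by simp
    show "g = \<one>\<^bsub>\<G>\<^esub>" if g: "g \<in> carrier \<G>" and e: "\<And>x. x \<in> P \<Longrightarrow> g x = x" for g
    proof -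
      have "g \<in> extensional P" using GA g cG by (auto simp: Bij_def)
      then show ?thesis unfolding oneG by (rule extensionalityI[of _ P]) (use e in auto)
    qed
    show "\<exists>g\<in>carrier \<G>. g x = y" if "x \<in> P" "y \<in> P" for x y
      using transitive_action.unique_orbit[OF tr that] .
    show "card D = 1 \<or> D = P" if "D \<subseteq> P" "D \<noteq> {}" "\<And>g. g \<in> carrier \<G> \<Longrightarrow> g ` D = D \<or> g ` D \<inter> D = {}" for D
      using pr[OF that(1,2)] that(3) by blast
    show "g ` B \<in> \<B>" if "g \<in> carrier \<G>" "B \<in> \<B>" for g B using GA that cG by simp
    show "\<exists>g\<in>carrier \<G>. g ` B = C" if "B \<in> \<B>" "C \<in> \<B>" for B C
      using transitive_action.unique_orbit[OF assms(3) that] that by (auto simp: \<G>_def block_action_def)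
  qed
  obtain \<alpha> where \<alpha>: "\<alpha> \<in> P" using S.nonempty by blast
  have nG: "nrm (carrier \<G>) (carrier \<G>)" using subgroup_self by (simp add: nrm_def)
  have "carrier \<G> \<noteq> {\<one>\<^bsub>\<G>\<^esub>}"
  proof
    assume c: "carrier \<G> = {\<one>\<^bsub>\<G>\<^esub>}"
    have "y = \<alpha>" if "y \<in> P" for y
    proof -
      obtain g where "g \<in> carrier \<G>" "g \<alpha> = y" using D.trans[OF \<alpha> \<open>y \<in> P\<close>] by blast
      then show ?thesis using c D.act_one[OF \<alpha>] by simp
    qed
    then have "P \<subseteq> {\<alpha>}" by (metis singletonI subsetI)
    then have "card P \<le> 1" using card_mono[of "{\<alpha>}" P] by simp
    then show False using S.cardP S.kv by simp
  qed
  then obtain N where N: "min_nrm (carrier \<G>) N" using ex_min_nrm[OF D.finite_G nG] by blast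
  show ?thesis
  proof (cases "\<forall>x\<in>N. \<forall>y\<in>N. x \<otimes>\<^bsub>\<G>\<^esub> y = y \<otimes>\<^bsub>\<G>\<^esub> x")
    case True
    then have "affine_type \<G> P"
      using D.abelian_min_normal_affine[OF N _ \<alpha>] unfolding affine_type_def perm_isomorphic_def by blast
    then show ?thesis by (simp add: \<G>_def)
  next
    case False
    have nN: "nrm (carrier \<G>) N" and N1: "N \<noteq> {\<one>\<^bsub>\<G>\<^esub>}" using N by (auto simp: min_nrm_def)
    have sN: "subgroup N \<G>" using nN by (rule nrm_subgroup)
    have "finite N" using D.finite_G sN by (meson finite_subset subgroup.subset)
    moreover have "nrm N N" by (rule nrm_mono[OF nN subgroup.subset[OF sN]])
    ultimately obtain T where T: "min_nrm N T" "T \<subseteq> N" using ex_min_nrm[OF _ _ N1] by blast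
    interpret M: design_min v k P \<B> \<G> "\<lambda>g. g" N T \<alpha>
      by unfold_locales (use D.finite_G N False T \<alpha> in auto)
    have "almost_simple_type \<G>"
    proof (rule almost_simple_typeI[OF grp D.finite_G nN N1])
      show "M = {\<one>\<^bsub>\<G>\<^esub>} \<or> M = N" if "nrm N M" "M \<subseteq> N" for M
        using T(1) that M.socle_simple(1) by (simp add: min_nrm_def)
      show "\<exists>x\<in>N. \<exists>y\<in>N. x \<otimes>\<^bsub>\<G>\<^esub> y \<noteq> y \<otimes>\<^bsub>\<G>\<^esub> x" using False by blast
      show "c = \<one>\<^bsub>\<G>\<^esub>" if "c \<in> carrier \<G>" "\<And>n. n \<in> N \<Longrightarrow> c \<otimes>\<^bsub>\<G>\<^esub> n = n \<otimes>\<^bsub>\<G>\<^esub> c" for c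
        by (rule M.socle_simple(2)[OF that])
    qed
    then show ?thesis by (simp add: \<G>_def)
  qed
qed

end
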